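(* For every $\epsilon>0$ there is a randomized algorithm for Perfect Binary Tree Labeling that in time $|L|^{O(1/\epsilon)}\cdot\mathrm{poly}(n,m,d)$ finds a valid labeling $\boldsymbol\ell$ with $Ax^{(\boldsymbol\ell)}\le O\!\left(\frac{n^\epsilon}{\epsilon}\log m\right)\cdot\mathbf 1$, assuming there exists a valid labeling $\boldsymbol\ell^*$ with $Ax^{(\boldsymbol\ell^* )}\le\mathbf 1$.
   Context: Perfect Binary Tree Labeling: given a perfect binary tree $T=(V,E)$ of height $H$ with root $r$ and $n=2^H$ leaves, a finite set $L$ of labels, a label $\ell^\circ\in L$, vectors $x^{(\ell)}\in\mathbb Z_{\ge0}^d$ for $\ell\in L$, a set $\Gamma\subseteq L\times L\times L$ of allowed triples, a matrix $A\in[0,1]^{m\times d}$ and a cost vector $c$. A valid labeling $\boldsymbol\ell=(\ell_v)_{v\in V}$ satisfies $\ell_r=\ell^\circ$ and, for every non-leaf $v$ with left child $u$ and right child $w$, $(\ell_v,\ell_u,\ell_w)\in\Gamma$. Its solution vector is $x^{(\boldsymbol\ell)}=\sum_{\text{leaves } v}x^{(\ell_v)}$. The goal is a valid labeling with $Ax^{(\boldsymbol\ell)}\le\mathbf 1$ minimizing $c^{\mathsf T}x^{(\boldsymbol\ell)}$. *)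

theory Defs
  imports "HOL-Probability.Probability" "Jordan_Normal_Form.Matrix"
begin

section \<open>Perfect Binary Tree Labeling\<close>

text \<open>
  An algorithm sees labels only through their numbers, so the label set \<open>L\<close> is
  \<open>{..<num_labels}\<close>. The numbers \<open>m\<close> and \<open>d\<close> are the dimensions of the constraint matrix.
\<close>

record pbtl =
  height :: nat
  num_labels :: nat
  root_label :: nat
  lvec :: "nat \<Rightarrow> nat vec"
  triples :: "(nat \<times> nat \<times> nat) set"
  constr :: "real mat"
  cost :: "real vec"

definition labels :: "pbtl \<Rightarrow> nat set" where
  "labels P = {..<num_labels P}"

definition nrows :: "pbtl \<Rightarrow> nat" where
  "nrows P = dim_row (constr P)"

definition ncols :: "pbtl \<Rightarrow> nat" where
  "ncols P = dim_col (constr P)"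

definition num_leaves :: "pbtl \<Rightarrow> nat" where
  "num_leaves P = 2 ^ height P"

definition wf_pbtl :: "pbtl \<Rightarrow> bool" where
  "wf_pbtl P \<longleftrightarrow>
     root_label P \<in> labels P \<and>
     (\<forall>l\<in>labels P. lvec P l \<in> carrier_vec (ncols P)) \<and>
     triples P \<subseteq> labels P \<times> labels P \<times> labels P \<and>
     (\<forall>i<nrows P. \<forall>j<ncols P. 0 \<le> constr P $$ (i, j) \<and> constr P $$ (i, j) \<le> 1) \<and>
     cost P \<in> carrier_vec (ncols P)"

text \<open>
  The perfect binary tree of height \<open>H\<close> in heap order: the root is \<open>1\<close>, and a non-leaf \<open>v\<close>
  has left child \<open>2 * v\<close> and right child \<open>2 * v + 1\<close>.
\<close>

definition vertices :: "pbtl \<Rightarrow> nat set" where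
  "vertices P = {1..<2 * num_leaves P}"

definition inner_vertices :: "pbtl \<Rightarrow> nat set" where
  "inner_vertices P = {1..<num_leaves P}"

definition leaves :: "pbtl \<Rightarrow> nat set" where
  "leaves P = {num_leaves P..<2 * num_leaves P}"

definition valid_labeling :: "pbtl \<Rightarrow> (nat \<Rightarrow> nat) \<Rightarrow> bool" where
  "valid_labeling P lab \<longleftrightarrow>
     (\<forall>v\<in>vertices P. lab v \<in> labels P) \<and>
     lab 1 = root_label P \<and>
     (\<forall>v\<in>inner_vertices P. (lab v, lab (2 * v), lab (2 * v + 1)) \<in> triples P)"

definition solution_vec :: "pbtl \<Rightarrow> (nat \<Rightarrow> nat) \<Rightarrow> nat vec" where
  "solution_vec P lab = vec (ncols P) (\<lambda>j. \<Sum>v\<in>leaves P. lvec P (lab v) $ j)"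

text \<open>\<open>load_le P b lab\<close> is the componentwise inequality \<open>A x \<le> b \<cdot> 1\<close> for the solution vector.\<close>

definition load_le :: "pbtl \<Rightarrow> real \<Rightarrow> (nat \<Rightarrow> nat) \<Rightarrow> bool" where
  "load_le P b lab \<longleftrightarrow>
     constr P *\<^sub>v map_vec real (solution_vec P lab) \<le> b \<cdot>\<^sub>v vec (nrows P) (\<lambda>_. 1)"


section \<open>Randomized algorithms: a unit-cost real RAM\<close>

text \<open>
  The entries of \<open>A\<close> are real numbers and running times are measured in \<open>n\<close>, \<open>m\<close>, \<open>d\<close> and
  \<open>|L|\<close> only, not in the encoding length of the numbers. The machine model is therefore a real
  RAM: a while language over natural and real registers and arrays in which every instruction
  and every test costs one step. The usual precautions are taken to keep unit cost honest.
  Natural numbers can only be added, subtracted (truncated) and compared, so that after \<open>t\<close>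
  steps they have \<open>O(t)\<close> bits more than the input. Reals admit the four field operations and
  comparison, but no rounding and no other conversion into natural numbers. The only constants
  in programs are natural numbers.
\<close>

type_synonym name = string

record state =
  nvar :: "name \<Rightarrow> nat"
  rvar :: "name \<Rightarrow> real"
  narr :: "name \<Rightarrow> nat \<Rightarrow> nat"
  rarr :: "name \<Rightarrow> nat \<Rightarrow> real"

datatype instr =
    NConst name nat
  | NAdd name name name
  | NSub name name name
  | NLoad name name name
  | NStore name name name
  | ROfNat name name
  | RAdd name name name
  | RSub name name name
  | RMul name name name
  | RDiv name name name
  | RLoad name name name
  | RStore name name name
  | Flip name name

datatype test = NLess name name | RLess name name

datatype com =
    Do instr
  | Seq com com
  | If test com com
  | While test com

text \<open>
  \<open>NLoad x a i\<close> is \<open>x := a[i]\<close> and \<open>NStore a i x\<close> is \<open>a[i] := x\<close>. \<open>Flip x p\<close> sets \<open>x\<close> to \<open>1\<close>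
  with probability \<open>p\<close> and to \<open>0\<close> otherwise; \<^const>\<open>bernoulli_pmf\<close> clips \<open>p\<close> to the unit interval.
\<close>

fun exec :: "instr \<Rightarrow> state \<Rightarrow> state pmf" where
  "exec (NConst x k) s = return_pmf (s\<lparr>nvar := (nvar s)(x := k)\<rparr>)"
| "exec (NAdd x y z) s = return_pmf (s\<lparr>nvar := (nvar s)(x := nvar s y + nvar s z)\<rparr>)"
| "exec (NSub x y z) s = return_pmf (s\<lparr>nvar := (nvar s)(x := nvar s y - nvar s z)\<rparr>)"
| "exec (NLoad x a i) s = return_pmf (s\<lparr>nvar := (nvar s)(x := narr s a (nvar s i))\<rparr>)"
| "exec (NStore a i x) s =
     return_pmf (s\<lparr>narr := (narr s)(a := (narr s a)(nvar s i := nvar s x))\<rparr>)"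
| "exec (ROfNat x y) s = return_pmf (s\<lparr>rvar := (rvar s)(x := real (nvar s y))\<rparr>)"
| "exec (RAdd x y z) s = return_pmf (s\<lparr>rvar := (rvar s)(x := rvar s y + rvar s z)\<rparr>)"
| "exec (RSub x y z) s = return_pmf (s\<lparr>rvar := (rvar s)(x := rvar s y - rvar s z)\<rparr>)"
| "exec (RMul x y z) s = return_pmf (s\<lparr>rvar := (rvar s)(x := rvar s y * rvar s z)\<rparr>)"
| "exec (RDiv x y z) s = return_pmf (s\<lparr>rvar := (rvar s)(x := rvar s y / rvar s z)\<rparr>)"
| "exec (RLoad x a i) s = return_pmf (s\<lparr>rvar := (rvar s)(x := rarr s a (nvar s i))\<rparr>)"
| "exec (RStore a i x) s =
     return_pmf (s\<lparr>rarr := (rarr s)(a := (rarr s a)(nvar s i := rvar s x))\<rparr>)"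
| "exec (Flip x p) s =
     map_pmf (\<lambda>b. s\<lparr>nvar := (nvar s)(x := of_bool b)\<rparr>) (bernoulli_pmf (rvar s p))"

fun holds :: "test \<Rightarrow> state \<Rightarrow> bool" where
  "holds (NLess x y) s \<longleftrightarrow> nvar s x < nvar s y"
| "holds (RLess x y) s \<longleftrightarrow> rvar s x < rvar s y"

text \<open>
  Small-step semantics on a stack of commands still to be executed; the machine has halted when
  the stack is empty.
\<close>

fun step :: "com list \<times> state \<Rightarrow> (com list \<times> state) pmf" where
  "step ([], s) = return_pmf ([], s)"
| "step (Do i # K, s) = map_pmf (Pair K) (exec i s)"
| "step (Seq c c' # K, s) = return_pmf (c # c' # K, s)"
| "step (If b c c' # K, s) = return_pmf ((if holds b s then c else c') # K, s)"
| "step (While b c # K, s) = return_pmf (if holds b s then c # While b c # K else K, s)"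

fun run :: "com \<Rightarrow> nat \<Rightarrow> state \<Rightarrow> (com list \<times> state) pmf" where
  "run c 0 s = return_pmf ([c], s)"
| "run c (Suc t) s = bind_pmf (run c t s) step"

definition halts_within :: "com \<Rightarrow> nat \<Rightarrow> state \<Rightarrow> bool" where
  "halts_within c t s \<longleftrightarrow> (\<forall>(K, s')\<in>set_pmf (run c t s). K = [])"

definition success_prob :: "com \<Rightarrow> nat \<Rightarrow> state \<Rightarrow> (state \<Rightarrow> bool) \<Rightarrow> real" where
  "success_prob c t s Q = measure_pmf.prob (run c t s) {(K, s'). K = [] \<and> Q s'}"


section \<open>Input and output\<close>

definition array_of :: "'a::zero list \<Rightarrow> nat \<Rightarrow> 'a" where
  "array_of xs i = (if i < length xs then xs ! i else 0)"

text \<open>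
  The allowed triples are given by their characteristic function; this table and the two matrices
  are laid out in row-major order. All registers and array cells not mentioned are \<open>0\<close>.
\<close>

definition input_state :: "pbtl \<Rightarrow> state" where
  "input_state P =
     (let q = num_labels P; m = nrows P; d = ncols P in
      \<lparr>nvar = (\<lambda>_. 0)(''H'' := height P, ''q'' := q, ''root'' := root_label P, ''m'' := m, ''d'' := d),
       rvar = (\<lambda>_. 0),
       narr = (\<lambda>_ _. 0)(''Gamma'' :=
         array_of [of_bool ((a, b, c) \<in> triples P). a \<leftarrow> [0..<q], b \<leftarrow> [0..<q], c \<leftarrow> [0..<q]]),
       rarr = (\<lambda>_ _. 0)(
         ''A'' := array_of [constr P $$ (i, j). i \<leftarrow> [0..<m], j \<leftarrow> [0..<d]],
         ''x'' := array_of [real (lvec P l $ j). l \<leftarrow> [0..<q], j \<leftarrow> [0..<d]],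
         ''c'' := array_of [cost P $ j. j \<leftarrow> [0..<d]])\<rparr>)"

definition output_labeling :: "state \<Rightarrow> nat \<Rightarrow> nat" where
  "output_labeling s = narr s ''label''"

end

theory Submission
  imports Defs
begin

text \<open>
  The algorithm is deterministic. Cut the tree into \<open>O(1/\<epsilon>)\<close> layers of height about
  \<open>\<epsilon> H\<close> and strengthen the natural linear program: conditionally on the labels of the cut
  ancestors of a cut vertex, the load below that vertex is at most \<open>1\<close>. A labeling whose labels
  record the labels at the cut ancestors uses \<open>|L| ^ O(1/\<epsilon>)\<close> codes, and a cheapest such labeling
  for given nonnegative weights of the conditional constraints is found by dynamic programming.
  Repeating this best response, with weights equal to the positive parts of the accumulated
  violations, gives a sequence of labelings that satisfies every conditional constraint on average,
  up to an additive error that matters only for codes that occur rarely.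

  Choosing at each vertex the children's codes from a random labeling of the sequence with the same
  code gives a random labeling. Within a layer the conditional loads are at most \<open>O(2 ^ h)\<close>,
  and at each cut they are \<open>O(1)\<close> again; hence the expectation of
  \<open>\<Prod>\<^sub>v (1 + s a\<^sub>v)\<close> over the leaves is at most \<open>2\<close> if \<open>1 / s\<close> is a
  sufficiently large multiple of \<open>2 ^ h\<close> times the number of layers. The choices are made greedily,
  vertex by vertex, so that the sum over the rows of these conditional expectations, plus a penalty for
  rare codes, does not increase. The final value is \<open>O(m)\<close>, and taking logarithms bounds the loads.
\<close>

text \<open>Two obstacles shape the construction. A weight attached to a code at a cut vertex has to
  be charged to the leaves below, and a leaf can price it only if its own code reveals the codes of
  its cut ancestors. Hence codes carry history, and only at cut levels, since each level recorded
  multiplies the number of codes by \<open>q\<close>. Between cuts nothing is controlled: the bound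
  on an expected load doubles with every level above the next cut, which is the origin of
  \<open>2 ^ h\<close>. Secondly, the iteration bounds the total load of the solutions sharing a
  code only up to an additive \<open>theta\<close>, so classes smaller than \<open>theta\<close> are
  uncontrolled. The number \<open>T\<close> of rounds makes the expected number of encounters with
  them at most \<open>1 / B\<close>, and since \<open>B\<close> exceeds \<open>2 * m + 1\<close>, a
  greedy walk with potential below \<open>B\<close> never enters one. Both demands are compatible
  because squared weights grow only linearly: \<open>theta\<close> has to be of the order of the
  square root of \<open>T\<close>, while \<open>T\<close> is linear in \<open>theta\<close>. The
  machine cannot multiply, divide or round natural numbers, so index arithmetic is done by counting
  loops, and \<open>\<epsilon>\<close> enters through a single integer constant of the
  program.\<close>

section \<open>Execution of deterministic program fragments\<close>

primrec run_from :: "nat \<Rightarrow> com list \<times> state \<Rightarrow> (com list \<times> state) pmf" where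
  "run_from 0 x = return_pmf x"
| "run_from (Suc t) x = bind_pmf (step x) (run_from t)"

text \<open>Unlike \<open>run\<close>, which appends steps at the end, this recursion starts from an
  arbitrary stack, so a run can be cut at the moment when the top command has been consumed.\<close>

lemma run_from_add: "run_from (a + b) x = bind_pmf (run_from a x) (run_from b)"
proof (induction a arbitrary: x)
  case (Suc a)
  then have "run_from (a + b) = (\<lambda>x. bind_pmf (run_from a x) (run_from b))" by (rule ext)
  then show ?case by (simp add: bind_assoc_pmf)
qed (simp add: bind_return_pmf)

lemma run_eq_run_from: "run c t s = run_from t ([c], s)"
proof (induction t)
  case (Suc t)
  have *: "run_from 1 = step" 
  proof
    have "run_from 0 = return_pmf" by (rule ext) simp
    then show "run_from 1 x = step x" for x by (simp add: bind_return_pmf')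
  qed
  have "run_from (t + 1) ([c], s) = bind_pmf (run_from t ([c], s)) step"
    unfolding run_from_add * ..
  with Suc show ?case by simp
qed simp

text \<open>The witness \<open>t\<close> is chosen before the continuation \<open>K\<close>: a
  fragment takes the same number of steps in every context, so fragments can be chained. The outcome
  is a point mass, which excludes effective randomness.\<close>

definition runs_in :: "com \<Rightarrow> nat \<Rightarrow> state \<Rightarrow> state \<Rightarrow> bool" where
  "runs_in c N s s' \<longleftrightarrow> (\<exists>t\<le>N. \<forall>K. run_from t (c # K, s) = return_pmf (K, s'))"

lemma runs_in_mono: "runs_in c N s s' \<Longrightarrow> N \<le> N' \<Longrightarrow> runs_in c N' s s'"
  unfolding runs_in_def by (meson order_trans)

lemma runs_in_Do: "exec i s = return_pmf s' \<Longrightarrow> runs_in (Do i) 1 s s'"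
  unfolding runs_in_def by (rule exI[of _ 1]) (simp add: bind_return_pmf)

lemma runs_in_Seq:
  assumes "runs_in c a s s1" "runs_in d b s1 s2" shows "runs_in (Seq c d) (Suc (a + b)) s s2"
proof -
  from assms obtain t u where t: "t \<le> a" "\<And>K. run_from t (c # K, s) = return_pmf (K, s1)"
    and u: "u \<le> b" "\<And>K. run_from u (d # K, s1) = return_pmf (K, s2)"
    unfolding runs_in_def by blast
  have "run_from (Suc (t + u)) (Seq c d # K, s) = return_pmf (K, s2)" for K
    by (simp add: bind_return_pmf run_from_add t(2) u(2))
  with t(1) u(1) show ?thesis unfolding runs_in_def by (intro exI[of _ "Suc (t + u)"]) simp
qed

lemma runs_in_If:
  assumes "runs_in (if holds b s then c else d) N s s'" shows "runs_in (If b c d) (Suc N) s s'"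
proof -
  from assms obtain t where t: "t \<le> N"
    "\<And>K. run_from t ((if holds b s then c else d) # K, s) = return_pmf (K, s')"
    unfolding runs_in_def by blast
  have "run_from (Suc t) (If b c d # K, s) = return_pmf (K, s')" for K
    by (simp add: bind_return_pmf t(2))
  with t(1) show ?thesis unfolding runs_in_def by (intro exI[of _ "Suc t"]) simp
qed

lemma runs_in_While_step:
  assumes "holds b s" "runs_in c a s s1" "runs_in (While b c) N s1 s2"
  shows "runs_in (While b c) (Suc (a + N)) s s2"
proof -
  from assms obtain t u where t: "t \<le> a" "\<And>K. run_from t (c # K, s) = return_pmf (K, s1)"
    and u: "u \<le> N" "\<And>K. run_from u (While b c # K, s1) = return_pmf (K, s2)"
    unfolding runs_in_def by blast
  have "run_from (Suc (t + u)) (While b c # K, s) = return_pmf (K, s2)" for K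
    by (simp add: bind_return_pmf run_from_add t(2) u(2) assms(1))
  with t(1) u(1) show ?thesis unfolding runs_in_def by (intro exI[of _ "Suc (t + u)"]) simp
qed

lemma runs_in_While_stop: "\<not> holds b s \<Longrightarrow> runs_in (While b c) 1 s s"
  unfolding runs_in_def by (rule exI[of _ 1]) (simp add: bind_return_pmf)

text \<open>Induction on the number of iterations left, because a loop unrolls at its front. Every
  round pays one extra step for the test, and so does the exit.\<close>

lemma runs_in_count_loop:
  assumes init: "I 0 s"
    and body: "\<And>i s. i < N \<Longrightarrow> I i s \<Longrightarrow> \<exists>s'. runs_in c a s s' \<and> I (Suc i) s'"
    and test: "\<And>i s. i \<le> N \<Longrightarrow> I i s \<Longrightarrow> holds b s \<longleftrightarrow> i < N"
  shows "\<exists>s'. runs_in (While b c) (N * Suc a + 1) s s' \<and> I N s'"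
proof -
  have "\<exists>s'. runs_in (While b c) (k * Suc a + 1) s s' \<and> I N s'" if "k \<le> N" "I (N - k) s" for k s
    using that
  proof (induction k arbitrary: s)
    case 0
    then show ?case using test[of N s] runs_in_While_stop by auto
  next
    case (Suc k)
    obtain s1 where s1: "runs_in c a s s1" "I (Suc (N - Suc k)) s1"
      using body[of "N - Suc k" s] Suc.prems by auto
    have "Suc (N - Suc k) = N - k" using Suc.prems by simp
    with Suc.IH[of s1] s1 Suc.prems obtain s2 where
      s2: "runs_in (While b c) (k * Suc a + 1) s1 s2" "I N s2" by auto
    have "holds b s" using test[of "N - Suc k" s] Suc.prems by simp
    from runs_in_While_step[OF this s1(1) s2(1)] s2(2) show ?case
      by (auto simp: algebra_simps intro: runs_in_mono)
  qed
  from this[of N s] init show ?thesis by simp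
qed

lemma runs_in_run:
  assumes "runs_in c N s s'" shows "\<exists>t\<le>N. run c t s = return_pmf ([], s')"
  using assms unfolding runs_in_def run_eq_run_from by blast

section \<open>Expressions and structured programs\<close>

datatype rop = ROAdd | ROSub | ROMul | RODiv

text \<open>Sums, minimisers and folds are expressions, so that the algorithm can be written as
  formulas filling tables. Every iteration is bounded by a register.\<close>

datatype nexp =
    NC nat
  | NV name
  | NPlus nexp nexp
  | NMinus nexp nexp
  | NLd name nexp
  | NIf bexp nexp nexp
  | NSum name name nexp
  | NArg name name rexp
and rexp =
    ROf nexp
  | RBin rop rexp rexp
  | RLd name nexp
  | RIf bexp rexp rexp
  | RAgg rop name name rexp rexp
and bexp = BN nexp nexp | BR rexp rexp

record env =
  nv :: "name \<Rightarrow> nat"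
  na :: "name \<Rightarrow> nat \<Rightarrow> nat"
  ra :: "name \<Rightarrow> nat \<Rightarrow> real"

abbreviation bind_nv :: "env \<Rightarrow> name \<Rightarrow> nat \<Rightarrow> env" where
  "bind_nv \<sigma> x i \<equiv> \<sigma>\<lparr>nv := (nv \<sigma>)(x := i)\<rparr>"

primrec rop_fun :: "rop \<Rightarrow> real \<Rightarrow> real \<Rightarrow> real" where
  "rop_fun ROAdd = (+)" | "rop_fun ROSub = (-)" | "rop_fun ROMul = (*)" | "rop_fun RODiv = (/)"

primrec rop_instr :: "rop \<Rightarrow> name \<Rightarrow> name \<Rightarrow> name \<Rightarrow> instr" where
  "rop_instr ROAdd = RAdd" | "rop_instr ROSub = RSub" | "rop_instr ROMul = RMul" | "rop_instr RODiv = RDiv"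

lemma exec_rop_instr:
  "exec (rop_instr r x y z) s = return_pmf (s\<lparr>rvar := (rvar s)(x := rop_fun r (rvar s y) (rvar s z))\<rparr>)"
  by (cases r) simp_all

primrec aggr :: "('a \<Rightarrow> 'b \<Rightarrow> 'a) \<Rightarrow> 'a \<Rightarrow> (nat \<Rightarrow> 'b) \<Rightarrow> nat \<Rightarrow> 'a" where
  "aggr g z f 0 = z"
| "aggr g z f (Suc k) = g (aggr g z f k) (f k)"

lemma aggr_plus: "aggr (+) (z :: 'a::comm_monoid_add) f N = z + (\<Sum>i<N. f i)"
  by (induction N) (simp_all add: add.assoc)

lemma aggr_times: "aggr (*) (z :: 'a::comm_monoid_mult) f N = z * (\<Prod>i<N. f i)"
  by (induction N) (simp_all add: mult.assoc)

text \<open>Ties go to the smallest index and the empty range gives \<open>0\<close>. This makes the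
  choice a function, which the compiled loop reproduces exactly.\<close>

primrec argmin :: "(nat \<Rightarrow> real) \<Rightarrow> nat \<Rightarrow> nat" where
  "argmin f 0 = 0"
| "argmin f (Suc k) = (if f k < f (argmin f k) then k else argmin f k)"

lemma argmin_less: "0 < N \<Longrightarrow> argmin f N < N"
proof (induction N)
  case (Suc k) then show ?case by (cases k) (auto simp: less_Suc_eq)
qed simp

lemma argmin_le: "k < N \<Longrightarrow> f (argmin f N) \<le> f k"
  by (induction N) (auto simp: less_Suc_eq)

lemma argmin_cong: "(\<And>i. i < N \<Longrightarrow> f i = g i) \<Longrightarrow> argmin f N = argmin g N"
proof (induction N)
  case (Suc k)
  have "argmin f k = argmin g k" using Suc by simp
  \<comment> \<open>For \<open>k = 0\<close> the incumbent is the default index \<open>0\<close>,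
    which is the new candidate itself and so is covered by the hypothesis.\<close>
  moreover have "f (argmin g k) = g (argmin g k)"
    using Suc.prems argmin_less[of k g] by (cases "k = 0") auto
  ultimately show ?case using Suc.prems by simp
qed simp

primrec nval :: "nexp \<Rightarrow> env \<Rightarrow> nat" and rval :: "rexp \<Rightarrow> env \<Rightarrow> real" and bval :: "bexp \<Rightarrow> env \<Rightarrow> bool" where
  "nval (NC k) \<sigma> = k"
| "nval (NV x) \<sigma> = nv \<sigma> x"
| "nval (NPlus a b) \<sigma> = nval a \<sigma> + nval b \<sigma>"
| "nval (NMinus a b) \<sigma> = nval a \<sigma> - nval b \<sigma>"
| "nval (NLd x a) \<sigma> = na \<sigma> x (nval a \<sigma>)"
| "nval (NIf c a b) \<sigma> = (if bval c \<sigma> then nval a \<sigma> else nval b \<sigma>)"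
| "nval (NSum x p a) \<sigma> = (\<Sum>i<nv \<sigma> p. nval a (bind_nv \<sigma> x i))"
| "nval (NArg x p a) \<sigma> = argmin (\<lambda>i. rval a (bind_nv \<sigma> x i)) (nv \<sigma> p)"
| "rval (ROf a) \<sigma> = real (nval a \<sigma>)"
| "rval (RBin r a b) \<sigma> = rop_fun r (rval a \<sigma>) (rval b \<sigma>)"
| "rval (RLd x a) \<sigma> = ra \<sigma> x (nval a \<sigma>)"
| "rval (RIf c a b) \<sigma> = (if bval c \<sigma> then rval a \<sigma> else rval b \<sigma>)"
| "rval (RAgg r x p z a) \<sigma> = aggr (rop_fun r) (rval z \<sigma>) (\<lambda>i. rval a (bind_nv \<sigma> x i)) (nv \<sigma> p)"
| "bval (BN a b) \<sigma> = (nval a \<sigma> < nval b \<sigma>)"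
| "bval (BR a b) \<sigma> = (rval a \<sigma> < rval b \<sigma>)"

datatype cmd =
    SetN name nexp
  | StN name nexp nexp
  | StR name nexp rexp
  | For name name cmd
  | CSeq cmd cmd

primrec iterate :: "(nat \<Rightarrow> env \<Rightarrow> env) \<Rightarrow> nat \<Rightarrow> env \<Rightarrow> env" where
  "iterate f 0 \<sigma> = \<sigma>"
| "iterate f (Suc k) \<sigma> = f k (iterate f k \<sigma>)"

text \<open>A loop restores its counter at exit, so that counters are local.\<close>

primrec psem :: "cmd \<Rightarrow> env \<Rightarrow> env" where
  "psem (SetN x e) \<sigma> = bind_nv \<sigma> x (nval e \<sigma>)"
| "psem (StN a i e) \<sigma> = \<sigma>\<lparr>na := (na \<sigma>)(a := (na \<sigma> a)(nval i \<sigma> := nval e \<sigma>))\<rparr>"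
| "psem (StR a i e) \<sigma> = \<sigma>\<lparr>ra := (ra \<sigma>)(a := (ra \<sigma> a)(nval i \<sigma> := rval e \<sigma>))\<rparr>"
| "psem (For x p c) \<sigma> =
     bind_nv (iterate (\<lambda>i \<tau>. psem c (bind_nv \<tau> x i)) (nv \<sigma> p) \<sigma>) x (nv \<sigma> x)"
| "psem (CSeq c d) \<sigma> = psem d (psem c \<sigma>)"

text \<open>The length recovers the index, and a program variable with another first character
  cannot collide with a temporary.\<close>

definition tmp :: "nat \<Rightarrow> name" where "tmp k = replicate (Suc k) (CHR ''~'')"

lemma tmp_eq_iff [simp]: "tmp j = tmp k \<longleftrightarrow> j = k"
proof
  assume "tmp j = tmp k"
  then have "length (tmp j) = length (tmp k)" by simp
  then show "j = k" by (simp add: tmp_def)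
qed simp

definition user_name :: "name \<Rightarrow> bool" where "user_name x \<longleftrightarrow> hd x \<noteq> CHR ''~''"

lemma user_name_neq_tmp [simp]: "user_name x \<Longrightarrow> x \<noteq> tmp k" "user_name x \<Longrightarrow> tmp k \<noteq> x"
  by (auto simp: user_name_def tmp_def)

text \<open>
  Loops are bounded by the values of these registers, which are set once and for all; hence the
  running time is at most a polynomial, depending only on the shape of the program, in their values.
\<close>

definition params :: "name set" where
  "params = {''H'', ''q'', ''m'', ''d'', ''n'', ''N'', ''Q'', ''QQ'', ''q2'', ''T'', ''H1''}"

lemma param_user_name: "p \<in> params \<Longrightarrow> user_name p"
  by (auto simp: params_def user_name_def)

definition counter :: "name \<Rightarrow> bool" where "counter x \<longleftrightarrow> user_name x \<and> x \<notin> params"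

primrec wf_n :: "nexp \<Rightarrow> bool" and wf_r :: "rexp \<Rightarrow> bool" and wf_b :: "bexp \<Rightarrow> bool" where
  "wf_n (NC k) = True"
| "wf_n (NV x) = user_name x"
| "wf_n (NPlus a b) = (wf_n a \<and> wf_n b)"
| "wf_n (NMinus a b) = (wf_n a \<and> wf_n b)"
| "wf_n (NLd x a) = wf_n a"
| "wf_n (NIf c a b) = (wf_b c \<and> wf_n a \<and> wf_n b)"
| "wf_n (NSum x p a) = (counter x \<and> p \<in> params \<and> wf_n a)"
| "wf_n (NArg x p a) = (counter x \<and> p \<in> params \<and> wf_r a)"
| "wf_r (ROf a) = wf_n a"
| "wf_r (RBin r a b) = (wf_r a \<and> wf_r b)"
| "wf_r (RLd x a) = wf_n a"
| "wf_r (RIf c a b) = (wf_b c \<and> wf_r a \<and> wf_r b)"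
| "wf_r (RAgg r x p z a) = (counter x \<and> p \<in> params \<and> wf_r z \<and> wf_r a)"
| "wf_b (BN a b) = (wf_n a \<and> wf_n b)"
| "wf_b (BR a b) = (wf_r a \<and> wf_r b)"

primrec set_vars :: "cmd \<Rightarrow> name set" where
  "set_vars (SetN x e) = {x}"
| "set_vars (StN a i e) = {}"
| "set_vars (StR a i e) = {}"
| "set_vars (For x p c) = set_vars c"
| "set_vars (CSeq c d) = set_vars c \<union> set_vars d"

text \<open>A loop bound checked on entry must stay valid, so loop bodies and first components leave
  the parameters alone. Assignments to parameters belong into the top-level list, where
  \<open>bounded_run\<close> checks the bound afresh before each command.\<close>

primrec wf_c :: "cmd \<Rightarrow> bool" where
  "wf_c (SetN x e) = (user_name x \<and> wf_n e)"
| "wf_c (StN a i e) = (wf_n i \<and> wf_n e)"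
| "wf_c (StR a i e) = (wf_n i \<and> wf_r e)"
| "wf_c (For x p c) = (counter x \<and> p \<in> params \<and> x \<notin> set_vars c \<and> set_vars c \<inter> params = {} \<and> wf_c c)"
| "wf_c (CSeq c d) = (set_vars c \<inter> params = {} \<and> wf_c c \<and> wf_c d)"

section \<open>Compilation\<close>

text \<open>The machine has no move instruction; a copy is the addition of a freshly cleared
  register.\<close>

definition save_counter :: "name \<Rightarrow> nat \<Rightarrow> com" where
  "save_counter x k =
     Seq (Do (NConst (tmp k) 0)) (Seq (Do (NAdd (tmp k) x (tmp k))) (Do (NConst x 0)))"

definition incr_counter :: "name \<Rightarrow> nat \<Rightarrow> com" where
  "incr_counter x k = Seq (Do (NConst (tmp k) 1)) (Do (NAdd x x (tmp k)))"

definition restore_counter :: "name \<Rightarrow> nat \<Rightarrow> com" where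
  "restore_counter x k = Seq (Do (NConst (tmp (Suc k)) 0)) (Do (NAdd x (tmp k) (tmp (Suc k))))"

text \<open>Register discipline: \<open>tmp k\<close> accumulates the result,
  \<open>tmp (k + 1)\<close> saves the outer value of the counter, and the body may use everything
  from \<open>tmp (k + 2)\<close> on.\<close>

definition loop :: "name \<Rightarrow> name \<Rightarrow> nat \<Rightarrow> com \<Rightarrow> com" where
  "loop x p k c =
     Seq (save_counter x (k + 1))
       (Seq (While (NLess x p) (Seq c (incr_counter x (k + 2)))) (restore_counter x (k + 1)))"

definition copy_nat :: "name \<Rightarrow> nat \<Rightarrow> com" where
  "copy_nat x k = Seq (Do (NConst (tmp k) 0)) (Do (NAdd (tmp k) x (tmp k)))"

definition copy_real :: "nat \<Rightarrow> nat \<Rightarrow> com" where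
  "copy_real j k =
     Seq (Do (NConst (tmp k) 0)) (Seq (Do (ROfNat (tmp k) (tmp k))) (Do (RAdd (tmp k) (tmp j) (tmp k))))"

primrec test_of :: "bexp \<Rightarrow> nat \<Rightarrow> test" where
  "test_of (BN a b) k = NLess (tmp k) (tmp (k + 1))"
| "test_of (BR a b) k = RLess (tmp k) (tmp (k + 1))"

text \<open>The value of an expression at level \<open>k\<close> ends up in \<open>tmp k\<close>.
  Natural and real registers share names, which \<open>NArg\<close> exploits: as a natural,
  \<open>tmp k\<close> is the best index so far, as a real, the value there. The search starts from
  the body evaluated at counter \<open>0\<close>.\<close>

primrec comp_n :: "nexp \<Rightarrow> nat \<Rightarrow> com" and comp_r :: "rexp \<Rightarrow> nat \<Rightarrow> com" and comp_b :: "bexp \<Rightarrow> nat \<Rightarrow> com" where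
  "comp_n (NC c) k = Do (NConst (tmp k) c)"
| "comp_n (NV x) k = copy_nat x k"
| "comp_n (NPlus a b) k = Seq (comp_n a k) (Seq (comp_n b (k + 1)) (Do (NAdd (tmp k) (tmp k) (tmp (k + 1)))))"
| "comp_n (NMinus a b) k = Seq (comp_n a k) (Seq (comp_n b (k + 1)) (Do (NSub (tmp k) (tmp k) (tmp (k + 1)))))"
| "comp_n (NLd x a) k = Seq (comp_n a k) (Do (NLoad (tmp k) x (tmp k)))"
| "comp_n (NIf c a b) k = Seq (comp_b c k) (If (test_of c k) (comp_n a k) (comp_n b k))"
| "comp_n (NSum x p a) k =
     Seq (Do (NConst (tmp k) 0))
       (loop x p k (Seq (comp_n a (k + 2)) (Do (NAdd (tmp k) (tmp k) (tmp (k + 2))))))"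
| "comp_n (NArg x p a) k =
     Seq (save_counter x (k + 1)) (Seq (comp_r a (k + 2)) (Seq (copy_real (k + 2) k) (Seq (restore_counter x (k + 1))
       (Seq (Do (NConst (tmp k) 0))
         (loop x p k
           (Seq (comp_r a (k + 2))
             (If (RLess (tmp (k + 2)) (tmp k)) (Seq (copy_real (k + 2) k) (copy_nat x k))
               (Do (NConst (tmp (k + 2)) 0)))))))))"
| "comp_r (ROf a) k = Seq (comp_n a k) (Do (ROfNat (tmp k) (tmp k)))"
| "comp_r (RBin r a b) k = Seq (comp_r a k) (Seq (comp_r b (k + 1)) (Do (rop_instr r (tmp k) (tmp k) (tmp (k + 1)))))"
| "comp_r (RLd x a) k = Seq (comp_n a k) (Do (RLoad (tmp k) x (tmp k)))"
| "comp_r (RIf c a b) k = Seq (comp_b c k) (If (test_of c k) (comp_r a k) (comp_r b k))"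
| "comp_r (RAgg r x p z a) k =
     Seq (comp_r z k)
       (loop x p k (Seq (comp_r a (k + 2)) (Do (rop_instr r (tmp k) (tmp k) (tmp (k + 2))))))"
| "comp_b (BN a b) k = Seq (comp_n a k) (comp_n b (k + 1))"
| "comp_b (BR a b) k = Seq (comp_r a k) (comp_r b (k + 1))"

primrec comp_c :: "cmd \<Rightarrow> nat \<Rightarrow> com" where
  "comp_c (SetN x e) k =
     Seq (comp_n e k) (Seq (Do (NConst (tmp (k + 1)) 0)) (Do (NAdd x (tmp k) (tmp (k + 1)))))"
| "comp_c (StN a i e) k = Seq (comp_n i k) (Seq (comp_n e (k + 1)) (Do (NStore a (tmp k) (tmp (k + 1)))))"
| "comp_c (StR a i e) k = Seq (comp_n i k) (Seq (comp_r e (k + 1)) (Do (RStore a (tmp k) (tmp (k + 1)))))"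
| "comp_c (For x p c) k = loop x p k (comp_c c (k + 2))"
| "comp_c (CSeq c d) k = Seq (comp_c c k) (comp_c d k)"

text \<open>Both branches of a conditional are charged and every loop is charged \<open>M\<close>
  rounds, so the bound depends on syntax and \<open>M\<close> only and is a polynomial in
  \<open>M\<close>.\<close>

primrec cost_n :: "nat \<Rightarrow> nexp \<Rightarrow> nat" and cost_r :: "nat \<Rightarrow> rexp \<Rightarrow> nat" and cost_b :: "nat \<Rightarrow> bexp \<Rightarrow> nat" where
  "cost_n M (NC c) = 1"
| "cost_n M (NV x) = 3"
| "cost_n M (NPlus a b) = cost_n M a + cost_n M b + 3"
| "cost_n M (NMinus a b) = cost_n M a + cost_n M b + 3"
| "cost_n M (NLd x a) = cost_n M a + 2"
| "cost_n M (NIf c a b) = cost_b M c + cost_n M a + cost_n M b + 2"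
| "cost_n M (NSum x p a) = M * (cost_n M a + 7) + 14"
| "cost_n M (NArg x p a) = M * (cost_r M a + 16) + cost_r M a + 31"
| "cost_r M (ROf a) = cost_n M a + 2"
| "cost_r M (RBin r a b) = cost_r M a + cost_r M b + 3"
| "cost_r M (RLd x a) = cost_n M a + 2"
| "cost_r M (RIf c a b) = cost_b M c + cost_r M a + cost_r M b + 2"
| "cost_r M (RAgg r x p z a) = cost_r M z + M * (cost_r M a + 7) + 13"
| "cost_b M (BN a b) = cost_n M a + cost_n M b + 1"
| "cost_b M (BR a b) = cost_r M a + cost_r M b + 1"

primrec cost_c :: "nat \<Rightarrow> cmd \<Rightarrow> nat" where
  "cost_c M (SetN x e) = cost_n M e + 4"
| "cost_c M (StN a i e) = cost_n M i + cost_n M e + 3"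
| "cost_c M (StR a i e) = cost_n M i + cost_r M e + 3"
| "cost_c M (For x p c) = M * (cost_c M c + 5) + 12"
| "cost_c M (CSeq c d) = cost_c M c + cost_c M d + 1"

section \<open>Simulation of environments by machine states\<close>

definition rel :: "env \<Rightarrow> state \<Rightarrow> bool" where
  "rel \<sigma> s \<longleftrightarrow> narr s = na \<sigma> \<and> rarr s = ra \<sigma> \<and> (\<forall>x. user_name x \<longrightarrow> nvar s x = nv \<sigma> x)"

text \<open>The calling convention. \<open>rel\<close> says nothing about temporaries or real
  registers; what is needed about them is that operands computed at lower levels survive.\<close>

definition keep :: "nat \<Rightarrow> state \<Rightarrow> state \<Rightarrow> bool" where
  "keep k s s' \<longleftrightarrow> (\<forall>j<k. nvar s' (tmp j) = nvar s (tmp j) \<and> rvar s' (tmp j) = rvar s (tmp j))"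

definition bounded :: "nat \<Rightarrow> env \<Rightarrow> bool" where
  "bounded M \<sigma> \<longleftrightarrow> (\<forall>p\<in>params. nv \<sigma> p \<le> M)"

lemma rel_simps [simp]:
  "rel \<sigma> (s\<lparr>nvar := (nvar s)(tmp k := v)\<rparr>) = rel \<sigma> s"
  "rel \<sigma> (s\<lparr>rvar := f\<rparr>) = rel \<sigma> s"
  by (auto simp: rel_def)

lemma rel_bind: "rel \<sigma> s \<Longrightarrow> user_name x \<Longrightarrow> rel (bind_nv \<sigma> x v) (s\<lparr>nvar := (nvar s)(x := v)\<rparr>)"
  by (auto simp: rel_def)

lemma rel_nvar: "rel \<sigma> s \<Longrightarrow> user_name x \<Longrightarrow> nvar s x = nv \<sigma> x"
  by (auto simp: rel_def)

lemma keep_refl [simp]: "keep k s s" by (simp add: keep_def)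

lemma keep_trans: "keep k s s1 \<Longrightarrow> keep k' s1 s2 \<Longrightarrow> k \<le> k' \<Longrightarrow> keep k s s2"
  by (simp add: keep_def)

lemma keep_mono: "keep k' s s' \<Longrightarrow> k \<le> k' \<Longrightarrow> keep k s s'"
  by (simp add: keep_def)

lemma keep_upd [simp]:
  "k \<le> j \<Longrightarrow> keep k s (s'\<lparr>nvar := (nvar s')(tmp j := v)\<rparr>) = keep k s s'"
  "k \<le> j \<Longrightarrow> keep k s (s'\<lparr>rvar := (rvar s')(tmp j := w)\<rparr>) = keep k s s'"
  "user_name x \<Longrightarrow> keep k s (s'\<lparr>nvar := (nvar s')(x := v)\<rparr>) = keep k s s'"
  "keep k s (s'\<lparr>narr := na'\<rparr>) = keep k s s'"
  "keep k s (s'\<lparr>rarr := ra'\<rparr>) = keep k s s'"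
  by (auto simp: keep_def)

lemma keepD: "keep k s s' \<Longrightarrow> j < k \<Longrightarrow> nvar s' (tmp j) = nvar s (tmp j)"
  "keep k s s' \<Longrightarrow> j < k \<Longrightarrow> rvar s' (tmp j) = rvar s (tmp j)"
  by (auto simp: keep_def)

lemma runs_in_Do_Seq:
  assumes "exec i s = return_pmf s1" "runs_in c N s1 s2"
  shows "runs_in (Seq (Do i) c) (N + 2) s s2"
  using runs_in_Seq[OF runs_in_Do[OF assms(1)] assms(2)] by simp

lemma save_counter_correct:
  assumes "rel \<sigma> s" "user_name x"
  shows "\<exists>s'. runs_in (save_counter x k) 5 s s' \<and> rel (bind_nv \<sigma> x 0) s' \<and> keep k s s' \<and>
    nvar s' (tmp k) = nv \<sigma> x"
proof -
  let ?s1 = "s\<lparr>nvar := (nvar s)(tmp k := 0)\<rparr>"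
  let ?s2 = "?s1\<lparr>nvar := (nvar ?s1)(tmp k := nvar ?s1 x + nvar ?s1 (tmp k))\<rparr>"
  let ?s3 = "?s2\<lparr>nvar := (nvar ?s2)(x := 0)\<rparr>"
  have "runs_in (Do (NConst x 0)) 1 ?s2 ?s3" by (rule runs_in_Do) simp
  then have "runs_in (Seq (Do (NAdd (tmp k) x (tmp k))) (Do (NConst x 0))) (1 + 2) ?s1 ?s3"
    by (rule runs_in_Do_Seq[rotated]) simp
  then have "runs_in (save_counter x k) (1 + 2 + 2) s ?s3"
    unfolding save_counter_def by (rule runs_in_Do_Seq[rotated]) simp
  moreover have "rel \<sigma> ?s2" using assms by (simp only: rel_simps)
  then have "rel (bind_nv \<sigma> x 0) ?s3" using assms by (intro rel_bind)
  moreover have "keep k s ?s3" using assms by (simp only: keep_upd keep_refl order_refl)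
  moreover have "nvar ?s3 (tmp k) = nv \<sigma> x" using assms by (simp add: rel_nvar)
  ultimately have "runs_in (save_counter x k) 5 s ?s3 \<and> rel (bind_nv \<sigma> x 0) ?s3 \<and> keep k s ?s3 \<and>
    nvar ?s3 (tmp k) = nv \<sigma> x" by (intro conjI) (rule runs_in_mono, assumption, simp, assumption+)
  then show ?thesis by blast
qed

lemma restore_counter_correct:
  assumes "rel \<sigma> s" "user_name x"
  shows "\<exists>s'. runs_in (restore_counter x k) 3 s s' \<and> rel (bind_nv \<sigma> x (nvar s (tmp k))) s' \<and> keep (Suc k) s s'"
proof -
  let ?s1 = "s\<lparr>nvar := (nvar s)(tmp (Suc k) := 0)\<rparr>"
  let ?s2 = "?s1\<lparr>nvar := (nvar ?s1)(x := nvar s (tmp k))\<rparr>"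
  have "runs_in (Do (NAdd x (tmp k) (tmp (Suc k)))) 1 ?s1 ?s2" by (rule runs_in_Do) simp
  then have "runs_in (restore_counter x k) (1 + 2) s ?s2"
    unfolding restore_counter_def by (rule runs_in_Do_Seq[rotated]) simp
  moreover have "rel (bind_nv \<sigma> x (nvar s (tmp k))) ?s2"
    using assms by (intro rel_bind) (simp_all only: rel_simps)
  moreover have "keep (Suc k) s ?s2" using assms by (simp only: keep_upd keep_refl order_refl)
  ultimately show ?thesis using runs_in_mono[of "restore_counter x k" "1 + 2" s ?s2 3] by auto
qed

lemma incr_counter_correct:
  assumes "rel \<sigma> s" "user_name x" "nv \<sigma> x = i"
  shows "\<exists>s'. runs_in (incr_counter x k) 3 s s' \<and> rel (bind_nv \<sigma> x (Suc i)) s' \<and> keep k s s'"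
proof -
  let ?s1 = "s\<lparr>nvar := (nvar s)(tmp k := 1)\<rparr>"
  let ?s2 = "?s1\<lparr>nvar := (nvar ?s1)(x := Suc i)\<rparr>"
  have "runs_in (Do (NAdd x x (tmp k))) 1 ?s1 ?s2"
    using assms by (intro runs_in_Do) (simp add: rel_nvar)
  then have "runs_in (incr_counter x k) (1 + 2) s ?s2"
    unfolding incr_counter_def by (rule runs_in_Do_Seq[rotated]) simp
  moreover have "rel (bind_nv \<sigma> x (Suc i)) ?s2"
    using assms by (intro rel_bind) (simp_all only: rel_simps)
  moreover have "keep k s ?s2" using assms by (simp only: keep_upd keep_refl order_refl)
  ultimately show ?thesis using runs_in_mono[of "incr_counter x k" "1 + 2" s ?s2 3] by auto
qed

text \<open>Serves expressions and commands alike: \<open>\<tau>\<close> is the trajectory of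
  environments, constant for expressions, and \<open>J\<close> describes the accumulator; for
  commands \<open>J\<close> is \<open>True\<close>.\<close>

lemma loop_correct:
  assumes s: "rel (\<tau> 0) s" and x: "counter x" and p: "p \<in> params"
    and N: "\<And>i. i \<le> N \<Longrightarrow> nv (\<tau> i) p = N"
    and body: "\<And>i s. i < N \<Longrightarrow> rel (bind_nv (\<tau> i) x i) s \<Longrightarrow> J i (nvar s (tmp k)) (rvar s (tmp k)) \<Longrightarrow>
      \<exists>s'. runs_in c a s s' \<and> rel (bind_nv (\<tau> (Suc i)) x i) s' \<and> keep k s s' \<and>
        nvar s' (tmp (k + 1)) = nvar s (tmp (k + 1)) \<and> J (Suc i) (nvar s' (tmp k)) (rvar s' (tmp k))"
    and J0: "J 0 (nvar s (tmp k)) (rvar s (tmp k))"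
  shows "\<exists>s'. runs_in (loop x p k c) (N * (a + 5) + 11) s s' \<and> rel (bind_nv (\<tau> N) x (nv (\<tau> 0) x)) s' \<and>
    keep k s s' \<and> J N (nvar s' (tmp k)) (rvar s' (tmp k))"
proof -
  have ux: "user_name x" and xp: "x \<noteq> p" and up: "user_name p"
    using x p by (auto simp: counter_def param_user_name)
  \<comment> \<open>The saved outer value of the counter belongs to the invariant because the exit
    code restores the counter from it.\<close>
  define I where "I i s' \<longleftrightarrow> rel (bind_nv (\<tau> i) x i) s' \<and> keep k s s' \<and> nvar s' (tmp (k + 1)) = nv (\<tau> 0) x \<and>
    J i (nvar s' (tmp k)) (rvar s' (tmp k))" for i s'
  obtain s1 where s1: "runs_in (save_counter x (k + 1)) 5 s s1" "rel (bind_nv (\<tau> 0) x 0) s1" "keep (k + 1) s s1"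
    "nvar s1 (tmp (k + 1)) = nv (\<tau> 0) x"
    using save_counter_correct[OF s ux] by blast
  have "nvar s1 (tmp k) = nvar s (tmp k)" "rvar s1 (tmp k) = rvar s (tmp k)" "keep k s s1"
    using keepD[OF s1(3), of k] keep_mono[OF s1(3), of k] by simp_all
  with s1(2,4) J0 have "I 0 s1" unfolding I_def by simp
  moreover have "\<exists>s'. runs_in (Seq c (incr_counter x (k + 2))) (a + 4) t s' \<and> I (Suc i) s'"
    if it: "i < N" "I i t" for i t
  proof -
    obtain t1 where t1: "runs_in c a t t1" "rel (bind_nv (\<tau> (Suc i)) x i) t1" "keep k t t1"
      "nvar t1 (tmp (k + 1)) = nvar t (tmp (k + 1))" "J (Suc i) (nvar t1 (tmp k)) (rvar t1 (tmp k))"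
      using body[OF it(1), of t] it(2) unfolding I_def by blast
    obtain t2 where t2: "runs_in (incr_counter x (k + 2)) 3 t1 t2"
      "rel (bind_nv (bind_nv (\<tau> (Suc i)) x i) x (Suc i)) t2" "keep (k + 2) t1 t2"
      using incr_counter_correct[OF t1(2) ux, of i "k + 2"] by auto
    have "keep k s t" using it(2) by (simp add: I_def)
    then have "keep k s t2" using keep_trans[OF keep_trans[OF _ t1(3)] t2(3)] by simp
    moreover have "nvar t2 (tmp (k + 1)) = nv (\<tau> 0) x"
      using it(2) t1(4) keepD(1)[OF t2(3), of "k + 1"] unfolding I_def by simp
    moreover have "J (Suc i) (nvar t2 (tmp k)) (rvar t2 (tmp k))"
      using t1(5) keepD[OF t2(3), of k] by simp
    ultimately have "I (Suc i) t2" using t2(2) unfolding I_def by simp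
    moreover have "runs_in (Seq c (incr_counter x (k + 2))) (a + 4) t t2"
      by (rule runs_in_mono[OF runs_in_Seq[OF t1(1) t2(1)]]) simp
    ultimately show ?thesis by blast
  qed
  moreover have "holds (NLess x p) t \<longleftrightarrow> i < N" if it: "i \<le> N" "I i t" for i t
  proof -
    have "rel (bind_nv (\<tau> i) x i) t" using it(2) by (simp add: I_def)
    from rel_nvar[OF this ux] rel_nvar[OF this up] xp N[OF it(1)] show ?thesis by simp
  qed
  ultimately obtain s2 where s2: "runs_in (While (NLess x p) (Seq c (incr_counter x (k + 2)))) (N * Suc (a + 4) + 1) s1 s2" "I N s2"
    using runs_in_count_loop[of I s1 N "Seq c (incr_counter x (k + 2))" "a + 4" "NLess x p"] by blast
  have "rel (bind_nv (\<tau> N) x N) s2" using s2(2) by (simp add: I_def)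
  then obtain s3 where s3: "runs_in (restore_counter x (k + 1)) 3 s2 s3"
    "rel (bind_nv (bind_nv (\<tau> N) x N) x (nvar s2 (tmp (k + 1)))) s3" "keep (Suc (k + 1)) s2 s3"
    using restore_counter_correct[OF _ ux] by blast
  have "runs_in (loop x p k c) (Suc (5 + Suc (N * Suc (a + 4) + 1 + 3))) s s3"
    unfolding loop_def by (intro runs_in_Seq[OF s1(1) runs_in_Seq[OF s2(1) s3(1)]])
  then have "runs_in (loop x p k c) (N * (a + 5) + 11) s s3" by (rule runs_in_mono) simp
  moreover have "rel (bind_nv (\<tau> N) x (nv (\<tau> 0) x)) s3" using s3(2) s2(2) by (simp add: I_def)
  moreover have "keep k s s3" using s2(2) keep_mono[OF s3(3), of k] keep_trans[of k s s2 k s3] by (simp add: I_def)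
  moreover have "J N (nvar s3 (tmp k)) (rvar s3 (tmp k))"
    using s2(2) keepD[OF s3(3), of k] by (simp add: I_def)
  ultimately show ?thesis by blast
qed

section \<open>Correctness of compiled expressions\<close>

definition correct_n :: "nat \<Rightarrow> nexp \<Rightarrow> bool" where
  "correct_n M e \<longleftrightarrow> (\<forall>\<sigma> s k. bounded M \<sigma> \<longrightarrow> rel \<sigma> s \<longrightarrow>
     (\<exists>s'. runs_in (comp_n e k) (cost_n M e) s s' \<and> rel \<sigma> s' \<and> keep k s s' \<and> nvar s' (tmp k) = nval e \<sigma>))"

definition correct_r :: "nat \<Rightarrow> rexp \<Rightarrow> bool" where
  "correct_r M e \<longleftrightarrow> (\<forall>\<sigma> s k. bounded M \<sigma> \<longrightarrow> rel \<sigma> s \<longrightarrow>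
     (\<exists>s'. runs_in (comp_r e k) (cost_r M e) s s' \<and> rel \<sigma> s' \<and> keep k s s' \<and> rvar s' (tmp k) = rval e \<sigma>))"

definition correct_b :: "nat \<Rightarrow> bexp \<Rightarrow> bool" where
  "correct_b M e \<longleftrightarrow> (\<forall>\<sigma> s k. bounded M \<sigma> \<longrightarrow> rel \<sigma> s \<longrightarrow>
     (\<exists>s'. runs_in (comp_b e k) (cost_b M e) s s' \<and> rel \<sigma> s' \<and> keep k s s' \<and> (holds (test_of e k) s' \<longleftrightarrow> bval e \<sigma>)))"

lemma correct_nD:
  assumes "correct_n M e" "bounded M \<sigma>" "rel \<sigma> s"
  obtains s' where "runs_in (comp_n e k) (cost_n M e) s s'" "rel \<sigma> s'" "keep k s s'" "nvar s' (tmp k) = nval e \<sigma>"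
  using assms unfolding correct_n_def by blast

lemma correct_rD:
  assumes "correct_r M e" "bounded M \<sigma>" "rel \<sigma> s"
  obtains s' where "runs_in (comp_r e k) (cost_r M e) s s'" "rel \<sigma> s'" "keep k s s'" "rvar s' (tmp k) = rval e \<sigma>"
  using assms unfolding correct_r_def by blast

lemma correct_bD:
  assumes "correct_b M e" "bounded M \<sigma>" "rel \<sigma> s"
  obtains s' where "runs_in (comp_b e k) (cost_b M e) s s'" "rel \<sigma> s'" "keep k s s'" "holds (test_of e k) s' \<longleftrightarrow> bval e \<sigma>"
  using assms unfolding correct_b_def by blast

lemma bounded_bind: "bounded M \<sigma> \<Longrightarrow> counter x \<Longrightarrow> bounded M (bind_nv \<sigma> x i)"
  by (auto simp: bounded_def counter_def)

lemma copy_nat_correct: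
  assumes "rel \<sigma> s" "user_name x"
  shows "\<exists>s'. runs_in (copy_nat x k) 3 s s' \<and> rel \<sigma> s' \<and> nvar s' (tmp k) = nv \<sigma> x \<and>
    (\<forall>y. y \<noteq> tmp k \<longrightarrow> nvar s' y = nvar s y) \<and> rvar s' = rvar s"
proof -
  let ?s1 = "s\<lparr>nvar := (nvar s)(tmp k := 0)\<rparr>"
  let ?s2 = "?s1\<lparr>nvar := (nvar ?s1)(tmp k := nv \<sigma> x)\<rparr>"
  have "runs_in (Do (NAdd (tmp k) x (tmp k))) 1 ?s1 ?s2"
    using assms by (intro runs_in_Do) (simp add: rel_nvar)
  then have "runs_in (copy_nat x k) (1 + 2) s ?s2"
    unfolding copy_nat_def by (rule runs_in_Do_Seq[rotated]) simp
  then have "runs_in (copy_nat x k) 3 s ?s2" by (rule runs_in_mono) simp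
  moreover have "rel \<sigma> ?s2" using assms by (simp only: rel_simps)
  ultimately show ?thesis by (intro exI[of _ ?s2]) simp
qed

lemma copy_real_correct:
  assumes "rel \<sigma> s" "j \<noteq> k"
  shows "\<exists>s'. runs_in (copy_real j k) 5 s s' \<and> rel \<sigma> s' \<and> rvar s' (tmp k) = rvar s (tmp j) \<and>
    (\<forall>y. y \<noteq> tmp k \<longrightarrow> nvar s' y = nvar s y \<and> rvar s' y = rvar s y)"
proof -
  let ?s1 = "s\<lparr>nvar := (nvar s)(tmp k := 0)\<rparr>"
  let ?s2 = "?s1\<lparr>rvar := (rvar ?s1)(tmp k := 0)\<rparr>"
  let ?s3 = "?s2\<lparr>rvar := (rvar ?s2)(tmp k := rvar s (tmp j))\<rparr>"
  have "runs_in (Do (RAdd (tmp k) (tmp j) (tmp k))) 1 ?s2 ?s3"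
    using assms by (intro runs_in_Do) simp
  then have "runs_in (Seq (Do (ROfNat (tmp k) (tmp k))) (Do (RAdd (tmp k) (tmp j) (tmp k)))) (1 + 2) ?s1 ?s3"
    by (rule runs_in_Do_Seq[rotated]) simp
  then have "runs_in (copy_real j k) (1 + 2 + 2) s ?s3"
    unfolding copy_real_def by (rule runs_in_Do_Seq[rotated]) simp
  then have "runs_in (copy_real j k) 5 s ?s3" by (rule runs_in_mono) simp
  moreover have "rel \<sigma> ?s3" using assms by (simp only: rel_simps)
  ultimately show ?thesis by (intro exI[of _ ?s3]) simp
qed

lemma runs_in_Seq_Do:
  assumes "runs_in c N s s1" "exec i s1 = return_pmf s2" "N + 2 \<le> N'"
  shows "runs_in (Seq c (Do i)) N' s s2"
  using runs_in_Seq[OF assms(1) runs_in_Do[OF assms(2)]] assms(3) by (auto intro: runs_in_mono)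

lemma runs_in_Seq2_Do:
  assumes "runs_in c a s s1" "runs_in d b s1 s2" "exec i s2 = return_pmf s3" "a + b + 3 \<le> N'"
  shows "runs_in (Seq c (Seq d (Do i))) N' s s3"
  using runs_in_Seq[OF assms(1) runs_in_Seq_Do[OF assms(2,3) order_refl]] assms(4) by (auto intro: runs_in_mono)

lemma correct_NC: "correct_n M (NC c)"
  unfolding correct_n_def
proof (intro allI impI)
  fix \<sigma> s k assume s: "rel \<sigma> s"
  show "\<exists>s'. runs_in (comp_n (NC c) k) (cost_n M (NC c)) s s' \<and> rel \<sigma> s' \<and> keep k s s' \<and> nvar s' (tmp k) = nval (NC c) \<sigma>"
    using s runs_in_Do[of "NConst (tmp k) c" s] by (intro exI[of _ "s\<lparr>nvar := (nvar s)(tmp k := c)\<rparr>"]) simp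
qed

lemma correct_NV: "user_name x \<Longrightarrow> correct_n M (NV x)"
  unfolding correct_n_def
proof (intro allI impI)
  fix \<sigma> s k assume x: "user_name x" and s: "rel \<sigma> s"
  obtain s' where s': "runs_in (copy_nat x k) 3 s s'" "rel \<sigma> s'" "nvar s' (tmp k) = nv \<sigma> x"
    "\<And>y. y \<noteq> tmp k \<Longrightarrow> nvar s' y = nvar s y" "rvar s' = rvar s"
    using copy_nat_correct[OF s x] by blast
  then show "\<exists>s'. runs_in (comp_n (NV x) k) (cost_n M (NV x)) s s' \<and> rel \<sigma> s' \<and> keep k s s' \<and> nvar s' (tmp k) = nval (NV x) \<sigma>"
    by (intro exI[of _ s']) (simp add: keep_def)
qed

lemma correct_NPlus: "correct_n M a \<Longrightarrow> correct_n M b \<Longrightarrow> correct_n M (NPlus a b)"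
  unfolding correct_n_def[of _ "NPlus a b"]
proof (intro allI impI)
  fix \<sigma> s k assume a: "correct_n M a" and b: "correct_n M b" and \<sigma>: "bounded M \<sigma>" and s: "rel \<sigma> s"
  obtain s1 where s1: "runs_in (comp_n a k) (cost_n M a) s s1" "rel \<sigma> s1" "keep k s s1" "nvar s1 (tmp k) = nval a \<sigma>"
    using correct_nD[OF a \<sigma> s] .
  obtain s2 where s2: "runs_in (comp_n b (k + 1)) (cost_n M b) s1 s2" "rel \<sigma> s2" "keep (k + 1) s1 s2" "nvar s2 (tmp (k + 1)) = nval b \<sigma>"
    using correct_nD[OF b \<sigma> s1(2)] .
  let ?s = "s2\<lparr>nvar := (nvar s2)(tmp k := nval a \<sigma> + nval b \<sigma>)\<rparr>"
  have "nvar s2 (tmp k) = nval a \<sigma>" using keepD[OF s2(3), of k] s1(4) by simp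
  then have "runs_in (comp_n (NPlus a b) k) (cost_n M (NPlus a b)) s ?s"
    unfolding comp_n.simps using s2(4) by (intro runs_in_Seq2_Do[OF s1(1) s2(1)]) simp_all
  moreover have "keep k s ?s" using keep_trans[OF s1(3) s2(3)] by simp
  ultimately show "\<exists>s'. runs_in (comp_n (NPlus a b) k) (cost_n M (NPlus a b)) s s' \<and> rel \<sigma> s' \<and> keep k s s' \<and> nvar s' (tmp k) = nval (NPlus a b) \<sigma>"
    using s2(2) by (intro exI[of _ ?s]) simp
qed

lemma correct_NMinus: "correct_n M a \<Longrightarrow> correct_n M b \<Longrightarrow> correct_n M (NMinus a b)"
  unfolding correct_n_def[of _ "NMinus a b"]
proof (intro allI impI)
  fix \<sigma> s k assume a: "correct_n M a" and b: "correct_n M b" and \<sigma>: "bounded M \<sigma>" and s: "rel \<sigma> s"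
  obtain s1 where s1: "runs_in (comp_n a k) (cost_n M a) s s1" "rel \<sigma> s1" "keep k s s1" "nvar s1 (tmp k) = nval a \<sigma>"
    using correct_nD[OF a \<sigma> s] .
  obtain s2 where s2: "runs_in (comp_n b (k + 1)) (cost_n M b) s1 s2" "rel \<sigma> s2" "keep (k + 1) s1 s2" "nvar s2 (tmp (k + 1)) = nval b \<sigma>"
    using correct_nD[OF b \<sigma> s1(2)] .
  let ?s = "s2\<lparr>nvar := (nvar s2)(tmp k := nval a \<sigma> - nval b \<sigma>)\<rparr>"
  have "nvar s2 (tmp k) = nval a \<sigma>" using keepD[OF s2(3), of k] s1(4) by simp
  then have "runs_in (comp_n (NMinus a b) k) (cost_n M (NMinus a b)) s ?s"
    unfolding comp_n.simps using s2(4) by (intro runs_in_Seq2_Do[OF s1(1) s2(1)]) simp_all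
  moreover have "keep k s ?s" using keep_trans[OF s1(3) s2(3)] by simp
  ultimately show "\<exists>s'. runs_in (comp_n (NMinus a b) k) (cost_n M (NMinus a b)) s s' \<and> rel \<sigma> s' \<and> keep k s s' \<and> nvar s' (tmp k) = nval (NMinus a b) \<sigma>"
    using s2(2) by (intro exI[of _ ?s]) simp
qed

lemma correct_RBin: "correct_r M a \<Longrightarrow> correct_r M b \<Longrightarrow> correct_r M (RBin r a b)"
  unfolding correct_r_def[of _ "RBin r a b"]
proof (intro allI impI)
  fix \<sigma> s k assume a: "correct_r M a" and b: "correct_r M b" and \<sigma>: "bounded M \<sigma>" and s: "rel \<sigma> s"
  obtain s1 where s1: "runs_in (comp_r a k) (cost_r M a) s s1" "rel \<sigma> s1" "keep k s s1" "rvar s1 (tmp k) = rval a \<sigma>"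
    using correct_rD[OF a \<sigma> s] .
  obtain s2 where s2: "runs_in (comp_r b (k + 1)) (cost_r M b) s1 s2" "rel \<sigma> s2" "keep (k + 1) s1 s2" "rvar s2 (tmp (k + 1)) = rval b \<sigma>"
    using correct_rD[OF b \<sigma> s1(2)] .
  let ?s = "s2\<lparr>rvar := (rvar s2)(tmp k := rop_fun r (rval a \<sigma>) (rval b \<sigma>))\<rparr>"
  have "rvar s2 (tmp k) = rval a \<sigma>" using keepD[OF s2(3), of k] s1(4) by simp
  then have "runs_in (comp_r (RBin r a b) k) (cost_r M (RBin r a b)) s ?s"
    unfolding comp_r.simps using s2(4) by (intro runs_in_Seq2_Do[OF s1(1) s2(1)]) (simp_all add: exec_rop_instr)
  moreover have "keep k s ?s" using keep_trans[OF s1(3) s2(3)] by simp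
  ultimately show "\<exists>s'. runs_in (comp_r (RBin r a b) k) (cost_r M (RBin r a b)) s s' \<and> rel \<sigma> s' \<and> keep k s s' \<and> rvar s' (tmp k) = rval (RBin r a b) \<sigma>"
    using s2(2) by (intro exI[of _ ?s]) simp
qed

lemma correct_unary:
  assumes a: "correct_n M a"
  shows "correct_n M (NLd x a)" "correct_r M (ROf a)" "correct_r M (RLd x a)"
proof -
  have "\<exists>s'. runs_in (comp_n (NLd x a) k) (cost_n M (NLd x a)) s s' \<and> rel \<sigma> s' \<and> keep k s s' \<and> nvar s' (tmp k) = nval (NLd x a) \<sigma>"
    "\<exists>s'. runs_in (comp_r (ROf a) k) (cost_r M (ROf a)) s s' \<and> rel \<sigma> s' \<and> keep k s s' \<and> rvar s' (tmp k) = rval (ROf a) \<sigma>"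
    "\<exists>s'. runs_in (comp_r (RLd x a) k) (cost_r M (RLd x a)) s s' \<and> rel \<sigma> s' \<and> keep k s s' \<and> rvar s' (tmp k) = rval (RLd x a) \<sigma>"
    if \<sigma>: "bounded M \<sigma>" and s: "rel \<sigma> s" for \<sigma> s k
  proof -
    obtain s1 where s1: "runs_in (comp_n a k) (cost_n M a) s s1" "rel \<sigma> s1" "keep k s s1" "nvar s1 (tmp k) = nval a \<sigma>"
      using correct_nD[OF a \<sigma> s] .
    have arr: "narr s1 = na \<sigma>" "rarr s1 = ra \<sigma>" using s1(2) by (simp_all add: rel_def)
    let ?s2 = "s1\<lparr>nvar := (nvar s1)(tmp k := na \<sigma> x (nval a \<sigma>))\<rparr>"
    have "runs_in (comp_n (NLd x a) k) (cost_n M (NLd x a)) s ?s2"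
      unfolding comp_n.simps using s1(4) arr by (intro runs_in_Seq_Do[OF s1(1)]) simp_all
    then show "\<exists>s'. runs_in (comp_n (NLd x a) k) (cost_n M (NLd x a)) s s' \<and> rel \<sigma> s' \<and> keep k s s' \<and> nvar s' (tmp k) = nval (NLd x a) \<sigma>"
      using s1(2,3) by (intro exI[of _ ?s2]) simp
    let ?s2 = "s1\<lparr>rvar := (rvar s1)(tmp k := real (nval a \<sigma>))\<rparr>"
    have "runs_in (comp_r (ROf a) k) (cost_r M (ROf a)) s ?s2"
      unfolding comp_r.simps using s1(4) arr by (intro runs_in_Seq_Do[OF s1(1)]) simp_all
    then show "\<exists>s'. runs_in (comp_r (ROf a) k) (cost_r M (ROf a)) s s' \<and> rel \<sigma> s' \<and> keep k s s' \<and> rvar s' (tmp k) = rval (ROf a) \<sigma>"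
      using s1(2,3) by (intro exI[of _ ?s2]) simp
    let ?s2 = "s1\<lparr>rvar := (rvar s1)(tmp k := ra \<sigma> x (nval a \<sigma>))\<rparr>"
    have "runs_in (comp_r (RLd x a) k) (cost_r M (RLd x a)) s ?s2"
      unfolding comp_r.simps using s1(4) arr by (intro runs_in_Seq_Do[OF s1(1)]) simp_all
    then show "\<exists>s'. runs_in (comp_r (RLd x a) k) (cost_r M (RLd x a)) s s' \<and> rel \<sigma> s' \<and> keep k s s' \<and> rvar s' (tmp k) = rval (RLd x a) \<sigma>"
      using s1(2,3) by (intro exI[of _ ?s2]) simp
  qed
  then show "correct_n M (NLd x a)" "correct_r M (ROf a)" "correct_r M (RLd x a)"
    unfolding correct_n_def correct_r_def by blast+
qed

lemma correct_BN: "correct_n M a \<Longrightarrow> correct_n M b \<Longrightarrow> correct_b M (BN a b)"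
  unfolding correct_b_def
proof (intro allI impI)
  fix \<sigma> s k assume a: "correct_n M a" and b: "correct_n M b" and \<sigma>: "bounded M \<sigma>" and s: "rel \<sigma> s"
  obtain s1 where s1: "runs_in (comp_n a k) (cost_n M a) s s1" "rel \<sigma> s1" "keep k s s1" "nvar s1 (tmp k) = nval a \<sigma>"
    using correct_nD[OF a \<sigma> s] .
  obtain s2 where s2: "runs_in (comp_n b (k + 1)) (cost_n M b) s1 s2" "rel \<sigma> s2" "keep (k + 1) s1 s2" "nvar s2 (tmp (k + 1)) = nval b \<sigma>"
    using correct_nD[OF b \<sigma> s1(2)] .
  have "nvar s2 (tmp k) = nval a \<sigma>" using keepD[OF s2(3), of k] s1(4) by simp
  moreover have "keep k s s2" using keep_trans[OF s1(3) s2(3)] by simp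
  ultimately show "\<exists>s'. runs_in (comp_b (BN a b) k) (cost_b M (BN a b)) s s' \<and> rel \<sigma> s' \<and> keep k s s' \<and> (holds (test_of (BN a b) k) s' \<longleftrightarrow> bval (BN a b) \<sigma>)"
    using runs_in_Seq[OF s1(1) s2(1)] s2(2,4) by (intro exI[of _ s2]) simp
qed

lemma correct_BR: "correct_r M a \<Longrightarrow> correct_r M b \<Longrightarrow> correct_b M (BR a b)"
  unfolding correct_b_def
proof (intro allI impI)
  fix \<sigma> s k assume a: "correct_r M a" and b: "correct_r M b" and \<sigma>: "bounded M \<sigma>" and s: "rel \<sigma> s"
  obtain s1 where s1: "runs_in (comp_r a k) (cost_r M a) s s1" "rel \<sigma> s1" "keep k s s1" "rvar s1 (tmp k) = rval a \<sigma>"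
    using correct_rD[OF a \<sigma> s] .
  obtain s2 where s2: "runs_in (comp_r b (k + 1)) (cost_r M b) s1 s2" "rel \<sigma> s2" "keep (k + 1) s1 s2" "rvar s2 (tmp (k + 1)) = rval b \<sigma>"
    using correct_rD[OF b \<sigma> s1(2)] .
  have "rvar s2 (tmp k) = rval a \<sigma>" using keepD[OF s2(3), of k] s1(4) by simp
  moreover have "keep k s s2" using keep_trans[OF s1(3) s2(3)] by simp
  ultimately show "\<exists>s'. runs_in (comp_b (BR a b) k) (cost_b M (BR a b)) s s' \<and> rel \<sigma> s' \<and> keep k s s' \<and> (holds (test_of (BR a b) k) s' \<longleftrightarrow> bval (BR a b) \<sigma>)"
    using runs_in_Seq[OF s1(1) s2(1)] s2(2,4) by (intro exI[of _ s2]) simp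
qed

lemma correct_NIf: "correct_b M c \<Longrightarrow> correct_n M a \<Longrightarrow> correct_n M b \<Longrightarrow> correct_n M (NIf c a b)"
  unfolding correct_n_def[of _ "NIf c a b"]
proof (intro allI impI)
  fix \<sigma> s k assume c: "correct_b M c" and ab: "correct_n M a" "correct_n M b" and \<sigma>: "bounded M \<sigma>" and s: "rel \<sigma> s"
  define e where "e = (if bval c \<sigma> then a else b)"
  have e: "correct_n M e" "cost_n M e \<le> cost_n M a + cost_n M b" using ab by (auto simp: e_def)
  obtain s1 where s1: "runs_in (comp_b c k) (cost_b M c) s s1" "rel \<sigma> s1" "keep k s s1" "holds (test_of c k) s1 \<longleftrightarrow> bval c \<sigma>"
    using correct_bD[OF c \<sigma> s] .
  obtain s2 where s2: "runs_in (comp_n e k) (cost_n M e) s1 s2" "rel \<sigma> s2" "keep k s1 s2" "nvar s2 (tmp k) = nval e \<sigma>"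
    using correct_nD[OF e(1) \<sigma> s1(2)] .
  have "(if holds (test_of c k) s1 then comp_n a k else comp_n b k) = comp_n e k" using s1(4) by (simp add: e_def)
  with s2(1) have "runs_in (If (test_of c k) (comp_n a k) (comp_n b k)) (Suc (cost_n M e)) s1 s2"
    by (intro runs_in_If) simp
  from runs_in_Seq[OF s1(1) this] e(2) have "runs_in (comp_n (NIf c a b) k) (cost_n M (NIf c a b)) s s2"
    by (auto intro: runs_in_mono)
  then show "\<exists>s'. runs_in (comp_n (NIf c a b) k) (cost_n M (NIf c a b)) s s' \<and> rel \<sigma> s' \<and> keep k s s' \<and> nvar s' (tmp k) = nval (NIf c a b) \<sigma>"
    using s2 keep_trans[OF s1(3) s2(3)] by (intro exI[of _ s2]) (simp add: e_def)
qed

lemma correct_RIf: "correct_b M c \<Longrightarrow> correct_r M a \<Longrightarrow> correct_r M b \<Longrightarrow> correct_r M (RIf c a b)"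
  unfolding correct_r_def[of _ "RIf c a b"]
proof (intro allI impI)
  fix \<sigma> s k assume c: "correct_b M c" and ab: "correct_r M a" "correct_r M b" and \<sigma>: "bounded M \<sigma>" and s: "rel \<sigma> s"
  define e where "e = (if bval c \<sigma> then a else b)"
  have e: "correct_r M e" "cost_r M e \<le> cost_r M a + cost_r M b" using ab by (auto simp: e_def)
  obtain s1 where s1: "runs_in (comp_b c k) (cost_b M c) s s1" "rel \<sigma> s1" "keep k s s1" "holds (test_of c k) s1 \<longleftrightarrow> bval c \<sigma>"
    using correct_bD[OF c \<sigma> s] .
  obtain s2 where s2: "runs_in (comp_r e k) (cost_r M e) s1 s2" "rel \<sigma> s2" "keep k s1 s2" "rvar s2 (tmp k) = rval e \<sigma>"
    using correct_rD[OF e(1) \<sigma> s1(2)] .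
  have "(if holds (test_of c k) s1 then comp_r a k else comp_r b k) = comp_r e k" using s1(4) by (simp add: e_def)
  with s2(1) have "runs_in (If (test_of c k) (comp_r a k) (comp_r b k)) (Suc (cost_r M e)) s1 s2"
    by (intro runs_in_If) simp
  from runs_in_Seq[OF s1(1) this] e(2) have "runs_in (comp_r (RIf c a b) k) (cost_r M (RIf c a b)) s s2"
    by (auto intro: runs_in_mono)
  then show "\<exists>s'. runs_in (comp_r (RIf c a b) k) (cost_r M (RIf c a b)) s s' \<and> rel \<sigma> s' \<and> keep k s s' \<and> rvar s' (tmp k) = rval (RIf c a b) \<sigma>"
    using s2 keep_trans[OF s1(3) s2(3)] by (intro exI[of _ s2]) (simp add: e_def)
qed

lemma correct_NSum:
  assumes "counter x" "p \<in> params" "correct_n M a" shows "correct_n M (NSum x p a)"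
  unfolding correct_n_def[of _ "NSum x p a"]
proof (intro allI impI)
  fix \<sigma> s k assume \<sigma>: "bounded M \<sigma>" and s: "rel \<sigma> s"
  let ?N = "nv \<sigma> p"
  let ?f = "\<lambda>i. nval a (bind_nv \<sigma> x i)"
  let ?s0 = "s\<lparr>nvar := (nvar s)(tmp k := 0)\<rparr>"
  let ?c = "Seq (comp_n a (k + 2)) (Do (NAdd (tmp k) (tmp k) (tmp (k + 2))))"
  have body: "\<exists>s'. runs_in ?c (cost_n M a + 2) t s' \<and> rel (bind_nv \<sigma> x i) s' \<and> keep k t s' \<and>
      nvar s' (tmp (k + 1)) = nvar t (tmp (k + 1)) \<and> nvar s' (tmp k) = (\<Sum>j<Suc i. ?f j)"
    if t0: "rel (bind_nv \<sigma> x i) t" and t: "nvar t (tmp k) = (\<Sum>j<i. ?f j)" for i t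
  proof -
    obtain t1 where t1: "runs_in (comp_n a (k + 2)) (cost_n M a) t t1" "rel (bind_nv \<sigma> x i) t1" "keep (k + 2) t t1"
      "nvar t1 (tmp (k + 2)) = ?f i"
      using correct_nD[OF assms(3) bounded_bind[OF \<sigma> assms(1)] t0] .
    let ?t = "t1\<lparr>nvar := (nvar t1)(tmp k := (\<Sum>j<Suc i. ?f j))\<rparr>"
    have "nvar t1 (tmp k) = (\<Sum>j<i. ?f j)" using keepD[OF t1(3), of k] t by simp
    then have "runs_in ?c (cost_n M a + 2) t ?t"
      using t1(4) by (intro runs_in_Seq_Do[OF t1(1)]) simp_all
    then show ?thesis using t1(2) keep_mono[OF t1(3), of k] keepD[OF t1(3), of "k + 1"]
      by (intro exI[of _ ?t]) simp
  qed
  obtain s' where s': "runs_in (loop x p k ?c) (?N * (cost_n M a + 2 + 5) + 11) ?s0 s'"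
    "rel (bind_nv \<sigma> x (nv \<sigma> x)) s'" "keep k ?s0 s'" "nvar s' (tmp k) = (\<Sum>j<?N. ?f j)"
    using loop_correct[of "\<lambda>_. \<sigma>" ?s0 x p ?N "\<lambda>i v _. v = (\<Sum>j<i. ?f j)" k ?c "cost_n M a + 2"] s assms(1,2) body by auto
  have "?N \<le> M" using \<sigma> assms(2) by (simp add: bounded_def)
  then have le: "?N * (cost_n M a + 2 + 5) \<le> M * (cost_n M a + 7)" by (intro mult_mono) simp_all
  have "runs_in (comp_n (NSum x p a) k) (cost_n M (NSum x p a)) s s'"
    unfolding comp_n.simps
    by (rule runs_in_mono[OF runs_in_Do_Seq[OF _ s'(1)]], simp, simp only: cost_n.simps) (use le in linarith)
  moreover have "keep k s s'" using s'(3) by (simp add: keep_def)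
  ultimately show "\<exists>s'. runs_in (comp_n (NSum x p a) k) (cost_n M (NSum x p a)) s s' \<and> rel \<sigma> s' \<and> keep k s s' \<and> nvar s' (tmp k) = nval (NSum x p a) \<sigma>"
    using s'(2,4) by (intro exI[of _ s']) simp
qed

lemma correct_RAgg:
  assumes "counter x" "p \<in> params" "correct_r M z" "correct_r M a" shows "correct_r M (RAgg r x p z a)"
  unfolding correct_r_def[of _ "RAgg r x p z a"]
proof (intro allI impI)
  fix \<sigma> s k assume \<sigma>: "bounded M \<sigma>" and s: "rel \<sigma> s"
  let ?N = "nv \<sigma> p"
  let ?f = "\<lambda>i. rval a (bind_nv \<sigma> x i)"
  let ?g = "aggr (rop_fun r) (rval z \<sigma>) ?f"
  let ?c = "Seq (comp_r a (k + 2)) (Do (rop_instr r (tmp k) (tmp k) (tmp (k + 2))))"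
  obtain s0 where s0: "runs_in (comp_r z k) (cost_r M z) s s0" "rel \<sigma> s0" "keep k s s0" "rvar s0 (tmp k) = rval z \<sigma>"
    using correct_rD[OF assms(3) \<sigma> s] .
  have body: "\<exists>s'. runs_in ?c (cost_r M a + 2) t s' \<and> rel (bind_nv \<sigma> x i) s' \<and> keep k t s' \<and>
      nvar s' (tmp (k + 1)) = nvar t (tmp (k + 1)) \<and> rvar s' (tmp k) = ?g (Suc i)"
    if t0: "rel (bind_nv \<sigma> x i) t" and t: "rvar t (tmp k) = ?g i" for i t
  proof -
    obtain t1 where t1: "runs_in (comp_r a (k + 2)) (cost_r M a) t t1" "rel (bind_nv \<sigma> x i) t1" "keep (k + 2) t t1"
      "rvar t1 (tmp (k + 2)) = ?f i"
      using correct_rD[OF assms(4) bounded_bind[OF \<sigma> assms(1)] t0] .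
    let ?t = "t1\<lparr>rvar := (rvar t1)(tmp k := ?g (Suc i))\<rparr>"
    have "rvar t1 (tmp k) = ?g i" using keepD[OF t1(3), of k] t by simp
    then have "runs_in ?c (cost_r M a + 2) t ?t"
      using t1(4) by (intro runs_in_Seq_Do[OF t1(1)]) (simp_all add: exec_rop_instr)
    then show ?thesis using t1(2) keep_mono[OF t1(3), of k] keepD[OF t1(3), of "k + 1"]
      by (intro exI[of _ ?t]) simp
  qed
  obtain s' where s': "runs_in (loop x p k ?c) (?N * (cost_r M a + 2 + 5) + 11) s0 s'"
    "rel (bind_nv \<sigma> x (nv \<sigma> x)) s'" "keep k s0 s'" "rvar s' (tmp k) = ?g ?N"
    using loop_correct[of "\<lambda>_. \<sigma>" s0 x p ?N "\<lambda>i _ v. v = ?g i" k ?c "cost_r M a + 2"] s0(2,4) assms(1,2) body by auto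
  have "?N \<le> M" using \<sigma> assms(2) by (simp add: bounded_def)
  then have le: "?N * (cost_r M a + 2 + 5) \<le> M * (cost_r M a + 7)" by (intro mult_mono) simp_all
  have "runs_in (comp_r (RAgg r x p z a) k) (cost_r M (RAgg r x p z a)) s s'"
    unfolding comp_r.simps
    by (rule runs_in_mono[OF runs_in_Seq[OF s0(1) s'(1)]], simp only: cost_r.simps) (use le in linarith)
  moreover have "keep k s s'" using keep_trans[OF s0(3) s'(3)] by simp
  ultimately show "\<exists>s'. runs_in (comp_r (RAgg r x p z a) k) (cost_r M (RAgg r x p z a)) s s' \<and> rel \<sigma> s' \<and> keep k s s' \<and> rvar s' (tmp k) = rval (RAgg r x p z a) \<sigma>"
    using s'(2,4) by (intro exI[of _ s']) simp
qed

lemma correct_NArg: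
  assumes "counter x" "p \<in> params" "correct_r M a" shows "correct_n M (NArg x p a)"
  unfolding correct_n_def[of _ "NArg x p a"]
proof (intro allI impI)
  fix \<sigma> s k assume \<sigma>: "bounded M \<sigma>" and s: "rel \<sigma> s"
  have ux: "user_name x" using assms(1) by (simp add: counter_def)
  let ?N = "nv \<sigma> p"
  let ?f = "\<lambda>i. rval a (bind_nv \<sigma> x i)"
  let ?J = "\<lambda>i v w. v = argmin ?f i \<and> w = ?f (argmin ?f i)"
  let ?if = "If (RLess (tmp (k + 2)) (tmp k)) (Seq (copy_real (k + 2) k) (copy_nat x k)) (Do (NConst (tmp (k + 2)) 0))"
  let ?c = "Seq (comp_r a (k + 2)) ?if"
  obtain s1 where s1: "runs_in (save_counter x (k + 1)) 5 s s1" "rel (bind_nv \<sigma> x 0) s1" "keep (k + 1) s s1"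
    "nvar s1 (tmp (k + 1)) = nv \<sigma> x"
    using save_counter_correct[OF s ux] by blast
  obtain s2 where s2: "runs_in (comp_r a (k + 2)) (cost_r M a) s1 s2" "rel (bind_nv \<sigma> x 0) s2" "keep (k + 2) s1 s2"
    "rvar s2 (tmp (k + 2)) = ?f 0"
    using correct_rD[OF assms(3) bounded_bind[OF \<sigma> assms(1)] s1(2)] .
  obtain s3 where s3: "runs_in (copy_real (k + 2) k) 5 s2 s3" "rel (bind_nv \<sigma> x 0) s3" "rvar s3 (tmp k) = ?f 0"
    "\<And>y. y \<noteq> tmp k \<Longrightarrow> nvar s3 y = nvar s2 y \<and> rvar s3 y = rvar s2 y"
    using copy_real_correct[OF s2(2), of "k + 2" k] s2(4) by auto
  have "nvar s3 (tmp (k + 1)) = nv \<sigma> x" using s3(4) keepD[OF s2(3), of "k + 1"] s1(4) by simp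
  then obtain s4 where s4: "runs_in (restore_counter x (k + 1)) 3 s3 s4" "rel \<sigma> s4" "keep (k + 2) s3 s4"
    using restore_counter_correct[OF s3(2) ux, of "k + 1"] by auto
  let ?s5 = "s4\<lparr>nvar := (nvar s4)(tmp k := 0)\<rparr>"
  \<comment> \<open>This is \<open>?J\<close> for \<open>i = 0\<close>: the default index is
    \<open>0\<close>, and the body has been evaluated with the counter at \<open>0\<close>, even if
    the range is empty.\<close>
  have r4: "rvar s4 (tmp k) = ?f 0" using keepD[OF s4(3), of k] s3(3) by simp
  have "keep k s s1" using keep_mono[OF s1(3), of k] by simp
  moreover have "keep k s1 s2" using keep_mono[OF s2(3), of k] by simp
  moreover have "keep k s2 s3" using s3(4) by (simp add: keep_def)
  moreover have "keep k s3 ?s5" using keep_mono[OF s4(3), of k] by simp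
  ultimately have k5: "keep k s ?s5" by (meson keep_trans order_refl)
  have body: "\<exists>s'. runs_in ?c (cost_r M a + 11) t s' \<and> rel (bind_nv \<sigma> x i) s' \<and> keep k t s' \<and>
      nvar s' (tmp (k + 1)) = nvar t (tmp (k + 1)) \<and> ?J (Suc i) (nvar s' (tmp k)) (rvar s' (tmp k))"
    if t0: "rel (bind_nv \<sigma> x i) t" and t: "?J i (nvar t (tmp k)) (rvar t (tmp k))" for i t
  proof -
    obtain t1 where t1: "runs_in (comp_r a (k + 2)) (cost_r M a) t t1" "rel (bind_nv \<sigma> x i) t1" "keep (k + 2) t t1"
      "rvar t1 (tmp (k + 2)) = ?f i"
      using correct_rD[OF assms(3) bounded_bind[OF \<sigma> assms(1)] t0] .
    have t1k: "?J i (nvar t1 (tmp k)) (rvar t1 (tmp k))" using keepD[OF t1(3), of k] t by simp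
    have kt1: "keep k t t1" "nvar t1 (tmp (k + 1)) = nvar t (tmp (k + 1))"
      using keep_mono[OF t1(3), of k] keepD[OF t1(3), of "k + 1"] by simp_all
    show ?thesis
    proof (cases "?f i < ?f (argmin ?f i)")
      case True
      obtain t2 where t2: "runs_in (copy_real (k + 2) k) 5 t1 t2" "rel (bind_nv \<sigma> x i) t2" "rvar t2 (tmp k) = ?f i"
        "\<And>y. y \<noteq> tmp k \<Longrightarrow> nvar t2 y = nvar t1 y \<and> rvar t2 y = rvar t1 y"
        using copy_real_correct[OF t1(2), of "k + 2" k] t1(4) by auto
      obtain t3 where t3: "runs_in (copy_nat x k) 3 t2 t3" "rel (bind_nv \<sigma> x i) t3" "nvar t3 (tmp k) = i"
        "\<And>y. y \<noteq> tmp k \<Longrightarrow> nvar t3 y = nvar t2 y" "rvar t3 = rvar t2"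
        using copy_nat_correct[OF t2(2) ux, of k] by auto
      have "runs_in ?if (Suc (Suc (5 + 3))) t1 t3"
        using runs_in_Seq[OF t2(1) t3(1)] True t1(4) t1k by (intro runs_in_If) simp
      from runs_in_Seq[OF t1(1) this] have "runs_in ?c (cost_r M a + 11) t t3" by (rule runs_in_mono) simp
      moreover have "keep k t1 t3" "nvar t3 (tmp (k + 1)) = nvar t1 (tmp (k + 1))"
        using t2(4) t3(4,5) by (simp_all add: keep_def)
      ultimately show ?thesis using t3(2,3,5) t2(3) True kt1 keep_trans[of k t t1 k t3]
        by (intro exI[of _ t3]) simp
    next
      case False
      let ?t = "t1\<lparr>nvar := (nvar t1)(tmp (k + 2) := 0)\<rparr>"
      have "runs_in ?if (Suc 1) t1 ?t"
        using False t1(4) t1k by (intro runs_in_If) (simp add: runs_in_Do[where s' = ?t, simplified])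
      from runs_in_Seq[OF t1(1) this] have "runs_in ?c (cost_r M a + 11) t ?t" by (rule runs_in_mono) simp
      then show ?thesis using t1(2) t1k kt1 False by (intro exI[of _ ?t]) simp
    qed
  qed
  obtain s' where s': "runs_in (loop x p k ?c) (?N * (cost_r M a + 11 + 5) + 11) ?s5 s'"
    "rel (bind_nv \<sigma> x (nv \<sigma> x)) s'" "keep k ?s5 s'" "nvar s' (tmp k) = argmin ?f ?N"
    using loop_correct[of "\<lambda>_. \<sigma>" ?s5 x p ?N ?J k ?c "cost_r M a + 11"] s4(2) r4 assms(1,2) body by auto
  have "?N \<le> M" using \<sigma> assms(2) by (simp add: bounded_def)
  then have le: "?N * (cost_r M a + 11 + 5) \<le> M * (cost_r M a + 16)" by (intro mult_mono) simp_all
  have "runs_in (comp_n (NArg x p a) k)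
      (Suc (5 + Suc (cost_r M a + Suc (5 + Suc (3 + (?N * (cost_r M a + 11 + 5) + 11 + 2)))))) s s'"
    unfolding comp_n.simps
    by (intro runs_in_Seq[OF s1(1)] runs_in_Seq[OF s2(1)] runs_in_Seq[OF s3(1)] runs_in_Seq[OF s4(1)]
        runs_in_Do_Seq[OF _ s'(1)]) simp
  then have "runs_in (comp_n (NArg x p a) k) (cost_n M (NArg x p a)) s s'"
    by (rule runs_in_mono, simp only: cost_n.simps) (use le in linarith)
  moreover have "keep k s s'" using keep_trans[OF k5 s'(3)] by simp
  ultimately show "\<exists>s'. runs_in (comp_n (NArg x p a) k) (cost_n M (NArg x p a)) s s' \<and> rel \<sigma> s' \<and> keep k s s' \<and> nvar s' (tmp k) = nval (NArg x p a) \<sigma>"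
    using s'(2,4) by (intro exI[of _ s']) simp
qed

lemma correct_exp:
  "wf_n e \<longrightarrow> correct_n M e" "wf_r e' \<longrightarrow> correct_r M e'" "wf_b e'' \<longrightarrow> correct_b M e''"
  by (induction e and e' and e'')
    (simp_all add: correct_NC correct_NV correct_NPlus correct_NMinus correct_RBin correct_unary correct_BN
      correct_BR correct_NIf correct_RIf correct_NSum correct_RAgg correct_NArg)

section \<open>Correctness of compiled commands and command lists\<close>

lemma bind_nv_same [simp]: "bind_nv \<sigma> x (nv \<sigma> x) = \<sigma>"
  by simp

lemma nv_iterate:
  assumes "\<And>\<tau>. nv (psem c \<tau>) y = nv \<tau> y" "y \<noteq> x"
  shows "nv (iterate (\<lambda>i \<tau>. psem c (bind_nv \<tau> x i)) N \<sigma>) y = nv \<sigma> y"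
  by (induction N) (use assms in simp_all)

lemma nv_psem: "y \<notin> set_vars c \<Longrightarrow> nv (psem c \<sigma>) y = nv \<sigma> y"
proof (induction c arbitrary: \<sigma>)
  case (For x p c)
  then have "nv (psem c \<tau>) y = nv \<tau> y" for \<tau> by simp
  then show ?case using nv_iterate[of c y x "nv \<sigma> p" \<sigma>] by (cases "y = x") simp_all
qed simp_all

lemma bounded_psem:
  assumes "bounded M \<sigma>" "set_vars c \<inter> params = {}" shows "bounded M (psem c \<sigma>)"
  unfolding bounded_def
proof
  fix p assume "p \<in> params"
  with assms have "nv (psem c \<sigma>) p = nv \<sigma> p" by (intro nv_psem) blast
  with assms(1) \<open>p \<in> params\<close> show "nv (psem c \<sigma>) p \<le> M" by (simp add: bounded_def)
qed

lemma correct_cmd: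
  "wf_c c \<Longrightarrow> bounded M \<sigma> \<Longrightarrow> rel \<sigma> s \<Longrightarrow>
     \<exists>s'. runs_in (comp_c c k) (cost_c M c) s s' \<and> rel (psem c \<sigma>) s' \<and> keep k s s'"
proof (induction c arbitrary: \<sigma> s k)
  case (SetN x e)
  obtain s1 where s1: "runs_in (comp_n e k) (cost_n M e) s s1" "rel \<sigma> s1" "keep k s s1" "nvar s1 (tmp k) = nval e \<sigma>"
    using SetN correct_nD[of M e \<sigma> s k] correct_exp(1)[of e M] by auto
  let ?s2 = "s1\<lparr>nvar := (nvar s1)(tmp (k + 1) := 0)\<rparr>"
  let ?s3 = "?s2\<lparr>nvar := (nvar ?s2)(x := nval e \<sigma>)\<rparr>"
  have x: "user_name x" using SetN by simp
  have "exec (NAdd x (tmp k) (tmp (k + 1))) ?s2 = return_pmf ?s3" using s1(4) by simp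
  then have "runs_in (Do (NAdd x (tmp k) (tmp (k + 1)))) 1 ?s2 ?s3" by (rule runs_in_Do)
  then have "runs_in (Seq (Do (NConst (tmp (k + 1)) 0)) (Do (NAdd x (tmp k) (tmp (k + 1))))) (1 + 2) s1 ?s3"
    by (rule runs_in_Do_Seq[rotated]) simp
  from runs_in_Seq[OF s1(1) this]
  have "runs_in (comp_c (SetN x e) k) (cost_c M (SetN x e)) s ?s3"
    unfolding comp_c.simps by (rule runs_in_mono) simp
  moreover have "rel (bind_nv \<sigma> x (nval e \<sigma>)) ?s3" by (rule rel_bind) (use s1(2) x in simp_all)
  moreover have "keep k s ?s3" using x s1(3) by (simp only: keep_upd le_add1)
  ultimately show ?case by (intro exI[of _ ?s3]) simp
next
  case (StN a i e)
  obtain s1 where s1: "runs_in (comp_n i k) (cost_n M i) s s1" "rel \<sigma> s1" "keep k s s1" "nvar s1 (tmp k) = nval i \<sigma>"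
    using StN correct_nD[of M i \<sigma> s k] correct_exp(1)[of i M] by auto
  obtain s2 where s2: "runs_in (comp_n e (k + 1)) (cost_n M e) s1 s2" "rel \<sigma> s2" "keep (k + 1) s1 s2" "nvar s2 (tmp (k + 1)) = nval e \<sigma>"
    using StN s1(2) correct_nD[of M e \<sigma> s1 "k + 1"] correct_exp(1)[of e M] by auto
  let ?s3 = "s2\<lparr>narr := (narr s2)(a := (narr s2 a)(nval i \<sigma> := nval e \<sigma>))\<rparr>"
  have "nvar s2 (tmp k) = nval i \<sigma>" using keepD[OF s2(3), of k] s1(4) by simp
  then have "runs_in (comp_c (StN a i e) k) (cost_c M (StN a i e)) s ?s3"
    unfolding comp_c.simps using s2(4) by (intro runs_in_Seq2_Do[OF s1(1) s2(1)]) simp_all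
  moreover have "rel (psem (StN a i e) \<sigma>) ?s3" using s2(2) by (simp add: rel_def)
  moreover have "keep k s ?s3" using keep_trans[OF s1(3) s2(3)] by simp
  ultimately show ?case by blast
next
  case (StR a i e)
  obtain s1 where s1: "runs_in (comp_n i k) (cost_n M i) s s1" "rel \<sigma> s1" "keep k s s1" "nvar s1 (tmp k) = nval i \<sigma>"
    using StR correct_nD[of M i \<sigma> s k] correct_exp(1)[of i M] by auto
  obtain s2 where s2: "runs_in (comp_r e (k + 1)) (cost_r M e) s1 s2" "rel \<sigma> s2" "keep (k + 1) s1 s2" "rvar s2 (tmp (k + 1)) = rval e \<sigma>"
    using StR s1(2) correct_rD[of M e \<sigma> s1 "k + 1"] correct_exp(2)[of e M] by auto
  let ?s3 = "s2\<lparr>rarr := (rarr s2)(a := (rarr s2 a)(nval i \<sigma> := rval e \<sigma>))\<rparr>"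
  have "nvar s2 (tmp k) = nval i \<sigma>" using keepD[OF s2(3), of k] s1(4) by simp
  then have "runs_in (comp_c (StR a i e) k) (cost_c M (StR a i e)) s ?s3"
    unfolding comp_c.simps using s2(4) by (intro runs_in_Seq2_Do[OF s1(1) s2(1)]) simp_all
  moreover have "rel (psem (StR a i e) \<sigma>) ?s3" using s2(2) by (simp add: rel_def)
  moreover have "keep k s ?s3" using keep_trans[OF s1(3) s2(3)] by simp
  ultimately show ?case by blast
next
  case (For x p c)
  let ?\<tau> = "\<lambda>i. iterate (\<lambda>i \<tau>. psem c (bind_nv \<tau> x i)) i \<sigma>"
  have wf: "counter x" "p \<in> params" "x \<notin> set_vars c" "set_vars c \<inter> params = {}" "wf_c c"
    using For.prems(1) by auto
  \<comment> \<open>The bound of the loop is a parameter, so it keeps its initial value throughout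
    the iteration.\<close>
  have pr: "nv (?\<tau> i) y = nv \<sigma> y" if "y \<in> params" for i y
  proof (rule nv_iterate)
    show "nv (psem c \<tau>) y = nv \<tau> y" for \<tau> using that wf(4) by (intro nv_psem) blast
    show "y \<noteq> x" using that wf(1) by (auto simp: counter_def)
  qed
  have body: "\<exists>s'. runs_in (comp_c c (k + 2)) (cost_c M c) t s' \<and> rel (bind_nv (?\<tau> (Suc i)) x i) s' \<and> keep k t s' \<and>
      nvar s' (tmp (k + 1)) = nvar t (tmp (k + 1)) \<and> True"
    if t: "rel (bind_nv (?\<tau> i) x i) t" for i t
  proof -
    have "bounded M (bind_nv (?\<tau> i) x i)"
      using For.prems(2) pr wf(1) by (simp add: bounded_def counter_def)
    from For.IH[OF wf(5) this t, of "k + 2"] obtain t1 where t1: "runs_in (comp_c c (k + 2)) (cost_c M c) t t1"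
      "rel (?\<tau> (Suc i)) t1" "keep (k + 2) t t1" by auto
    \<comment> \<open>The body does not assign its counter; rebinding it to \<open>i\<close> changes
      nothing.\<close>
    have "nv (?\<tau> (Suc i)) x = i" using wf(3) by (simp add: nv_psem)
    then have "bind_nv (?\<tau> (Suc i)) x i = ?\<tau> (Suc i)" using bind_nv_same[of "?\<tau> (Suc i)" x] by (simp only:)
    then have "rel (bind_nv (?\<tau> (Suc i)) x i) t1" using t1(2) by (simp only:)
    then show ?thesis using t1(1) keep_mono[OF t1(3), of k] keepD[OF t1(3), of "k + 1"] by auto
  qed
  obtain s' where s': "runs_in (loop x p k (comp_c c (k + 2))) (nv \<sigma> p * (cost_c M c + 5) + 11) s s'"
    "rel (bind_nv (?\<tau> (nv \<sigma> p)) x (nv (?\<tau> 0) x)) s'" "keep k s s'"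
    using loop_correct[of ?\<tau> s x p "nv \<sigma> p" "\<lambda>_ _ _. True" k "comp_c c (k + 2)" "cost_c M c"]
      For.prems(3) wf(1,2) pr[OF wf(2)] body by auto
  have "nv \<sigma> p \<le> M" using For.prems(2) wf(2) by (simp add: bounded_def)
  then have le: "nv \<sigma> p * (cost_c M c + 5) \<le> M * (cost_c M c + 5)" by (rule mult_right_mono) simp
  have "runs_in (comp_c (For x p c) k) (cost_c M (For x p c)) s s'"
    unfolding comp_c.simps
    by (rule runs_in_mono[OF s'(1)], simp only: cost_c.simps) (use le in linarith)
  with s'(2,3) show ?case by (intro exI[of _ s']) simp
next
  case (CSeq c d)
  obtain s1 where s1: "runs_in (comp_c c k) (cost_c M c) s s1" "rel (psem c \<sigma>) s1" "keep k s s1"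
    using CSeq.IH(1)[of \<sigma> s k] CSeq.prems by auto
  have "bounded M (psem c \<sigma>)" using CSeq.prems by (intro bounded_psem) auto
  then obtain s2 where s2: "runs_in (comp_c d k) (cost_c M d) s1 s2" "rel (psem d (psem c \<sigma>)) s2" "keep k s1 s2"
    using CSeq.IH(2)[of "psem c \<sigma>" s1 k] CSeq.prems s1(2) by auto
  show ?case using runs_in_Seq[OF s1(1) s2(1)] s2(2) keep_trans[OF s1(3) s2(3)] by (intro exI[of _ s2]) simp
qed

primrec comp_list :: "cmd list \<Rightarrow> com" where
  "comp_list [] = Do (NConst (tmp 0) 0)"
| "comp_list (c # cs) = Seq (comp_c c 0) (comp_list cs)"

primrec cost_list :: "nat \<Rightarrow> cmd list \<Rightarrow> nat" where
  "cost_list M [] = 1"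
| "cost_list M (c # cs) = cost_c M c + cost_list M cs + 1"

primrec bounded_run :: "nat \<Rightarrow> cmd list \<Rightarrow> env \<Rightarrow> bool" where
  "bounded_run M [] \<sigma> = True"
| "bounded_run M (c # cs) \<sigma> = (bounded M \<sigma> \<and> bounded_run M cs (psem c \<sigma>))"

lemma correct_list:
  "list_all wf_c cs \<Longrightarrow> bounded_run M cs \<sigma> \<Longrightarrow> rel \<sigma> s \<Longrightarrow>
     \<exists>s'. runs_in (comp_list cs) (cost_list M cs) s s' \<and> rel (fold psem cs \<sigma>) s'"
proof (induction cs arbitrary: \<sigma> s)
  case Nil
  then show ?case using runs_in_Do[of "NConst (tmp 0) 0" s]
    by (intro exI[of _ "s\<lparr>nvar := (nvar s)(tmp 0 := 0)\<rparr>"]) simp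
next
  case (Cons c cs)
  then obtain s1 where s1: "runs_in (comp_c c 0) (cost_c M c) s s1" "rel (psem c \<sigma>) s1"
    using correct_cmd[of c M \<sigma> s 0] by auto
  with Cons obtain s2 where "runs_in (comp_list cs) (cost_list M cs) s1 s2" "rel (fold psem cs (psem c \<sigma>)) s2"
    by auto
  with runs_in_Seq[OF s1(1) this(1)] show ?case by auto
qed

section \<open>Polynomial bounds on running times\<close>

text \<open>One constant serves as coefficient and exponent; the base \<open>M + 1\<close> is
  positive, so exponents can be raised freely.\<close>

definition poly_bounded :: "(nat \<Rightarrow> nat) \<Rightarrow> bool" where
  "poly_bounded f \<longleftrightarrow> (\<exists>c. \<forall>M. f M \<le> c * (M + 1) ^ c)"

lemma poly_boundedI: "(\<And>M. f M \<le> c * (M + 1) ^ c') \<Longrightarrow> poly_bounded f"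
proof -
  assume *: "\<And>M. f M \<le> c * (M + 1) ^ c'"
  have "f M \<le> (c + c') * (M + 1) ^ (c + c')" for M
    by (rule order_trans[OF *]) (intro mult_mono power_increasing; simp)
  then show ?thesis unfolding poly_bounded_def by blast
qed

lemma poly_bounded_const: "poly_bounded (\<lambda>_. k)"
  by (rule poly_boundedI[of _ k 0]) simp

lemma poly_bounded_id: "poly_bounded (\<lambda>M. M)"
  by (rule poly_boundedI[of _ 1 1]) simp

lemma poly_bounded_mult:
  assumes "poly_bounded f" "poly_bounded g" shows "poly_bounded (\<lambda>M. f M * g M)"
proof -
  from assms obtain c d where *: "\<And>M. f M \<le> c * (M + 1) ^ c" "\<And>M. g M \<le> d * (M + 1) ^ d"
    unfolding poly_bounded_def by blast
  have "f M * g M \<le> (c * d) * (M + 1) ^ (c + d)" for M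
    using mult_mono[OF *] by (simp add: power_add algebra_simps)
  then show ?thesis by (rule poly_boundedI)
qed

lemma poly_bounded_add:
  assumes "poly_bounded f" "poly_bounded g" shows "poly_bounded (\<lambda>M. f M + g M)"
proof -
  from assms obtain c d where *: "\<And>M. f M \<le> c * (M + 1) ^ c" "\<And>M. g M \<le> d * (M + 1) ^ d"
    unfolding poly_bounded_def by blast
  have "f M + g M \<le> (c + d) * (M + 1) ^ (c + d)" for M
  proof -
    have "c * (M + 1) ^ c \<le> c * (M + 1) ^ (c + d)" "d * (M + 1) ^ d \<le> d * (M + 1) ^ (c + d)"
      by (intro mult_left_mono power_increasing; simp)+
    with *[of M] show ?thesis by (simp only: add_mult_distrib)
  qed
  then show ?thesis by (rule poly_boundedI)
qed

lemmas poly_bounded_intros = poly_bounded_const poly_bounded_id poly_bounded_mult poly_bounded_add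

lemma poly_bounded_cost_exp:
  "poly_bounded (\<lambda>M. cost_n M e)" "poly_bounded (\<lambda>M. cost_r M e')" "poly_bounded (\<lambda>M. cost_b M e'')"
  by (induction e and e' and e'') (simp_all only: cost_n.simps cost_r.simps cost_b.simps poly_bounded_intros)

lemma poly_bounded_cost_c: "poly_bounded (\<lambda>M. cost_c M c)"
  by (induction c) (simp_all only: cost_c.simps poly_bounded_intros poly_bounded_cost_exp)

lemma poly_bounded_cost_list: "poly_bounded (\<lambda>M. cost_list M cs)"
  by (induction cs) (simp_all only: cost_list.simps poly_bounded_intros poly_bounded_cost_c)

section \<open>Array segments filled by loops\<close>

definition seg_r :: "env \<Rightarrow> name \<Rightarrow> nat \<Rightarrow> nat \<Rightarrow> (nat \<Rightarrow> real) \<Rightarrow> env" where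
  "seg_r \<sigma> a l h g = \<sigma>\<lparr>ra := (ra \<sigma>)(a := \<lambda>z. if l \<le> z \<and> z < h then g z else ra \<sigma> a z)\<rparr>"

definition seg_n :: "env \<Rightarrow> name \<Rightarrow> nat \<Rightarrow> nat \<Rightarrow> (nat \<Rightarrow> nat) \<Rightarrow> env" where
  "seg_n \<sigma> a l h g = \<sigma>\<lparr>na := (na \<sigma>)(a := \<lambda>z. if l \<le> z \<and> z < h then g z else na \<sigma> a z)\<rparr>"

lemma seg_empty [simp]: "seg_r \<sigma> a l l g = \<sigma>" "seg_n \<sigma> a l l g' = \<sigma>"
  by (simp_all add: seg_r_def seg_n_def cong: conj_cong)

lemma seg_join:
  assumes "l \<le> k" "k \<le> h"
  shows "seg_r (seg_r \<sigma> a l k g) a k h g = seg_r \<sigma> a l h g"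
    "seg_n (seg_n \<sigma> a l k g') a k h g' = seg_n \<sigma> a l h g'"
proof -
  have *: "(\<lambda>z. if k \<le> z \<and> z < h then f z else if l \<le> z \<and> z < k then f z else A z) =
      (\<lambda>z. if l \<le> z \<and> z < h then f z else A z)" for f A :: "nat \<Rightarrow> real"
    using assms by (intro ext) auto
  show "seg_r (seg_r \<sigma> a l k g) a k h g = seg_r \<sigma> a l h g"
    by (simp add: seg_r_def * cong: if_cong del: if_split)
  have "(\<lambda>z. if k \<le> z \<and> z < h then f z else if l \<le> z \<and> z < k then f z else A z) =
      (\<lambda>z. if l \<le> z \<and> z < h then f z else A z)" for f A :: "nat \<Rightarrow> nat"
    using assms by (intro ext) auto
  then show "seg_n (seg_n \<sigma> a l k g') a k h g' = seg_n \<sigma> a l h g'"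
    by (simp add: seg_n_def cong: if_cong del: if_split)
qed

lemma nv_seg [simp]: "nv (seg_r \<sigma> a l h g) = nv \<sigma>" "nv (seg_n \<sigma> a l h g') = nv \<sigma>"
  by (simp_all add: seg_r_def seg_n_def)

lemma bind_seg:
  "(seg_r \<sigma> a l h g)\<lparr>nv := f\<rparr> = seg_r (\<sigma>\<lparr>nv := f\<rparr>) a l h g"
  "(seg_n \<sigma> a l h g')\<lparr>nv := f\<rparr> = seg_n (\<sigma>\<lparr>nv := f\<rparr>) a l h g'"
  by (simp_all add: seg_r_def seg_n_def cong: if_cong)

text \<open>Every round appends a block of width \<open>w\<close> to the segment. The body sees the
  part filled so far, which admits tables defined by recursion on earlier entries.\<close>

lemma fill_r_For:
  assumes "\<And>i. i < nv \<sigma> p \<Longrightarrow> psem c (seg_r (bind_nv \<sigma> x i) a l (l + i * w) g) = seg_r (bind_nv \<sigma> x i) a l (l + Suc i * w) g"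
  shows "psem (For x p c) \<sigma> = seg_r \<sigma> a l (l + nv \<sigma> p * w) g"
proof -
  let ?it = "\<lambda>i. iterate (\<lambda>i \<tau>. psem c (bind_nv \<tau> x i)) i \<sigma>"
  have "\<exists>u. ?it i = seg_r (bind_nv \<sigma> x u) a l (l + i * w) g" if "i \<le> nv \<sigma> p" for i
    using that
  proof (induction i)
    case 0 show ?case by (intro exI[of _ "nv \<sigma> x"]) simp
  next
    case (Suc i)
    obtain u where "?it i = seg_r (bind_nv \<sigma> x u) a l (l + i * w) g"
      using Suc.IH[OF Suc_leD[OF Suc.prems]] by blast
    then have "?it (Suc i) = psem c (seg_r (bind_nv \<sigma> x i) a l (l + i * w) g)" by (simp add: bind_seg)
    with assms[of i] Suc.prems have "?it (Suc i) = seg_r (bind_nv \<sigma> x i) a l (l + Suc i * w) g"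
      by (simp only: Suc_le_eq)
    then show ?case by (rule exI)
  qed
  from this[of "nv \<sigma> p"] show ?thesis by (auto simp: bind_seg)
qed

lemma fill_n_For:
  assumes "\<And>i. i < nv \<sigma> p \<Longrightarrow> psem c (seg_n (bind_nv \<sigma> x i) a l (l + i * w) g) = seg_n (bind_nv \<sigma> x i) a l (l + Suc i * w) g"
  shows "psem (For x p c) \<sigma> = seg_n \<sigma> a l (l + nv \<sigma> p * w) g"
proof -
  let ?it = "\<lambda>i. iterate (\<lambda>i \<tau>. psem c (bind_nv \<tau> x i)) i \<sigma>"
  have "\<exists>u. ?it i = seg_n (bind_nv \<sigma> x u) a l (l + i * w) g" if "i \<le> nv \<sigma> p" for i
    using that
  proof (induction i)
    case 0 show ?case by (intro exI[of _ "nv \<sigma> x"]) simp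
  next
    case (Suc i)
    obtain u where "?it i = seg_n (bind_nv \<sigma> x u) a l (l + i * w) g"
      using Suc.IH[OF Suc_leD[OF Suc.prems]] by blast
    then have "?it (Suc i) = psem c (seg_n (bind_nv \<sigma> x i) a l (l + i * w) g)" by (simp add: bind_seg)
    with assms[of i] Suc.prems have "?it (Suc i) = seg_n (bind_nv \<sigma> x i) a l (l + Suc i * w) g"
      by (simp only: Suc_le_eq)
    then show ?case by (rule exI)
  qed
  from this[of "nv \<sigma> p"] show ?thesis by (auto simp: bind_seg)
qed

lemma fill_StR:
  assumes "nval ie \<tau> = k" "rval e \<tau> = g k"
  shows "psem (StR a ie e) \<tau> = seg_r \<tau> a k (Suc k) g"
proof -
  have "A(k := g k) = (\<lambda>z. if k \<le> z \<and> z < Suc k then g z else A z)" for A by auto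
  then show ?thesis using assms by (simp add: seg_r_def)
qed

lemma fill_StN:
  assumes "nval ie \<tau> = k" "nval e \<tau> = g k"
  shows "psem (StN a ie e) \<tau> = seg_n \<tau> a k (Suc k) g"
proof -
  have "A(k := g k) = (\<lambda>z. if k \<le> z \<and> z < Suc k then g z else A z)" for A by auto
  then show ?thesis using assms by (simp add: seg_n_def)
qed

lemma fill_r1:
  assumes "\<And>i \<tau>. i < nv \<sigma> p \<Longrightarrow> \<tau> = seg_r (bind_nv \<sigma> x i) a l (l + i) g \<Longrightarrow> nval ie \<tau> = l + i \<and> rval e \<tau> = g (l + i)"
  shows "psem (For x p (StR a ie e)) \<sigma> = seg_r \<sigma> a l (l + nv \<sigma> p) g"
proof -
  have "psem (For x p (StR a ie e)) \<sigma> = seg_r \<sigma> a l (l + nv \<sigma> p * 1) g"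
  proof (rule fill_r_For)
    fix i assume i: "i < nv \<sigma> p"
    show "psem (StR a ie e) (seg_r (bind_nv \<sigma> x i) a l (l + i * 1) g) = seg_r (bind_nv \<sigma> x i) a l (l + Suc i * 1) g"
      using assms[OF i refl] fill_StR[of ie "seg_r (bind_nv \<sigma> x i) a l (l + i) g" "l + i" e g a]
      by (simp add: seg_join)
  qed
  then show ?thesis by simp
qed

lemma fill_n1:
  assumes "\<And>i \<tau>. i < nv \<sigma> p \<Longrightarrow> \<tau> = seg_n (bind_nv \<sigma> x i) a l (l + i) g \<Longrightarrow> nval ie \<tau> = l + i \<and> nval e \<tau> = g (l + i)"
  shows "psem (For x p (StN a ie e)) \<sigma> = seg_n \<sigma> a l (l + nv \<sigma> p) g"
proof -
  have "psem (For x p (StN a ie e)) \<sigma> = seg_n \<sigma> a l (l + nv \<sigma> p * 1) g"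
  proof (rule fill_n_For)
    fix i assume i: "i < nv \<sigma> p"
    show "psem (StN a ie e) (seg_n (bind_nv \<sigma> x i) a l (l + i * 1) g) = seg_n (bind_nv \<sigma> x i) a l (l + Suc i * 1) g"
      using assms[OF i refl] fill_StN[of ie "seg_n (bind_nv \<sigma> x i) a l (l + i) g" "l + i" e g a]
      by (simp add: seg_join)
  qed
  then show ?thesis by simp
qed

lemma fill_r2:
  assumes "x \<noteq> r"
    and "\<And>i j \<tau>. i < nv \<sigma> p \<Longrightarrow> j < nv \<sigma> r \<Longrightarrow>
      \<tau> = seg_r (bind_nv (bind_nv \<sigma> x i) y j) a l (l + i * nv \<sigma> r + j) g \<Longrightarrow>
      nval ie \<tau> = l + i * nv \<sigma> r + j \<and> rval e \<tau> = g (l + i * nv \<sigma> r + j)"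
  shows "psem (For x p (For y r (StR a ie e))) \<sigma> = seg_r \<sigma> a l (l + nv \<sigma> p * nv \<sigma> r) g"
proof (rule fill_r_For)
  fix i assume i: "i < nv \<sigma> p"
  let ?s = "seg_r (bind_nv \<sigma> x i) a l (l + i * nv \<sigma> r) g"
  have "psem (For y r (StR a ie e)) ?s = seg_r ?s a (l + i * nv \<sigma> r) (l + i * nv \<sigma> r + nv ?s r) g"
  proof (rule fill_r1)
    fix j \<tau> assume j: "j < nv ?s r" and \<tau>: "\<tau> = seg_r (bind_nv ?s y j) a (l + i * nv \<sigma> r) (l + i * nv \<sigma> r + j) g"
    have "\<tau> = seg_r (bind_nv (bind_nv \<sigma> x i) y j) a l (l + i * nv \<sigma> r + j) g"
      unfolding \<tau> nv_seg bind_seg by (subst seg_join) simp_all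
    from assms(2)[OF i _ this] j assms(1) show "nval ie \<tau> = l + i * nv \<sigma> r + j \<and> rval e \<tau> = g (l + i * nv \<sigma> r + j)"
      by simp
  qed
  then show "psem (For y r (StR a ie e)) ?s = seg_r (bind_nv \<sigma> x i) a l (l + Suc i * nv \<sigma> r) g"
    using assms(1) by (simp add: seg_join add.commute add.left_commute del: psem.simps)
qed

lemma fill_r3:
  assumes "x \<noteq> r" "x \<noteq> q" "y \<noteq> q"
    and "\<And>i j k \<tau>. i < nv \<sigma> p \<Longrightarrow> j < nv \<sigma> r \<Longrightarrow> k < nv \<sigma> q \<Longrightarrow>
      \<tau> = seg_r (bind_nv (bind_nv (bind_nv \<sigma> x i) y j) z k) a l (l + (i * nv \<sigma> r + j) * nv \<sigma> q + k) g \<Longrightarrow>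
      nval ie \<tau> = l + (i * nv \<sigma> r + j) * nv \<sigma> q + k \<and> rval e \<tau> = g (l + (i * nv \<sigma> r + j) * nv \<sigma> q + k)"
  shows "psem (For x p (For y r (For z q (StR a ie e)))) \<sigma> = seg_r \<sigma> a l (l + nv \<sigma> p * (nv \<sigma> r * nv \<sigma> q)) g"
proof (rule fill_r_For)
  fix i assume i: "i < nv \<sigma> p"
  let ?l = "l + i * (nv \<sigma> r * nv \<sigma> q)"
  let ?s = "seg_r (bind_nv \<sigma> x i) a l ?l g"
  have "psem (For y r (For z q (StR a ie e))) ?s = seg_r ?s a ?l (?l + nv ?s r * nv ?s q) g"
  proof (rule fill_r2[OF assms(3)])
    fix j k \<tau> assume j: "j < nv ?s r" and k: "k < nv ?s q"
      and \<tau>: "\<tau> = seg_r (bind_nv (bind_nv ?s y j) z k) a ?l (?l + j * nv ?s q + k) g"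
    have e: "?l + j * nv ?s q + k = l + (i * nv \<sigma> r + j) * nv \<sigma> q + k"
      using assms(2) by (simp add: algebra_simps)
    have "\<tau> = seg_r (bind_nv (bind_nv (bind_nv \<sigma> x i) y j) z k) a l (l + (i * nv \<sigma> r + j) * nv \<sigma> q + k) g"
      unfolding \<tau> e bind_seg nv_seg
      by (subst seg_join) (use assms(2) in \<open>simp_all add: distrib_right mult.assoc add.assoc\<close>)
    from assms(4)[OF i _ _ this] j k assms(1,2)
    show "nval ie \<tau> = ?l + j * nv ?s q + k \<and> rval e \<tau> = g (?l + j * nv ?s q + k)"
      unfolding e by simp
  qed
  then show "psem (For y r (For z q (StR a ie e))) ?s = seg_r (bind_nv \<sigma> x i) a l (l + Suc i * (nv \<sigma> r * nv \<sigma> q)) g"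
    using assms(1,2) by (simp add: seg_join add.commute add.left_commute del: psem.simps)
qed

section \<open>Recursion over the heap-ordered tree\<close>

text \<open>Index \<open>0\<close> is its own left child and must be excluded. All indices outside
  \<open>1..<n\<close> count as leaves, so tables have a definite entry at \<open>0\<close> as
  well.\<close>

function tree_rec :: "nat \<Rightarrow> (nat \<Rightarrow> 'a) \<Rightarrow> (nat \<Rightarrow> 'a \<Rightarrow> 'a \<Rightarrow> 'a) \<Rightarrow> nat \<Rightarrow> 'a" where
  "tree_rec n lf nd v =
     (if 0 < v \<and> v < n then nd v (tree_rec n lf nd (2 * v)) (tree_rec n lf nd (2 * v + 1)) else lf v)"
  by auto
termination by (relation "Wellfounded.measure (\<lambda>(n, lf, nd, v). n - v)") auto

declare tree_rec.simps [simp del]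

lemma tree_rec_node: "0 < v \<Longrightarrow> v < n \<Longrightarrow>
    tree_rec n lf nd v = nd v (tree_rec n lf nd (2 * v)) (tree_rec n lf nd (2 * v + 1))"
  by (subst tree_rec.simps) simp

lemma tree_rec_leaf: "\<not> (0 < v \<and> v < n) \<Longrightarrow> tree_rec n lf nd v = lf v"
  by (subst tree_rec.simps) (simp only: if_False)

lemma tree_induct [consumes 2, case_names leaf node]:
  assumes "0 < v" and "v < 2 * n"
    and leaf: "\<And>v. n \<le> v \<Longrightarrow> v < 2 * n \<Longrightarrow> P v"
    and node: "\<And>v. 0 < v \<Longrightarrow> v < n \<Longrightarrow> P (2 * v) \<Longrightarrow> P (2 * v + 1) \<Longrightarrow> P v"
  shows "P (v :: nat)"
  using assms(1,2)
proof (induction "2 * n - v" arbitrary: v rule: less_induct)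
  case less
  show ?case
  proof (cases "v < n")
    case True
    have "P (2 * v)" "P (2 * v + 1)" using less.prems True by (auto intro!: less.hyps)
    with node less.prems True show ?thesis by blast
  qed (use leaf less.prems in auto)
qed

lemma root_induct [consumes 1, case_names base child]:
  assumes "0 < v" and "P 1" and "\<And>v. 2 \<le> v \<Longrightarrow> P (v div 2) \<Longrightarrow> P v"
  shows "P (v :: nat)"
  using assms(1)
proof (induction v rule: less_induct)
  case (less v)
  show ?case
  proof (cases "v = 1")
    case False
    with less have "2 \<le> v" "P (v div 2)" by (auto intro: less.IH)
    then show ?thesis by (rule assms(3))
  qed (use assms(2) in simp)
qed

text \<open>The vertices \<open>v..<2 * v\<close> form the frontier left after removing the first \<open>v - 1\<close> vertices.\<close>

lemma frontier_step:
  fixes g :: "nat \<Rightarrow> 'a::comm_monoid_add"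
  assumes "0 < v"
  shows "(\<Sum>w=v..<2 * v. g w) = g v + (\<Sum>w\<in>{v<..<2 * v}. g w)"
    and "(\<Sum>w=Suc v..<2 * Suc v. g w) = (\<Sum>w\<in>{v<..<2 * v}. g w) + (g (2 * v) + g (2 * v+1))"
proof -
  have *: "{v..<2 * v} = insert v {v<..<2 * v}" "{Suc v..<2 * Suc v} = insert (2 * v) (insert (2 * v+1) {v<..<2 * v})"
    using assms by auto
  show "(\<Sum>w=v..<2 * v. g w) = g v + (\<Sum>w\<in>{v<..<2 * v}. g w)"
    "(\<Sum>w=Suc v..<2 * Suc v. g w) = (\<Sum>w\<in>{v<..<2 * v}. g w) + (g (2 * v) + g (2 * v+1))"
    unfolding * by (simp_all add: add_ac)
qed

lemma frontier_step_prod: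
  fixes g :: "nat \<Rightarrow> 'a::comm_monoid_mult"
  assumes "0 < v"
  shows "(\<Prod>w=v..<2 * v. g w) = g v * (\<Prod>w\<in>{v<..<2 * v}. g w)"
    and "(\<Prod>w=Suc v..<2 * Suc v. g w) = (\<Prod>w\<in>{v<..<2 * v}. g w) * (g (2 * v) * g (2 * v+1))"
proof -
  have *: "{v..<2 * v} = insert v {v<..<2 * v}" "{Suc v..<2 * Suc v} = insert (2 * v) (insert (2 * v+1) {v<..<2 * v})"
    using assms by auto
  show "(\<Prod>w=v..<2 * v. g w) = g v * (\<Prod>w\<in>{v<..<2 * v}. g w)"
    "(\<Prod>w=Suc v..<2 * Suc v. g w) = (\<Prod>w\<in>{v<..<2 * v}. g w) * (g (2 * v) * g (2 * v+1))"
    unfolding * by (simp_all add: mult_ac)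
qed

lemma tree_rec_sum:
  fixes g lf :: "nat \<Rightarrow> real"
  assumes "0 < n"
  shows "tree_rec n lf (\<lambda>v x y. x + y + g v) 1 = (\<Sum>v=1..<n. g v) + (\<Sum>v=n..<2 * n. lf v)"
proof -
  let ?R = "tree_rec n lf (\<lambda>v x y. x + y + g v)"
  \<comment> \<open>The frontier sweeps down the tree: its values plus the contributions of the
    removed vertices stay constant.\<close>
  have "(\<Sum>w=v..<2 * v. ?R w) + (\<Sum>w=1..<v. g w) = ?R 1" if "0 < v" "v \<le> n" for v
    using that
  proof (induction v)
    case (Suc v)
    show ?case
    proof (cases "v = 0")
      case True
      have "{1..<2::nat} = {1}" by auto
      with True show ?thesis by simp
    next
      case False
      then have "?R v = ?R (2 * v) + ?R (2 * v+1) + g v" using Suc.prems by (intro tree_rec_node) auto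
      with Suc False frontier_step[of v ?R] show ?thesis by (simp add: sum.atLeastLessThan_Suc)
    qed
  qed simp
  from this[of n] have "?R 1 = (\<Sum>w=n..<2 * n. ?R w) + (\<Sum>w=1..<n. g w)" using assms by simp
  also have "(\<Sum>w=n..<2 * n. ?R w) = (\<Sum>w=n..<2 * n. lf w)" by (intro sum.cong tree_rec_leaf) auto
  finally show ?thesis by simp
qed

section \<open>Depths and cut levels\<close>

fun depth :: "nat \<Rightarrow> nat" where
  "depth v = (if v \<le> 1 then 0 else Suc (depth (v div 2)))"

declare depth.simps [simp del]

lemma depth_1 [simp]: "depth (Suc 0) = 0" by (subst depth.simps) simp

lemma depth_children:
  assumes "0 < v" shows "depth (2 * v) = Suc (depth v)" "depth (2 * v + 1) = Suc (depth v)" "depth (Suc (2 * v)) = Suc (depth v)"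
  using assms by (subst depth.simps; simp)+

lemma depth_le_iff: "0 < v \<Longrightarrow> depth v \<le> k \<longleftrightarrow> v < 2 ^ Suc k"
proof (induction v arbitrary: k rule: root_induct)
  case base
  have "1 < (2::nat) ^ Suc k" by (rule one_less_power) simp_all
  then show ?case by simp
next
  case (child v)
  have d: "depth v = Suc (depth (v div 2))" using child.hyps by (subst depth.simps) simp
  show ?case
  proof (cases k)
    case 0
    have "\<not> v < 2" using child.hyps by simp
    then show ?thesis using d 0 by simp
  next
    case (Suc k')
    have "v div 2 < 2 ^ Suc k' \<longleftrightarrow> v < 2 ^ Suc k' * 2" by (rule div_less_iff_less_mult) simp
    then show ?thesis using child.IH[of k'] d Suc by (simp add: mult.commute)
  qed
qed

text \<open>The ceiling of \<open>k / h\<close>: the number of cut depths in \<open>0..<k\<close>,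
  that is, of cut vertices strictly above a vertex at depth \<open>k\<close>.\<close>

primrec cuts :: "nat \<Rightarrow> nat \<Rightarrow> nat" where
  "cuts h 0 = 0"
| "cuts h (Suc k) = cuts h k + (if k mod h = 0 then 1 else 0)"

lemma cuts_bounds:
  assumes "0 < h" shows "k \<le> h * cuts h k" "h * cuts h k < k + h"
proof -
  \<comment> \<open>The ceiling without division; both bounds follow from the size of the
    remainder.\<close>
  have "h * cuts h k + k mod h = k + (if k mod h = 0 then 0 else h)"
  proof (induction k)
    case (Suc k)
    then show ?case using assms by (auto simp: mod_Suc algebra_simps split: if_splits)
  qed simp
  moreover have "k mod h < h" using assms by simp
  ultimately show "k \<le> h * cuts h k" "h * cuts h k < k + h" by (auto split: if_splits)
qed

lemma cuts_mono: "j \<le> k \<Longrightarrow> cuts h j \<le> cuts h k"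
  by (rule lift_Suc_mono_le[of "cuts h"]) auto

section \<open>History-coded labelings\<close>

text \<open>Here \<open>a l i\<close> is the load that a leaf with label \<open>l\<close> puts on
  row \<open>i\<close>, \<open>h\<close> is the distance between cuts, and \<open>G\<close> is
  membership in the set of allowed triples.\<close>

locale block_tree =
  fixes H q m h root :: nat and a :: "nat \<Rightarrow> nat \<Rightarrow> real" and G :: "nat \<Rightarrow> nat \<Rightarrow> nat \<Rightarrow> bool"
  assumes root: "root < q" and h: "0 < h" and a_nonneg: "\<And>l i. 0 \<le> a l i"
begin

definition n :: nat where "n = 2 ^ H"

definition cut :: "nat \<Rightarrow> bool" where "cut v \<longleftrightarrow> depth v mod h = 0"

text \<open>
  A code \<open>g * q + l\<close> stands for the label \<open>l\<close> together with the labels, packed into \<open>g\<close>, of the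
  strict ancestors at cut depths.
\<close>

definition hist :: "nat \<Rightarrow> nat \<Rightarrow> nat" where "hist v y = (if cut v then y else y div q)"

definition coded :: "(nat \<Rightarrow> nat) \<Rightarrow> bool" where
  "coded L \<longleftrightarrow> L 1 = root \<and>
     (\<forall>v. 0 < v \<longrightarrow> v < n \<longrightarrow> L (2 * v) div q = hist v (L v) \<and> L (2 * v + 1) div q = hist v (L v))"

text \<open>In base \<open>q\<close>, a code has one digit for its own label and one for each strict
  cut ancestor, of which a leaf has \<open>cuts h H\<close>.\<close>

definition Q :: nat where "Q = q ^ Suc (cuts h H)"

definition load :: "(nat \<Rightarrow> nat) \<Rightarrow> nat \<Rightarrow> nat \<Rightarrow> real" where
  "load L i = tree_rec n (\<lambda>v. a (L v mod q) i) (\<lambda>v x y. x + y)"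

lemma n_pos [simp]: "0 < n" by (simp add: n_def)

lemma q_pos: "0 < q" using root by simp

lemma Q_pos: "0 < Q" using q_pos by (simp add: Q_def)

lemma load_node: "0 < v \<Longrightarrow> v < n \<Longrightarrow> load L i v = load L i (2 * v) + load L i (2 * v + 1)"
  unfolding load_def by (rule tree_rec_node)

lemma load_leaf: "n \<le> v \<Longrightarrow> load L i v = a (L v mod q) i"
  unfolding load_def by (rule tree_rec_leaf) simp

lemma load_nonneg: "0 < v \<Longrightarrow> v < 2 * n \<Longrightarrow> 0 \<le> load L i v"
  by (induction v rule: tree_induct[where n = n]) (simp_all add: load_node load_leaf a_nonneg)

lemma load_root: "load L i 1 = (\<Sum>v=n..<2 * n. a (L v mod q) i)"
  using tree_rec_sum[of n "\<lambda>v. a (L v mod q) i" "\<lambda>_. 0"] by (simp add: load_def)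

lemma depth_le: "0 < v \<Longrightarrow> v < 2 * n \<Longrightarrow> depth v \<le> H"
  by (simp add: depth_le_iff n_def)

lemma coded_child:
  assumes "coded L" "2 \<le> v" "v < 2 * n"
  shows "L v div q = hist (v div 2) (L (v div 2))"
proof -
  have "0 < v div 2" "v div 2 < n" using assms by auto
  moreover have "v = 2 * (v div 2) \<or> v = 2 * (v div 2) + 1" by presburger
  ultimately show ?thesis using assms(1) unfolding coded_def by metis
qed

lemma depth_child: "2 \<le> v \<Longrightarrow> depth v = Suc (depth (v div 2))"
  by (subst depth.simps) simp

lemma coded_bound_depth:
  assumes "coded L"
  shows "0 < v \<Longrightarrow> v < 2 * n \<Longrightarrow> L v < q ^ Suc (cuts h (depth v))"
proof (induction v rule: root_induct)
  case base then show ?case using assms root by (simp add: coded_def)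
next
  case (child v)
  let ?p = "v div 2"
  have IH: "L ?p < q ^ Suc (cuts h (depth ?p))" using child by (simp add: child.IH)
  have "hist ?p (L ?p) < q ^ cuts h (depth v)"
    using IH child.hyps by (auto simp: hist_def cut_def depth_child less_mult_imp_div_less mult.commute)
  then have "L v div q < q ^ cuts h (depth v)" using coded_child[OF assms child.hyps child.prems] by simp
  then have "L v < q ^ cuts h (depth v) * q" using q_pos by (simp add: div_less_iff_less_mult)
  then show ?case by (simp add: mult.commute)
qed

lemma coded_bound: "coded L \<Longrightarrow> 0 < v \<Longrightarrow> v < 2 * n \<Longrightarrow> L v < Q"
proof -
  assume L: "coded L" and v: "0 < v" "v < 2 * n"
  have "L v < q ^ Suc (cuts h (depth v))" by (rule coded_bound_depth[OF L v])
  also have "\<dots> \<le> Q" unfolding Q_def using q_pos depth_le[OF v] by (intro power_increasing) (simp_all add: cuts_mono)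
  finally show ?thesis .
qed

section \<open>Cheapest labelings by dynamic programming\<close>

text \<open>A label with an entry above \<open>1\<close> cannot occur at a leaf of a feasible
  labeling. Penalising such entries yields solutions with load at most \<open>1\<close> per leaf, on
  which both the growth estimate for the weights and the final exponential estimate rest.\<close>

definition excess :: "nat \<Rightarrow> real" where "excess l = (\<Sum>i<m. if 1 < a l i then 1 else 0)"

definition viol :: "nat \<Rightarrow> nat \<Rightarrow> nat \<Rightarrow> real" where "viol l l1 l2 = (if G l l1 l2 then 0 else 1)"

text \<open>\<open>acc W v i g\<close> is the total weight of row \<open>i\<close> at the strict ancestors of \<open>v\<close> at cut depths whose labels are packed into \<open>g\<close>.\<close>

fun acc :: "(nat \<Rightarrow> nat \<Rightarrow> nat \<Rightarrow> real) \<Rightarrow> nat \<Rightarrow> nat \<Rightarrow> nat \<Rightarrow> real" where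
  "acc W v i g =
     (if v \<le> 1 then 0
      else if cut (v div 2) then acc W (v div 2) i (g div q) + W (v div 2) i g
      else acc W (v div 2) i g)"

declare acc.simps [simp del]

lemma acc_children:
  assumes "0 < v"
  shows "acc W (2 * v) i g = (if cut v then acc W v i (g div q) + W v i g else acc W v i g)"
    "acc W (2 * v + 1) i g = (if cut v then acc W v i (g div q) + W v i g else acc W v i g)"
  using assms by (subst acc.simps; simp)+

context
  fixes W :: "nat \<Rightarrow> nat \<Rightarrow> nat \<Rightarrow> real" and big :: real
begin

text \<open>Together with \<open>credit\<close> this is the Lagrangian of the conditional
  constraints: the weighted load below a cut vertex is distributed over its leaves through
  \<open>acc\<close>, and the constant \<open>1\<close> on the right-hand side is credited at the
  cut vertex.\<close>

definition leaf_cost :: "nat \<Rightarrow> nat \<Rightarrow> real" where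
  "leaf_cost v y = (\<Sum>i<m. acc W v i (y div q) * a (y mod q) i) + big * excess (y mod q)"

definition credit :: "nat \<Rightarrow> nat \<Rightarrow> real" where
  "credit v y = (if cut v then (\<Sum>i<m. W v i y) else 0)"

text \<open>Codes that no coded labeling uses may overflow; clamping keeps all table indices below \<open>Q\<close>.\<close>

definition clamp :: "nat \<Rightarrow> nat" where "clamp z = (if z < Q then z else 0)"

definition node_cost :: "(nat \<Rightarrow> real) \<Rightarrow> (nat \<Rightarrow> real) \<Rightarrow> nat \<Rightarrow> nat \<Rightarrow> nat \<Rightarrow> real" where
  "node_cost f g v y p =
     f (clamp (hist v y * q + p div q)) + g (clamp (hist v y * q + p mod q)) + big * viol (y mod q) (p div q) (p mod q) - credit v y"

definition dp :: "nat \<Rightarrow> nat \<Rightarrow> real" where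
  "dp = tree_rec n leaf_cost (\<lambda>v f g y. node_cost f g v y (argmin (node_cost f g v y) (q * q)))"

definition choice :: "nat \<Rightarrow> nat \<Rightarrow> nat" where
  "choice v y = argmin (node_cost (dp (2 * v)) (dp (2 * v + 1)) v y) (q * q)"

fun best :: "nat \<Rightarrow> nat" where
  "best v =
     (if v \<le> 1 then root
      else let p = v div 2; y = best p; c = choice p y
           in hist p y * q + (if even v then c div q else c mod q))"

declare best.simps [simp del]

definition total_cost :: "(nat \<Rightarrow> nat) \<Rightarrow> nat \<Rightarrow> real" where
  "total_cost L = tree_rec n (\<lambda>v. leaf_cost v (L v))
     (\<lambda>v x y. x + y + (big * viol (L v mod q) (L (2 * v) mod q) (L (2 * v + 1) mod q) - credit v (L v)))"

text \<open>The same cost in another account: here a constraint is charged at its own vertex, so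
  that it reads as a weighted violation; \<open>total_cost\<close> charges it at the leaves, so that
  the dynamic program meets only local terms.\<close>

definition own_cost :: "(nat \<Rightarrow> nat) \<Rightarrow> nat \<Rightarrow> real" where
  "own_cost L = tree_rec n (\<lambda>v. big * excess (L v mod q))
     (\<lambda>v x y. x + y + (big * viol (L v mod q) (L (2 * v) mod q) (L (2 * v + 1) mod q) +
        (if cut v then (\<Sum>i<m. W v i (L v) * (load L i v - 1)) else 0)))"

lemma dp_leaf: "n \<le> v \<Longrightarrow> dp v = leaf_cost v"
  unfolding dp_def by (rule tree_rec_leaf) simp

lemma dp_node: "0 < v \<Longrightarrow> v < n \<Longrightarrow> dp v y = node_cost (dp (2 * v)) (dp (2 * v + 1)) v y (choice v y)"
  unfolding choice_def by (subst dp_def, subst tree_rec_node) (simp_all add: dp_def)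

text \<open>Exchange of summation. The two accounts differ by what the strict cut ancestors of
  \<open>v\<close> charge for the load below \<open>v\<close>, and the root has no
  ancestors.\<close>

lemma total_cost_eq:
  assumes L: "coded L"
  shows "0 < v \<Longrightarrow> v < 2 * n \<Longrightarrow>
    total_cost L v = own_cost L v + (\<Sum>i<m. acc W v i (L v div q) * load L i v)"
proof (induction v rule: tree_induct[where n = n])
  case (leaf v)
  then show ?case by (simp add: total_cost_def own_cost_def tree_rec_leaf leaf_cost_def load_leaf)
next
  case (node v)
  have ch: "L (2 * v) div q = hist v (L v)" "L (2 * v + 1) div q = hist v (L v)"
    using L node.hyps by (auto simp: coded_def)
  have acc_ch: "acc W (2 * v) i (hist v (L v)) = acc W v i (L v div q) + (if cut v then W v i (L v) else 0)"
    "acc W (2 * v + 1) i (hist v (L v)) = acc W v i (L v div q) + (if cut v then W v i (L v) else 0)" for i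
    using node.hyps(1) by (simp_all add: acc_children[OF node.hyps(1), simplified] hist_def)
  have t: "total_cost L v = total_cost L (2 * v) + total_cost L (2 * v + 1) +
      (big * viol (L v mod q) (L (2 * v) mod q) (L (2 * v + 1) mod q) - credit v (L v))"
    unfolding total_cost_def using node.hyps by (rule tree_rec_node)
  have o: "own_cost L v = own_cost L (2 * v) + own_cost L (2 * v + 1) +
      (big * viol (L v mod q) (L (2 * v) mod q) (L (2 * v + 1) mod q) +
        (if cut v then (\<Sum>i<m. W v i (L v) * (load L i v - 1)) else 0))"
    unfolding own_cost_def using node.hyps by (rule tree_rec_node)
  have "(\<Sum>i<m. acc W (2 * v) i (L (2 * v) div q) * load L i (2 * v)) +
      (\<Sum>i<m. acc W (2 * v + 1) i (L (2 * v + 1) div q) * load L i (2 * v + 1)) =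
      (\<Sum>i<m. acc W v i (L v div q) * load L i v) + (if cut v then (\<Sum>i<m. W v i (L v) * (load L i v - 1)) else 0) + credit v (L v)"
    unfolding ch acc_ch credit_def
    by (auto simp: load_node[OF node.hyps] sum.distrib[symmetric] algebra_simps intro!: sum.cong)
  with t o node.IH show ?case by simp
qed

lemma dp_le_total_cost:
  assumes L: "coded L"
  shows "0 < v \<Longrightarrow> v < 2 * n \<Longrightarrow> dp v (L v) \<le> total_cost L v"
proof (induction v rule: tree_induct[where n = n])
  case (leaf v)
  then show ?case by (simp add: dp_leaf total_cost_def tree_rec_leaf)
next
  case (node v)
  \<comment> \<open>The pair of labels that \<open>L\<close> itself gives to the children; it
    competes in the minimum.\<close>
  let ?p = "(L (2 * v) mod q) * q + L (2 * v + 1) mod q"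
  have "L (2 * v) div q = hist v (L v)" "L (2 * v + 1) div q = hist v (L v)"
    using L node.hyps by (auto simp: coded_def)
  then have "hist v (L v) * q + L (2 * v) mod q = L (2 * v)" "hist v (L v) * q + L (2 * v + 1) mod q = L (2 * v + 1)"
    using div_mult_mod_eq by metis+
  moreover have "L (2 * v) < Q" "L (2 * v + 1) < Q" using node.hyps by (auto intro: coded_bound[OF L])
  ultimately have c: "clamp (hist v (L v) * q + L (2 * v) mod q) = L (2 * v)"
    "clamp (hist v (L v) * q + L (2 * v + 1) mod q) = L (2 * v + 1)"
    by (simp_all add: clamp_def)
  have p: "?p div q = L (2 * v) mod q" "?p mod q = L (2 * v + 1) mod q" using q_pos by simp_all
  have "L (2 * v) mod q < q" using q_pos by simp
  then have "Suc (L (2 * v) mod q) * q \<le> q * q" by (intro mult_right_mono) simp_all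
  then have "?p < q * q"
    using mod_less_divisor[OF q_pos, of "L (2 * v + 1)"] by (simp only: mult_Suc)
  then have "dp v (L v) \<le> node_cost (dp (2 * v)) (dp (2 * v + 1)) v (L v) ?p"
    using node.hyps by (simp only: dp_node choice_def argmin_le)
  also have "\<dots> = dp (2 * v) (L (2 * v)) + dp (2 * v + 1) (L (2 * v + 1)) +
      (big * viol (L v mod q) (L (2 * v) mod q) (L (2 * v + 1) mod q) - credit v (L v))"
    unfolding node_cost_def p c by simp
  also have "\<dots> \<le> total_cost L (2 * v) + total_cost L (2 * v + 1) +
      (big * viol (L v mod q) (L (2 * v) mod q) (L (2 * v + 1) mod q) - credit v (L v))"
    using node.IH by simp
  also have "\<dots> = total_cost L v"
    unfolding total_cost_def using node.hyps by (rule tree_rec_node[symmetric])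
  finally show ?case .
qed

lemma choice_less: "choice v y < q * q"
  unfolding choice_def using q_pos by (intro argmin_less) simp

lemma choice_digits: "choice v y div q < q" "choice v y mod q < q"
  using choice_less[of v y] q_pos by (simp_all add: less_mult_imp_div_less)

lemma best_root: "best (Suc 0) = root" by (subst best.simps) simp

lemma best_children:
  assumes "0 < v"
  shows "best (2 * v) = hist v (best v) * q + choice v (best v) div q"
    "best (2 * v + 1) = hist v (best v) * q + choice v (best v) mod q"
  using assms by (subst best.simps; simp add: Let_def)+

lemma coded_best: "coded best"
  unfolding coded_def
  using best_children choice_digits q_pos by (auto simp: best_root[folded One_nat_def] div_add1_eq simp del: One_nat_def Suc_eq_plus1)

lemma dp_best: "0 < v \<Longrightarrow> v < 2 * n \<Longrightarrow> dp v (best v) = total_cost best v"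
proof (induction v rule: tree_induct[where n = n])
  case (leaf v)
  then show ?case by (simp add: dp_leaf total_cost_def tree_rec_leaf)
next
  case (node v)
  have md: "best (2 * v) mod q = choice v (best v) div q" "best (2 * v + 1) mod q = choice v (best v) mod q"
    using best_children[OF node.hyps(1)] choice_digits[of v "best v"] by simp_all
  have "total_cost best v = total_cost best (2 * v) + total_cost best (2 * v + 1) +
      (big * viol (best v mod q) (best (2 * v) mod q) (best (2 * v + 1) mod q) - credit v (best v))"
    unfolding total_cost_def using node.hyps by (rule tree_rec_node)
  moreover have "clamp (best (2 * v)) = best (2 * v)" "clamp (best (2 * v + 1)) = best (2 * v + 1)"
    using node.hyps coded_bound[OF coded_best, of "2 * v"] coded_bound[OF coded_best, of "2 * v + 1"]
    by (simp_all add: clamp_def)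
  ultimately show ?case
    unfolding md node.IH[symmetric] dp_node[OF node.hyps] node_cost_def best_children[OF node.hyps(1), symmetric]
    by simp
qed

lemma own_cost_best_le:
  assumes "coded L" shows "own_cost best 1 \<le> own_cost L 1"
proof -
  have "total_cost best 1 \<le> total_cost L 1"
    using dp_best[of 1] dp_le_total_cost[OF assms, of 1] coded_best assms n_pos
    by (simp add: coded_def)
  moreover have "acc W (Suc 0) i g = 0" for i g by (subst acc.simps) simp
  ultimately show ?thesis using total_cost_eq[OF assms, of 1] total_cost_eq[OF coded_best, of 1] n_pos by simp
qed

lemma own_cost_root:
  "own_cost L 1 = (\<Sum>v=1..<n. big * viol (L v mod q) (L (2 * v) mod q) (L (2 * v + 1) mod q)) +
     (\<Sum>v=n..<2 * n. big * excess (L v mod q)) +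
     (\<Sum>v=1..<n. if cut v then (\<Sum>i<m. W v i (L v) * (load L i v - 1)) else 0)"
  unfolding own_cost_def by (subst tree_rec_sum) (simp_all add: sum.distrib)

end

end

section \<open>A fractional solution by repeated best responses\<close>

locale feasible_tree = block_tree +
  fixes lab0 :: "nat \<Rightarrow> nat"
  assumes lab0_root: "lab0 1 = root"
    and lab0_less: "\<And>v. 0 < v \<Longrightarrow> v < 2 * n \<Longrightarrow> lab0 v < q"
    and lab0_G: "\<And>v. 0 < v \<Longrightarrow> v < n \<Longrightarrow> G (lab0 v) (lab0 (2 * v)) (lab0 (2 * v + 1))"
    and lab0_load: "\<And>i. i < m \<Longrightarrow> (\<Sum>v=n..<2 * n. a (lab0 v) i) \<le> 1"
begin

text \<open>Lifts the feasible labeling to codes, which makes it a competitor of the dynamic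
  program.\<close>

fun enc :: "nat \<Rightarrow> nat" where
  "enc v = (if v \<le> 1 then root else hist (v div 2) (enc (v div 2)) * q + lab0 v)"

declare enc.simps [simp del]

lemma enc_root: "enc 1 = root" by (subst enc.simps) simp

lemma enc_children:
  assumes "0 < v"
  shows "enc (2 * v) = hist v (enc v) * q + lab0 (2 * v)" "enc (2 * v + 1) = hist v (enc v) * q + lab0 (2 * v + 1)"
  using assms by (subst enc.simps; simp)+

lemma coded_enc: "coded enc"
  unfolding coded_def using enc_root enc_children lab0_less q_pos by (auto simp: div_add1_eq simp del: One_nat_def)

lemma enc_mod: "0 < v \<Longrightarrow> v < 2 * n \<Longrightarrow> enc v mod q = lab0 v"
  using lab0_less[of v] root lab0_root by (subst enc.simps) (auto simp: le_Suc_eq)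

lemma load_le_root: "0 < v \<Longrightarrow> v < 2 * n \<Longrightarrow> load L i v \<le> load L i 1"
proof (induction v rule: root_induct)
  case (child v)
  let ?p = "v div 2"
  have p: "0 < ?p" "?p < n" using child by auto
  have "v = 2 * ?p \<or> v = 2 * ?p + 1" by presburger
  moreover have "0 \<le> load L i (2 * ?p)" "0 \<le> load L i (2 * ?p + 1)" using p by (auto intro!: load_nonneg)
  ultimately have "load L i v \<le> load L i ?p" using load_node[OF p, of L i] by auto
  with child.IH p show ?case by simp
qed simp

lemma load_enc: "i < m \<Longrightarrow> 0 < v \<Longrightarrow> v < 2 * n \<Longrightarrow> load enc i v \<le> 1"
proof -
  assume i: "i < m" and v: "0 < v" "v < 2 * n"
  have "load enc i 1 = (\<Sum>v=n..<2 * n. a (lab0 v) i)"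
    unfolding load_root by (intro sum.cong) (auto simp: enc_mod)
  with load_le_root[OF v, of enc i] lab0_load[OF i] show ?thesis by linarith
qed

text \<open>A single feasible labeling satisfies the conditional constraints trivially: whatever is
  conditioned on, the load below a vertex is at most the total load. This is where the existence of
  a feasible labeling enters the analysis.\<close>

lemma own_cost_enc_le:
  assumes W: "\<And>v i y. 0 \<le> W v i y"
  shows "own_cost W big enc 1 \<le> 0"
proof -
  have 1: "viol (enc v mod q) (enc (2 * v) mod q) (enc (2 * v + 1) mod q) = 0" if "v \<in> {1..<n}" for v
    using that lab0_G[of v] by (auto simp: viol_def enc_mod)
  have 2: "excess (enc v mod q) = 0" if "v \<in> {n..<2 * n}" for v
  proof -
    have "0 < v" using that n_pos by (simp del: n_pos)
    have "a (lab0 v) i \<le> 1" if "i < m" for i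
    proof -
      have "a (lab0 v) i \<le> (\<Sum>v=n..<2 * n. a (lab0 v) i)"
        using \<open>v \<in> _\<close> a_nonneg by (intro member_le_sum) auto
      with lab0_load[OF that] show ?thesis by linarith
    qed
    then show ?thesis using that \<open>0 < v\<close> by (auto simp: excess_def enc_mod not_less intro!: sum.neutral)
  qed
  have 3: "(if cut v then (\<Sum>i<m. W v i (enc v) * (load enc i v - 1)) else 0) \<le> 0" if "v \<in> {1..<n}" for v
    using that load_enc W by (auto intro!: sum_nonpos mult_nonneg_nonpos)
  have "(\<Sum>v=1..<n. big * viol (enc v mod q) (enc (2 * v) mod q) (enc (2 * v + 1) mod q)) = 0"
    "(\<Sum>v=n..<2 * n. big * excess (enc v mod q)) = 0"
    using 1 2 by (simp_all add: sum.neutral)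
  moreover have "(\<Sum>v=1..<n. if cut v then (\<Sum>i<m. W v i (enc v) * (load enc i v - 1)) else 0) \<le> 0"
    by (intro sum_nonpos 3)
  ultimately show ?thesis unfolding own_cost_root by linarith
qed

text \<open>The best response costs no more than the feasible labeling, hence at most
  \<open>0\<close>. Every weighted constraint contributes at least \<open>- \<theta>\<close>, so all
  of them together stay above \<open>- big\<close> and cannot pay for a single penalty. Without
  penalties the weighted violation itself is nonpositive.\<close>

lemma best_response:
  fixes \<theta> :: real
  assumes W: "\<And>v i y. 0 \<le> W v i y"
    and W\<theta>: "\<And>v i. 0 < v \<Longrightarrow> v < n \<Longrightarrow> cut v \<Longrightarrow> i < m \<Longrightarrow> W v i (best W big v) \<le> \<theta>"
    and big: "real n * real m * \<theta> < big" "0 \<le> \<theta>"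
  shows "\<And>v. 0 < v \<Longrightarrow> v < n \<Longrightarrow> G (best W big v mod q) (best W big (2 * v) mod q) (best W big (2 * v + 1) mod q)"
    and "\<And>v i. n \<le> v \<Longrightarrow> v < 2 * n \<Longrightarrow> i < m \<Longrightarrow> a (best W big v mod q) i \<le> 1"
    and "(\<Sum>v=1..<n. if cut v then (\<Sum>i<m. W v i (best W big v) * (load (best W big) i v - 1)) else 0) \<le> 0"
proof -
  let ?L = "best W big"
  define A where "A = (\<Sum>v=1..<n. big * viol (?L v mod q) (?L (2 * v) mod q) (?L (2 * v + 1) mod q))"
  define E where "E = (\<Sum>v=n..<2 * n. big * excess (?L v mod q))"
  define C where "C = (\<Sum>v=1..<n. if cut v then (\<Sum>i<m. W v i (?L v) * (load ?L i v - 1)) else 0)"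
  have bp: "0 < big" using big by (meson le_less_trans mult_nonneg_nonneg of_nat_0_le_iff)
  have le: "A + E + C \<le> 0"
    using own_cost_best_le[where W = W and big = big, OF coded_enc] own_cost_enc_le[where W = W and big = big, OF W]
    unfolding own_cost_root A_def E_def C_def by linarith
  have ex_nn: "0 \<le> excess l" for l by (auto simp: excess_def intro!: sum_nonneg)
  have v_nn: "0 \<le> viol x y z" for x y z by (simp add: viol_def)
  have A0: "0 \<le> A" "0 \<le> E" unfolding A_def E_def using bp ex_nn v_nn by (auto intro!: sum_nonneg)
  have "(\<Sum>v=1..<n. - (real m * \<theta>)) \<le> C" unfolding C_def
  proof (intro sum_mono)
    fix v assume v: "v \<in> {1..<n}"
    have "(\<Sum>i<m. - \<theta>) \<le> (\<Sum>i<m. W v i (?L v) * (load ?L i v - 1))" if "cut v"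
    proof (intro sum_mono)
      fix i assume i: "i \<in> {..<m}"
      have "0 \<le> W v i (?L v) * load ?L i v" using v load_nonneg[of v ?L i] W by (intro mult_nonneg_nonneg) auto
      moreover have "W v i (?L v) \<le> \<theta>" using W\<theta> v i that by auto
      ultimately show "- \<theta> \<le> W v i (?L v) * (load ?L i v - 1)" by (simp add: algebra_simps)
    qed
    then show "- (real m * \<theta>) \<le> (if cut v then \<Sum>i<m. W v i (?L v) * (load ?L i v - 1) else 0)"
      using big(2) by auto
  qed
  then have "- (real (n - 1) * (real m * \<theta>)) \<le> C" by simp
  moreover have "real (n - 1) * (real m * \<theta>) \<le> real n * (real m * \<theta>)" using big(2) by (intro mult_right_mono) auto
  ultimately have Cb: "- big < C" using big(1) by (simp add: mult.assoc)
  show G: "G (?L v mod q) (?L (2 * v) mod q) (?L (2 * v + 1) mod q)" if v: "0 < v" "v < n" for v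
  proof (rule ccontr)
    assume "\<not> ?thesis"
    then have "big = big * viol (?L v mod q) (?L (2 * v) mod q) (?L (2 * v + 1) mod q)" by (simp add: viol_def)
    also have "\<dots> \<le> A" unfolding A_def using v bp v_nn by (intro member_le_sum) auto
    finally show False using le A0 Cb by linarith
  qed
  show "a (?L v mod q) i \<le> 1" if v: "n \<le> v" "v < 2 * n" "i < m" for v i
  proof (rule ccontr)
    assume "\<not> ?thesis"
    then have "1 = (if 1 < a (?L v mod q) i then 1 else 0 :: real)" by simp
    also have "\<dots> \<le> excess (?L v mod q)" unfolding excess_def using v(3) by (intro member_le_sum) auto
    finally have "big \<le> big * excess (?L v mod q)" using bp by simp
    also have "\<dots> \<le> E" unfolding E_def using v bp ex_nn by (intro member_le_sum) auto
    finally show False using le A0 Cb by linarith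
  qed
  show "(\<Sum>v=1..<n. if cut v then (\<Sum>i<m. W v i (?L v) * (load ?L i v - 1)) else 0) \<le> 0"
    using le A0 unfolding C_def by linarith
qed

section \<open>Constants, weights and the potential\<close>

text \<open>Larger than \<open>2 * m + 1\<close>, the bound for the rounding estimator at the root;
  a rare code on the frontier costs \<open>B\<close> and is therefore unaffordable.\<close>

definition B :: nat where "B = 4 * (m + 1)"
text \<open>Serves both as bound on all weights, which requires \<open>theta * theta\<close> to be
  at least \<open>T * n ^ 3 * m\<close>, and as the size below which a class is rare.\<close>

definition theta :: nat where "theta = B * (2 * n) ^ 4 * Q * (m + 1)"
text \<open>Rare codes at one vertex cover at most \<open>Q * theta\<close> rounds; relative to
  \<open>T\<close> and summed over fewer than \<open>2 * n\<close> vertices this leaves at most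
  \<open>1 / B\<close>.\<close>

definition T :: nat where "T = B * (2 * n) * Q * theta"
text \<open>More than all credits together as long as the weights are at most
  \<open>theta\<close>.\<close>

definition big :: real where "big = real n * real m * real theta + 1"

text \<open>
  The weights are the positive parts of accumulated constraint violations. A best response has
  nonpositive weighted violation, so the sum of the squared weights grows only linearly in time.
\<close>

primrec weight :: "nat \<Rightarrow> nat \<Rightarrow> nat \<Rightarrow> nat \<Rightarrow> real" where
  "weight 0 = (\<lambda>v i y. 0)"
| "weight (Suc t) = (\<lambda>v i y. max 0 (weight t v i y +
     (if best (weight t) big v = y then load (best (weight t) big) i v - 1 else 0)))"

definition sol :: "nat \<Rightarrow> nat \<Rightarrow> nat" where "sol t = best (weight t) big"

definition potential :: "nat \<Rightarrow> real" where
  "potential t = (\<Sum>v=1..<n. if cut v then (\<Sum>i<m. \<Sum>y<Q. (weight t v i y)\<^sup>2) else 0)"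

lemma coded_sol: "coded (sol t)" unfolding sol_def by (rule coded_best)

lemma weight_nonneg: "0 \<le> weight t v i y"
  by (cases t) simp_all

lemma theta_pos: "0 < theta" "0 < T"
  using Q_pos by (simp_all add: theta_def T_def B_def)

lemma theta_square: "T * n ^ 3 * m \<le> theta * theta"
proof -
  have "n ^ 3 * m \<le> (2 * n) ^ 3 * (m + 1)" by (intro mult_mono power_mono) auto
  then have "B * (2 * n) * Q * (n ^ 3 * m) \<le> B * (2 * n) * Q * ((2 * n) ^ 3 * (m + 1))" by (rule mult_left_mono) simp
  also have "\<dots> = theta" unfolding theta_def by (simp add: power4_eq_xxxx power3_eq_cube algebra_simps)
  finally have "B * (2 * n) * Q * (n ^ 3 * m) * theta \<le> theta * theta" by (rule mult_right_mono) simp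
  then show ?thesis by (simp add: T_def mult_ac)
qed

lemma weight_le_theta:
  assumes "potential t \<le> real t * real (n ^ 3 * m)" "t \<le> T" "0 < v" "v < n" "cut v" "i < m" "y < Q"
  shows "weight t v i y \<le> theta"
proof -
  have "(weight t v i y)\<^sup>2 \<le> (\<Sum>y<Q. (weight t v i y)\<^sup>2)" using assms by (intro member_le_sum) auto
  also have "\<dots> \<le> (\<Sum>i<m. \<Sum>y<Q. (weight t v i y)\<^sup>2)"
    using assms by (intro member_le_sum[of i "{..<m}" "\<lambda>i. \<Sum>y<Q. (weight t v i y)\<^sup>2"]) (auto intro!: sum_nonneg)
  also have "\<dots> = (if cut v then (\<Sum>i<m. \<Sum>y<Q. (weight t v i y)\<^sup>2) else 0)" using assms by simp
  also have "\<dots> \<le> potential t" unfolding potential_def using assms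
    by (intro member_le_sum[of v "{1..<n}" "\<lambda>v. if cut v then (\<Sum>i<m. \<Sum>y<Q. (weight t v i y)\<^sup>2) else 0"])
      (auto intro!: sum_nonneg)
  also have "\<dots> \<le> real t * real (n ^ 3 * m)" by (rule assms(1))
  also have "\<dots> \<le> real T * real (n ^ 3 * m)" using assms(2) by (intro mult_right_mono) auto
  also have "\<dots> \<le> (real theta)\<^sup>2"
    using theta_square by (simp add: power2_eq_square mult.assoc flip: of_nat_mult of_nat_power)
  finally show ?thesis by (rule power2_le_imp_le) simp
qed

text \<open>The potential bound is a hypothesis because of a joint induction: small weights in round
  \<open>t\<close> make its best response valid, and this in turn keeps the potential small in round
  \<open>t + 1\<close>.\<close>

lemma round_facts:
  assumes "potential t \<le> real t * real (n ^ 3 * m)" "t < T"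
  shows "\<And>v. 0 < v \<Longrightarrow> v < n \<Longrightarrow> G (sol t v mod q) (sol t (2 * v) mod q) (sol t (2 * v + 1) mod q)"
    and "\<And>v i. n \<le> v \<Longrightarrow> v < 2 * n \<Longrightarrow> i < m \<Longrightarrow> a (sol t v mod q) i \<le> 1"
    and "(\<Sum>v=1..<n. if cut v then (\<Sum>i<m. weight t v i (sol t v) * (load (sol t) i v - 1)) else 0) \<le> 0"
proof -
  have *: "weight t v i (best (weight t) big v) \<le> real theta" if "0 < v" "v < n" "cut v" "i < m" for v i
    using assms that coded_bound[OF coded_best] by (intro weight_le_theta) auto
  have big: "real n * real m * real theta < big" "0 \<le> real theta" by (simp_all add: big_def)
  note b = best_response[of "weight t" big "real theta", OF weight_nonneg * big]
  show "\<And>v. 0 < v \<Longrightarrow> v < n \<Longrightarrow> G (sol t v mod q) (sol t (2 * v) mod q) (sol t (2 * v + 1) mod q)"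
    "\<And>v i. n \<le> v \<Longrightarrow> v < 2 * n \<Longrightarrow> i < m \<Longrightarrow> a (sol t v mod q) i \<le> 1"
    "(\<Sum>v=1..<n. if cut v then (\<Sum>i<m. weight t v i (sol t v) * (load (sol t) i v - 1)) else 0) \<le> 0"
    unfolding sol_def using b by blast+
qed

lemma load_le_n:
  assumes "\<And>v. n \<le> v \<Longrightarrow> v < 2 * n \<Longrightarrow> a (L v mod q) i \<le> 1" "0 < v" "v < 2 * n"
  shows "load L i v \<le> n"
proof -
  have "load L i 1 \<le> (\<Sum>v=n..<2 * n. 1)" unfolding load_root using assms(1) by (intro sum_mono) auto
  with load_le_root[OF assms(2,3), of L i] show ?thesis by simp
qed

text \<open>Approachability: truncation at \<open>0\<close> does not increase squares, the cross
  term is the weighted violation of a best response and hence nonpositive, and what remains is at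
  most \<open>n ^ 2\<close> for each vertex and row.\<close>

lemma potential_bound: "t \<le> T \<Longrightarrow> potential t \<le> real t * real (n ^ 3 * m)"
proof (induction t)
  case 0 show ?case by (simp add: potential_def cong: if_cong)
next
  case (Suc t)
  then have IH: "potential t \<le> real t * real (n ^ 3 * m)" and t: "t < T" by simp_all
  note r = round_facts[OF IH t]
  let ?x = "\<lambda>i v. load (sol t) i v - 1"
  have sq: "(?x i v)\<^sup>2 \<le> (real n)\<^sup>2" if "0 < v" "v < n" "i < m" for i v
  proof (rule abs_le_square_iff[THEN iffD1])
    show "\<bar>?x i v\<bar> \<le> \<bar>real n\<bar>"
      using that load_le_n[of "sol t" i v] r(2)[of _ i] load_nonneg[of v "sol t" i] n_pos by (simp add: abs_le_iff)
  qed
  \<comment> \<open>Only the code used by the current solution is updated, so one term of the sum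
    over \<open>y\<close> changes and the increment is free of \<open>Q\<close>.\<close>
  have step: "(\<Sum>y<Q. (weight (Suc t) v i y)\<^sup>2) \<le> (\<Sum>y<Q. (weight t v i y)\<^sup>2) + 2 * (weight t v i (sol t v) * ?x i v) + (real n)\<^sup>2"
    if v: "0 < v" "v < n" and i: "i < m" for v i
  proof -
    have *: "(weight (Suc t) v i y)\<^sup>2 \<le> (weight t v i y)\<^sup>2 +
        (if sol t v = y then 2 * (weight t v i (sol t v) * ?x i v) + (?x i v)\<^sup>2 else 0)" for y
    proof -
      have "(max 0 z)\<^sup>2 \<le> z\<^sup>2" for z :: real by (simp add: max_def)
      from this[of "weight t v i y + (if sol t v = y then ?x i v else 0)"] show ?thesis
        unfolding weight.simps sol_def[symmetric] by (auto simp: power2_sum algebra_simps split: if_splits)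
    qed
    have "sol t v < Q" using v by (intro coded_bound coded_sol) auto
    then have "(\<Sum>y<Q. (weight (Suc t) v i y)\<^sup>2) \<le>
        (\<Sum>y<Q. (weight t v i y)\<^sup>2) + (2 * (weight t v i (sol t v) * ?x i v) + (?x i v)\<^sup>2)"
      by (intro order_trans[OF sum_mono[OF *]]) (simp add: sum.distrib)
    with sq[OF v i] show ?thesis by linarith
  qed
  have "potential (Suc t) \<le> (\<Sum>v=1..<n. (if cut v then (\<Sum>i<m. \<Sum>y<Q. (weight t v i y)\<^sup>2) else 0) +
      2 * (if cut v then (\<Sum>i<m. weight t v i (sol t v) * ?x i v) else 0) + real m * (real n)\<^sup>2)"
    unfolding potential_def
  proof (intro sum_mono)
    fix v assume "v \<in> {1..<n}"
    then have v: "0 < v" "v < n" by auto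
    have "(\<Sum>i<m. \<Sum>y<Q. (weight (Suc t) v i y)\<^sup>2) \<le>
        (\<Sum>i<m. (\<Sum>y<Q. (weight t v i y)\<^sup>2) + 2 * (weight t v i (sol t v) * ?x i v) + (real n)\<^sup>2)"
      using step[OF v] by (intro sum_mono) auto
    then show "(if cut v then (\<Sum>i<m. \<Sum>y<Q. (weight (Suc t) v i y)\<^sup>2) else 0) \<le>
        (if cut v then (\<Sum>i<m. \<Sum>y<Q. (weight t v i y)\<^sup>2) else 0) +
        2 * (if cut v then (\<Sum>i<m. weight t v i (sol t v) * ?x i v) else 0) + real m * (real n)\<^sup>2"
      by (auto simp: sum.distrib sum_distrib_left)
  qed
  also have "\<dots> = potential t + 2 * (\<Sum>v=1..<n. if cut v then (\<Sum>i<m. weight t v i (sol t v) * ?x i v) else 0) +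
      real (n - 1) * (real m * (real n)\<^sup>2)"
    by (simp add: sum.distrib potential_def sum_distrib_left)
  also have "\<dots> \<le> potential t + real n * (real m * (real n)\<^sup>2)"
    using r(3) mult_right_mono[of "real (n - 1)" "real n" "real m * (real n)\<^sup>2"] by simp
  also have "real n * (real m * (real n)\<^sup>2) = real (n ^ 3 * m)" by (simp add: power2_eq_square power3_eq_cube)
  finally show ?case using IH by (simp add: algebra_simps)
qed

lemmas sol_G = round_facts(1)[OF potential_bound[OF less_imp_le]]
  and sol_leaf = round_facts(2)[OF potential_bound[OF less_imp_le]]

text \<open>Truncation only raises the weights, so they dominate the plain sums of
  violations.\<close>

lemma weight_lower: "(\<Sum>t' | t' < t \<and> sol t' v = y. load (sol t') i v - 1) \<le> weight t v i y"
proof (induction t)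
  case (Suc t)
  have "{t'. t' < Suc t \<and> sol t' v = y} = (if sol t v = y then insert t else id) {t'. t' < t \<and> sol t' v = y}"
    by (auto simp: less_Suc_eq)
  then have "(\<Sum>t' | t' < Suc t \<and> sol t' v = y. load (sol t') i v - 1) =
      (\<Sum>t' | t' < t \<and> sol t' v = y. load (sol t') i v - 1) + (if sol t v = y then load (sol t) i v - 1 else 0)"
    by simp
  also have "\<dots> \<le> weight (Suc t) v i y" using Suc.IH by (auto simp: sol_def le_max_iff_disj)
  finally show ?case .
qed simp

section \<open>Classes of solutions with a common code\<close>

definition cls :: "nat \<Rightarrow> nat \<Rightarrow> nat set" where "cls v y = {t. t < T \<and> sol t v = y}"

lemma finite_cls [simp]: "finite (cls v y)" by (simp add: cls_def)

text \<open>Division by the class size turns this into the conditional constraint with error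
  \<open>theta / card (cls v y)\<close>; a class of at least \<open>theta\<close> members thus has
  mean load at most \<open>2\<close>.\<close>

lemma load_cls:
  assumes "0 < v" "v < n" "cut v" "i < m" "y < Q"
  shows "(\<Sum>t\<in>cls v y. load (sol t) i v) \<le> card (cls v y) + theta"
proof -
  have "(\<Sum>t\<in>cls v y. load (sol t) i v - 1) \<le> weight T v i y" unfolding cls_def by (rule weight_lower)
  also have "\<dots> \<le> theta" using assms by (intro weight_le_theta potential_bound) auto
  finally show ?thesis by (simp add: sum_subtractf)
qed

end

section \<open>Rounding by conditional expectations\<close>

lemma sum_power_two_diff: "(\<Sum>r<h. (2::real) ^ (h - r)) \<le> 2 * 2 ^ h"
proof -
  have "(\<Sum>r<h. (2::real) ^ (h - r)) + 2 = 2 * 2 ^ h"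
    by (induction h) (simp_all add: sum.lessThan_Suc_shift del: sum.lessThan_Suc)
  then show ?thesis by simp
qed

lemma average_le:
  fixes f :: "'a \<Rightarrow> real"
  assumes "finite A" "A \<noteq> {}" "\<And>x. x \<in> A \<Longrightarrow> f x \<le> b"
  shows "sum f A / card A \<le> b"
  using sum_bounded_above[of A f b] assms by (simp add: divide_le_eq card_gt_0_iff mult.commute)

lemma average_ge:
  fixes f :: "'a \<Rightarrow> real"
  assumes "finite A" "A \<noteq> {}" "\<And>x. x \<in> A \<Longrightarrow> b \<le> f x"
  shows "b \<le> sum f A / card A"
  using sum_bounded_below[of A b f] assms by (simp add: le_divide_eq card_gt_0_iff mult.commute)

context feasible_tree
begin

definition blocks :: nat where "blocks = Suc (cuts h H)"

text \<open>The constant \<open>16\<close> makes \<open>4 * s * drift d\<close> at most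
  \<open>1\<close>, which confines \<open>factor\<close> to the interval from \<open>1\<close> to
  \<open>2\<close>.\<close>

definition s :: real where "s = 1 / (16 * 2 ^ h * real blocks)"

definition rare :: "nat \<Rightarrow> nat \<Rightarrow> bool" where "rare v y \<longleftrightarrow> card (cls v y) < theta"

text \<open>
  Walking down the tree and extending a code \<open>y\<close> at \<open>v\<close> by the children of a uniformly random
  solution in \<open>cls v y\<close>, and stopping at rare codes, gives a Markov process; \<open>X\<close> is the
  expected load of row \<open>i\<close> that it collects, \<open>R\<close> the expected number of stops and
  \<open>F\<close> the expectation of the product of the factors \<open>1 + s * a\<close> at the leaves.
\<close>

definition F :: "nat \<Rightarrow> nat \<Rightarrow> nat \<Rightarrow> real" where
  "F i = tree_rec n (\<lambda>v y. 1 + s * a (y mod q) i)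
     (\<lambda>v f g y. if rare v y then 1 else (\<Sum>t\<in>cls v y. f (sol t (2 * v)) * g (sol t (2 * v + 1))) / card (cls v y))"

definition X :: "nat \<Rightarrow> nat \<Rightarrow> nat \<Rightarrow> real" where
  "X i = tree_rec n (\<lambda>v y. a (y mod q) i)
     (\<lambda>v f g y. if rare v y then 0 else (\<Sum>t\<in>cls v y. f (sol t (2 * v)) + g (sol t (2 * v + 1))) / card (cls v y))"

definition R :: "nat \<Rightarrow> nat \<Rightarrow> real" where
  "R = tree_rec n (\<lambda>v y. 0)
     (\<lambda>v f g y. if rare v y then 1 else (\<Sum>t\<in>cls v y. f (sol t (2 * v)) + g (sol t (2 * v + 1))) / card (cls v y))"

lemma F_leaf: "n \<le> v \<Longrightarrow> F i v y = 1 + s * a (y mod q) i"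
  unfolding F_def by (subst tree_rec_leaf) simp_all
lemma X_leaf: "n \<le> v \<Longrightarrow> X i v y = a (y mod q) i"
  unfolding X_def by (subst tree_rec_leaf) simp_all
lemma R_leaf: "n \<le> v \<Longrightarrow> R v y = 0"
  unfolding R_def by (subst tree_rec_leaf) simp_all

lemma F_node: "0 < v \<Longrightarrow> v < n \<Longrightarrow> F i v y = (if rare v y then 1
    else (\<Sum>t\<in>cls v y. F i (2 * v) (sol t (2 * v)) * F i (2 * v + 1) (sol t (2 * v + 1))) / card (cls v y))"
  by (subst F_def, subst tree_rec_node) (simp_all add: F_def)
lemma X_node: "0 < v \<Longrightarrow> v < n \<Longrightarrow> X i v y = (if rare v y then 0
    else (\<Sum>t\<in>cls v y. X i (2 * v) (sol t (2 * v)) + X i (2 * v + 1) (sol t (2 * v + 1))) / card (cls v y))"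
  by (subst X_def, subst tree_rec_node) (simp_all add: X_def)
lemma R_node: "0 < v \<Longrightarrow> v < n \<Longrightarrow> R v y = (if rare v y then 1
    else (\<Sum>t\<in>cls v y. R (2 * v) (sol t (2 * v)) + R (2 * v + 1) (sol t (2 * v + 1))) / card (cls v y))"
  by (subst R_def, subst tree_rec_node) (simp_all add: R_def)

lemma s_pos: "0 < s" by (simp add: s_def blocks_def)

lemma s_le: "s \<le> 1 / 16"
proof -
  have "1 * 1 \<le> 2 ^ h * real blocks" by (intro mult_mono) (auto simp: blocks_def)
  then show ?thesis by (simp add: s_def field_simps blocks_def)
qed

lemma not_rare_nonempty: "\<not> rare v y \<Longrightarrow> cls v y \<noteq> {}"
  using theta_pos by (auto simp: rare_def)

lemma F_ge_1: "0 < v \<Longrightarrow> v < 2 * n \<Longrightarrow> 1 \<le> F i v y"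
proof (induction v arbitrary: y rule: tree_induct[where n = n])
  case (leaf v)
  then show ?case using s_pos a_nonneg by (simp add: F_leaf)
next
  case (node v)
  have "1 \<le> x * y" if "1 \<le> x" "1 \<le> y" for x y :: real using mult_mono[OF that] that by simp
  then show ?case using node.IH node.hyps by (auto simp: F_node simp del: One_nat_def Suc_eq_plus1 intro!: average_ge dest!: not_rare_nonempty)
qed

lemma X_nonneg: "0 < v \<Longrightarrow> v < 2 * n \<Longrightarrow> 0 \<le> X i v y"
proof (induction v arbitrary: y rule: tree_induct[where n = n])
  case (leaf v)
  then show ?case using a_nonneg by (simp add: X_leaf)
next
  case (node v)
  then show ?case by (auto simp: X_node intro!: divide_nonneg_nonneg sum_nonneg add_nonneg_nonneg)
qed

lemma R_nonneg: "0 < v \<Longrightarrow> v < 2 * n \<Longrightarrow> 0 \<le> R v y"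
proof (induction v arbitrary: y rule: tree_induct[where n = n])
  case (leaf v)
  then show ?case by (simp add: R_leaf)
next
  case (node v)
  then show ?case by (auto simp: R_node intro!: divide_nonneg_nonneg sum_nonneg add_nonneg_nonneg)
qed

lemma cls_memD: "t \<in> cls v y \<Longrightarrow> t < T \<and> sol t v = y"
  by (simp add: cls_def)

text \<open>The tower rule for conditional expectations: \<open>S\<close> is a union of classes at
  \<open>v\<close>, and on each of them averaging preserves the sum.\<close>

lemma class_average:
  fixes g :: "nat \<Rightarrow> real"
  assumes S: "S \<subseteq> {..<T}" and sat: "\<And>t t'. t \<in> S \<Longrightarrow> t' < T \<Longrightarrow> sol t' v = sol t v \<Longrightarrow> t' \<in> S"
  shows "(\<Sum>t\<in>S. sum g (cls v (sol t v)) / card (cls v (sol t v))) = sum g S"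
proof -
  have fin: "finite S" using S finite_subset by blast
  let ?Y = "(\<lambda>t. sol t v) ` S"
  have c: "{t \<in> S. sol t v = y} = cls v y" if "y \<in> ?Y" for y
    using that S sat by (auto simp: cls_def)
  have ne: "card (cls v y) > 0" if "y \<in> ?Y" for y
    using that S by (auto simp: card_gt_0_iff cls_def)
  have "(\<Sum>t\<in>S. sum g (cls v (sol t v)) / card (cls v (sol t v))) =
      (\<Sum>y\<in>?Y. \<Sum>t | t \<in> S \<and> sol t v = y. sum g (cls v (sol t v)) / card (cls v (sol t v)))"
    using fin by (intro sum.group[symmetric]) auto
  also have "\<dots> = (\<Sum>y\<in>?Y. sum g (cls v y))"
  proof (rule sum.cong[OF refl])
    fix y assume y: "y \<in> ?Y"
    have "(\<Sum>t | t \<in> S \<and> sol t v = y. sum g (cls v (sol t v)) / card (cls v (sol t v))) =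
        (\<Sum>t\<in>cls v y. sum g (cls v y) / card (cls v y))"
      unfolding c[OF y, symmetric] by (intro sum.cong) (auto simp: c[OF y] dest: cls_memD)
    then show "(\<Sum>t | t \<in> S \<and> sol t v = y. sum g (cls v (sol t v)) / card (cls v (sol t v))) = sum g (cls v y)"
      using ne[OF y] by simp
  qed
  also have "\<dots> = (\<Sum>y\<in>?Y. \<Sum>t | t \<in> S \<and> sol t v = y. g t)"
    by (intro sum.cong refl arg_cong2[where f = sum] c[symmetric])
  also have "\<dots> = sum g S" using fin by (intro sum.group) auto
  finally show ?thesis .
qed

text \<open>
  Codes determine the codes of all cut ancestors, so a class at a cut vertex is a union of classes
  at each of its descendants. This makes the process preserve the total load of the class.
\<close>

definition saturated :: "nat set \<Rightarrow> nat \<Rightarrow> bool" where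
  "saturated S v \<longleftrightarrow> S \<subseteq> {..<T} \<and> (\<forall>t\<in>S. \<forall>t'<T. sol t v div q = sol t' v div q \<longrightarrow> t' \<in> S)"

lemma sol_children:
  assumes "0 < v" "v < n"
  shows "sol t (2 * v) div q = hist v (sol t v)" "sol t (2 * v + 1) div q = hist v (sol t v)"
  using coded_sol[of t] assms by (auto simp: coded_def)

text \<open>The history of a child is that of \<open>v\<close>, possibly extended by the label of
  \<open>v\<close>; agreement at the child is the stronger condition.\<close>

lemma saturated_children:
  assumes "saturated S v" "0 < v" "v < n" shows "saturated S (2 * v)" "saturated S (2 * v + 1)"
  using assms(1) unfolding saturated_def sol_children[OF assms(2,3)] by (auto simp: hist_def split: if_splits)

text \<open>At a cut the children's histories contain the whole code of the vertex, so agreeing on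
  them means lying in one class.\<close>

lemma saturated_cls:
  assumes "cut v" "0 < v" "v < n" shows "saturated (cls v y) (2 * v)" "saturated (cls v y) (2 * v + 1)"
  using assms(1) unfolding saturated_def sol_children[OF assms(2,3)] by (auto simp: hist_def cls_def)

text \<open>On a saturated set the tower rule moves load between solutions without changing the
  total; stopping at rare codes can only lose load, hence an inequality.\<close>

lemma X_flow:
  "0 < v \<Longrightarrow> v < 2 * n \<Longrightarrow> saturated S v \<Longrightarrow> (\<Sum>t\<in>S. X i v (sol t v)) \<le> (\<Sum>t\<in>S. load (sol t) i v)"
proof (induction v rule: tree_induct[where n = n])
  case (leaf v)
  then show ?case by (simp add: X_leaf load_leaf)
next
  case (node v)
  let ?g = "\<lambda>t. X i (2 * v) (sol t (2 * v)) + X i (2 * v + 1) (sol t (2 * v + 1))"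
  have "0 \<le> ?g t" for t using node.hyps by (intro add_nonneg_nonneg X_nonneg) auto
  then have "(\<Sum>t\<in>S. X i v (sol t v)) \<le> (\<Sum>t\<in>S. sum ?g (cls v (sol t v)) / card (cls v (sol t v)))"
    using node.hyps by (intro sum_mono) (auto simp: X_node simp del: One_nat_def Suc_eq_plus1 intro!: divide_nonneg_nonneg sum_nonneg)
  also have "\<dots> = sum ?g S"
    using node.prems unfolding saturated_def by (intro class_average) (blast, metis)
  also have "\<dots> \<le> (\<Sum>t\<in>S. load (sol t) i (2 * v) + load (sol t) i (2 * v + 1))"
    using node.IH saturated_children[OF node.prems node.hyps] by (simp add: sum.distrib)
  also have "\<dots> = (\<Sum>t\<in>S. load (sol t) i v)" using node.hyps by (simp add: load_node)
  finally show ?case .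
qed

text \<open>The strengthened constraints take effect here: the error \<open>theta\<close> is at most
  the size of a class that is not rare, so the mean load is bounded by a constant at every cut,
  whatever was chosen above it.\<close>

lemma X_cut:
  assumes v: "0 < v" "v < n" and "cut v" "i < m" "y < Q" shows "X i v y \<le> 2"
proof (cases "rare v y")
  case True
  then show ?thesis using v by (simp add: X_node)
next
  case False
  let ?C = "cls v y"
  have "card ?C > 0" using not_rare_nonempty[OF False] by (simp add: card_gt_0_iff)
  have "(\<Sum>t\<in>?C. X i (2 * v) (sol t (2 * v)) + X i (2 * v + 1) (sol t (2 * v + 1))) \<le>
      (\<Sum>t\<in>?C. load (sol t) i (2 * v) + load (sol t) i (2 * v + 1))"
    using X_flow[OF _ _ saturated_cls(1)[OF assms(3) v], of i y] X_flow[OF _ _ saturated_cls(2)[OF assms(3) v], of i y] v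
    by (simp add: sum.distrib add_mono)
  also have "\<dots> = (\<Sum>t\<in>?C. load (sol t) i v)" using v by (simp add: load_node)
  also have "\<dots> \<le> card ?C + theta" by (rule load_cls[OF assms])
  also have "\<dots> \<le> 2 * card ?C" using False by (simp add: rare_def)
  finally show ?thesis using v False \<open>card ?C > 0\<close> by (simp add: X_node divide_le_eq)
qed

text \<open>Bounds \<open>X\<close> at depth \<open>d\<close>: \<open>2\<close> at a cut, and
  doubled for every level above the next cut, since an inner vertex adds the loads of two
  children.\<close>

definition width :: "nat \<Rightarrow> real" where "width d = (if d mod h = 0 then 2 else 2 * 2 ^ (h - d mod h))"

lemma width_step: "d mod h \<noteq> 0 \<Longrightarrow> 2 * width (Suc d) \<le> width d"
proof -
  assume d: "d mod h \<noteq> 0"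
  have lt: "d mod h < h" using h by simp
  show ?thesis
  proof (cases "Suc (d mod h) = h")
    case True
    then have "h - d mod h = 1" by simp
    with True d show ?thesis by (simp add: width_def mod_Suc)
  next
    case False
    with lt have "h - d mod h = Suc (h - Suc (d mod h))" by simp
    with False d show ?thesis by (simp add: width_def mod_Suc)
  qed
qed

lemma width_ge_1: "1 \<le> width d"
  proof (cases "d mod h = 0")
  case False
  have "(1::real) \<le> 2 ^ (h - d mod h)" by (rule one_le_power) simp
  with False show ?thesis by (simp only: width_def if_False)
qed (simp add: width_def)

lemma X_le_width:
  assumes i: "i < m"
  shows "0 < v \<Longrightarrow> v < 2 * n \<Longrightarrow> t < T \<Longrightarrow> X i v (sol t v) \<le> width (depth v)"
proof (induction v arbitrary: t rule: tree_induct[where n = n])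
  case (leaf v)
  then show ?case using sol_leaf[of t v i] i width_ge_1[of "depth v"] by (simp add: X_leaf)
next
  case (node v)
  show ?case
  proof (cases "cut v")
    case True
    have "sol t v < Q" using node.hyps by (intro coded_bound coded_sol) auto
    then show ?thesis using X_cut[OF node.hyps True i] True by (simp add: width_def cut_def)
  next
    case False
    have "X i (2 * v) (sol t (2 * v)) + X i (2 * v + 1) (sol t (2 * v + 1)) \<le> width (depth v)" if "t < T" for t
      using node.IH[OF that] width_step[of "depth v"] False by (simp add: depth_children[OF node.hyps(1)] cut_def)
    then have "\<not> rare v (sol t v) \<Longrightarrow>
        (\<Sum>t\<in>cls v (sol t v). X i (2 * v) (sol t (2 * v)) + X i (2 * v + 1) (sol t (2 * v + 1))) / card (cls v (sol t v))
          \<le> width (depth v)"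
      by (intro average_le not_rare_nonempty finite_cls) (auto dest: cls_memD)
    then show ?thesis using node.hyps width_ge_1[of "depth v"] by (simp add: X_node)
  qed
qed

text \<open>Bounds the widths of all deeper levels together. Cut levels are overestimated so that
  every block of \<open>h\<close> levels contributes the same geometric sum.\<close>

definition drift :: "nat \<Rightarrow> real" where "drift d = (\<Sum>d'\<in>{d<..H}. 2 * 2 ^ (h - d' mod h))"

lemma drift_le: "drift d \<le> 4 * 2 ^ h * blocks"
proof -
  let ?f = "\<lambda>d. 2 * 2 ^ (h - d mod h) :: real"
  have "H < blocks * h" using cuts_bounds(1)[OF h, of H] h by (simp add: blocks_def mult.commute)
  then have "drift d \<le> (\<Sum>d<blocks * h. ?f d)" unfolding drift_def by (intro sum_mono2) auto
  also have "\<dots> = (\<Sum>k<blocks. \<Sum>d\<in>{k * h..<k * h + h}. ?f d)" by (rule sum.nat_group[symmetric])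
  also have "\<dots> = (\<Sum>k<blocks. \<Sum>r<h. 2 * 2 ^ (h - r))"
  proof (rule sum.cong[OF refl])
    fix k
    have "(\<Sum>d\<in>{0 + k * h..<h + k * h}. ?f d) = (\<Sum>r\<in>{0..<h}. ?f (r + k * h))" by (rule sum.shift_bounds_nat_ivl)
    then show "(\<Sum>d\<in>{k * h..<k * h + h}. ?f d) = (\<Sum>r<h. 2 * 2 ^ (h - r))"
      by (simp add: add.commute lessThan_atLeast0)
  qed
  also have "\<dots> \<le> (\<Sum>k<blocks. 2 * (2 * 2 ^ h))"
    using sum_power_two_diff[of h] by (intro sum_mono) (simp add: sum_distrib_left[symmetric])
  finally show ?thesis by (simp add: mult.commute)
qed

text \<open>The slack in the linear bound on \<open>F\<close>; it is spent level by level on the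
  cross terms of the products over two children.\<close>

definition factor :: "nat \<Rightarrow> real" where "factor d = 1 + 4 * s * drift d"

lemma factor_bounds: "1 \<le> factor d" "factor d \<le> 2"
proof -
  have "0 \<le> drift d" unfolding drift_def by (intro sum_nonneg) auto
  then show "1 \<le> factor d" using s_pos by (simp add: factor_def)
  have "4 * s * drift d \<le> 4 * s * (4 * 2 ^ h * blocks)" using s_pos drift_le by (intro mult_left_mono) auto
  also have "\<dots> = 1"
  proof -
    have "real blocks \<noteq> 0" by (simp add: blocks_def)
    then show ?thesis by (simp add: s_def field_simps)
  qed
  finally show "factor d \<le> 2" by (simp add: factor_def)
qed

lemma factor_step: "d < H \<Longrightarrow> factor (Suc d) + 4 * s * width (Suc d) \<le> factor d"
proof -
  assume "d < H"
  then have "{d<..H} = insert (Suc d) {Suc d<..H}" by auto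
  then have "drift d = 2 * 2 ^ (h - Suc d mod h) + drift (Suc d)" by (simp add: drift_def)
  moreover have "width (Suc d) \<le> 2 * 2 ^ (h - Suc d mod h)" by (simp add: width_def)
  ultimately have "width (Suc d) + drift (Suc d) \<le> drift d" by simp
  then have "4 * s * (width (Suc d) + drift (Suc d)) \<le> 4 * s * drift d" using s_pos by (intro mult_left_mono) auto
  then show ?thesis by (simp add: factor_def algebra_simps)
qed

text \<open>The cross term is at most \<open>s * (4 * s * w) * (x + y)\<close>, since
  \<open>x * y\<close> is at most \<open>w * (x + y)\<close> and \<open>c' * c'\<close> at most
  \<open>4\<close>; the increase from \<open>c'\<close> to \<open>c\<close> pays for it.\<close>

lemma product_step:
  fixes c c' x y w :: real
  assumes "0 \<le> x" "0 \<le> y" "x \<le> w" "y \<le> w" "0 \<le> c'" "c' \<le> 2" "c' + 4 * s * w \<le> c"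
  shows "(1 + s * c' * x) * (1 + s * c' * y) \<le> 1 + s * c * (x + y)"
proof -
  have "x * y \<le> w * (x + y)" using assms mult_right_mono[of x w y] by (simp add: distrib_left add_increasing)
  moreover have "c' * c' \<le> 2 * 2" using assms(5,6) by (intro mult_mono) auto
  ultimately have "(c' * c') * (x * y) \<le> 4 * (w * (x + y))" using assms(1,2,3) by (intro mult_mono) auto
  then have "(s * s) * ((c' * c') * (x * y)) \<le> (s * s) * (4 * (w * (x + y)))" by (rule mult_left_mono) simp
  then have "(1 + s * c' * x) * (1 + s * c' * y) \<le> 1 + s * (c' + 4 * s * w) * (x + y)" by (simp add: algebra_simps)
  also have "\<dots> \<le> 1 + s * c * (x + y)" using assms s_pos by (intro add_mono mult_right_mono mult_left_mono) auto
  finally show ?thesis .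
qed

text \<open>A bound linear in \<open>X\<close> survives the class averages. Only the product over
  the children is nonlinear, and \<open>product_step\<close> makes it linear again at the price of a
  larger factor.\<close>

lemma F_bound:
  assumes i: "i < m"
  shows "0 < v \<Longrightarrow> v < 2 * n \<Longrightarrow> t < T \<Longrightarrow> F i v (sol t v) \<le> 1 + s * factor (depth v) * X i v (sol t v)"
proof (induction v arbitrary: t rule: tree_induct[where n = n])
  case (leaf v)
  have "s * 1 * a (sol t v mod q) i \<le> s * factor (depth v) * a (sol t v mod q) i"
    using s_pos a_nonneg factor_bounds by (intro mult_right_mono mult_left_mono) auto
  then show ?case using leaf by (simp add: F_leaf X_leaf)
next
  case (node v)
  let ?y = "sol t v" and ?c = "factor (depth v)"
  let ?x = "\<lambda>t. X i (2 * v) (sol t (2 * v)) + X i (2 * v + 1) (sol t (2 * v + 1))"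
  have dH: "depth v < H" using depth_le[of "2 * v"] node.hyps by (simp add: depth_children)
  show ?case
  proof (cases "rare v ?y")
    case True
    then show ?thesis using node.hyps by (simp add: F_node X_node)
  next
    case False
    have "F i (2 * v) (sol t (2 * v)) * F i (2 * v + 1) (sol t (2 * v + 1)) \<le> 1 + s * ?c * ?x t" if "t < T" for t
    proof -
      let ?c' = "factor (Suc (depth v))"
      have lt: "0 < 2 * v" "2 * v < 2 * n" "0 < 2 * v + 1" "2 * v + 1 < 2 * n" using node.hyps by auto
      have "F i (2 * v) (sol t (2 * v)) * F i (2 * v + 1) (sol t (2 * v + 1)) \<le>
          (1 + s * ?c' * X i (2 * v) (sol t (2 * v))) * (1 + s * ?c' * X i (2 * v + 1) (sol t (2 * v + 1)))"
        using node.IH[OF that] F_ge_1[OF lt(1,2), of i "sol t (2 * v)"] F_ge_1[OF lt(3,4), of i "sol t (2 * v + 1)"]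
        unfolding depth_children[OF node.hyps(1)] by (intro mult_mono) linarith+
      also have "\<dots> \<le> 1 + s * ?c * ?x t"
        using X_nonneg[OF lt(1,2)] X_nonneg[OF lt(3,4)] X_le_width[OF i lt(1,2) that] X_le_width[OF i lt(3,4) that]
          factor_bounds[of "Suc (depth v)"] factor_step[OF dH]
        unfolding depth_children[OF node.hyps(1)] by (intro product_step[where w = "width (Suc (depth v))"]) auto
      finally show ?thesis .
    qed
    then have "(\<Sum>t\<in>cls v ?y. F i (2 * v) (sol t (2 * v)) * F i (2 * v + 1) (sol t (2 * v + 1))) \<le>
        (\<Sum>t\<in>cls v ?y. 1 + s * ?c * ?x t)" by (intro sum_mono) (auto dest: cls_memD)
    also have "\<dots> = card (cls v ?y) + s * ?c * (\<Sum>t\<in>cls v ?y. ?x t)"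
      by (simp add: sum.distrib sum_distrib_left distrib_left)
    finally have "(\<Sum>t\<in>cls v ?y. F i (2 * v) (sol t (2 * v)) * F i (2 * v + 1) (sol t (2 * v + 1))) / card (cls v ?y) \<le>
        (card (cls v ?y) + s * ?c * (\<Sum>t\<in>cls v ?y. ?x t)) / card (cls v ?y)" by (rule divide_right_mono) simp
    also have "\<dots> = 1 + s * ?c * ((\<Sum>t\<in>cls v ?y. ?x t) / card (cls v ?y))"
      using not_rare_nonempty[OF False] by (simp add: add_divide_distrib card_gt_0_iff)
    finally show ?thesis using False node.hyps by (simp add: F_node X_node)
  qed
qed

section \<open>The expected number of rare codes\<close>

text \<open>At one vertex there are at most \<open>Q\<close> rare codes with fewer than
  \<open>theta\<close> solutions each. The set of all solutions is a union of classes at every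
  vertex, so by the tower rule these contributions add up over the inner vertices below
  \<open>v\<close>, which the \<open>tree_rec\<close> term counts.\<close>

lemma R_flow:
  "0 < v \<Longrightarrow> v < 2 * n \<Longrightarrow>
    (\<Sum>t<T. R v (sol t v)) \<le> theta * Q * tree_rec n (\<lambda>_. 0 :: real) (\<lambda>v x y. x + y + 1) v"
proof (induction v rule: tree_induct[where n = n])
  case (leaf v)
  then show ?case by (simp add: R_leaf tree_rec_leaf)
next
  case (node v)
  let ?g = "\<lambda>t. R (2 * v) (sol t (2 * v)) + R (2 * v + 1) (sol t (2 * v + 1))"
  let ?A = "{t. t < T \<and> rare v (sol t v)}"
  have nn: "0 \<le> ?g t" for t using node.hyps by (intro add_nonneg_nonneg R_nonneg) auto
  have "card ?A \<le> card (\<Union>y\<in>{y. y < Q \<and> rare v y}. cls v y)"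
    using coded_bound[OF coded_sol] node.hyps by (intro card_mono) (auto simp: cls_def)
  also have "\<dots> \<le> (\<Sum>y | y < Q \<and> rare v y. card (cls v y))" by (rule card_UN_le) simp
  also have "\<dots> \<le> (\<Sum>y | y < Q \<and> rare v y. theta)" by (intro sum_mono) (simp add: rare_def)
  also have "\<dots> \<le> Q * theta" using card_mono[of "{..<Q}" "{y. y < Q \<and> rare v y}"] by auto
  finally have A: "card ?A \<le> Q * theta" .
  have "(\<Sum>t<T. R v (sol t v)) \<le> (\<Sum>t<T. (if rare v (sol t v) then 1 else 0) + sum ?g (cls v (sol t v)) / card (cls v (sol t v)))"
    using node.hyps nn by (intro sum_mono) (auto simp: R_node simp del: One_nat_def Suc_eq_plus1 intro!: divide_nonneg_nonneg sum_nonneg)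
  also have "\<dots> = (\<Sum>t<T. if rare v (sol t v) then 1 else 0) + (\<Sum>t<T. sum ?g (cls v (sol t v)) / card (cls v (sol t v)))"
    by (rule sum.distrib)
  also have "(\<Sum>t<T. sum ?g (cls v (sol t v)) / card (cls v (sol t v))) = sum ?g {..<T}"
    by (rule class_average) auto
  also have "(\<Sum>t<T. if rare v (sol t v) then 1 else 0 :: real) = card ?A"
    by (subst sum.inter_filter[symmetric]) simp_all
  also have "real (card ?A) \<le> real (Q * theta)" using A by (simp only: of_nat_le_iff)
  also have "sum ?g {..<T} \<le> theta * Q * tree_rec n (\<lambda>_. 0 :: real) (\<lambda>v x y. x + y + 1) (2 * v) +
      theta * Q * tree_rec n (\<lambda>_. 0 :: real) (\<lambda>v x y. x + y + 1) (2 * v + 1)"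
    using node.IH by (simp add: sum.distrib)
  finally show ?case using node.hyps
    by (subst tree_rec_node) (simp_all add: algebra_simps del: One_nat_def Suc_eq_plus1)
qed

lemma sol_root: "sol t 1 = root" using coded_sol[of t] by (simp add: coded_def)

text \<open>All solutions have the code \<open>root\<close> at the root, so the sum in
  \<open>R_flow\<close> becomes \<open>T * R 1 root\<close>, and \<open>T\<close> was chosen for
  this quotient.\<close>

lemma R_root: "B * R 1 root \<le> 1"
proof -
  have "tree_rec n (\<lambda>_. 0 :: real) (\<lambda>v x y. x + y + 1) 1 = real (n - 1)" by (subst tree_rec_sum) simp_all
  then have "T * R 1 root \<le> theta * Q * real (n - 1)" using R_flow[of 1] n_pos sol_root
    by (simp add: of_nat_diff Suc_leI)
  also have "\<dots> \<le> theta * Q * real (2 * n)" by (intro mult_left_mono) auto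
  finally have "(theta * Q * real (2 * n)) * (B * R 1 root) \<le> (theta * Q * real (2 * n)) * 1"
    by (simp add: T_def mult_ac)
  moreover have "0 < theta * Q * real (2 * n)" using theta_pos Q_pos n_pos by simp
  ultimately show ?thesis by (rule mult_left_le_imp_le)
qed

lemma F_root: "i < m \<Longrightarrow> F i 1 root \<le> 2"
proof -
  assume i: "i < m"
  have X2: "0 \<le> X i 1 root" "X i 1 root \<le> 2"
    using X_le_width[OF i, of 1 0] X_nonneg[of 1 i root] theta_pos n_pos sol_root[of 0] by (auto simp: width_def)
  have "s * factor 0 * X i 1 root \<le> (1 / 16 * 2) * 2"
    using X2 factor_bounds[of 0] s_le s_pos by (intro mult_mono) auto
  then show ?thesis using F_bound[OF i, of 1 0] theta_pos n_pos sol_root[of 0] by simp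
qed

section \<open>Greedy choices\<close>

text \<open>A pick belongs to a parent: it is the solution from which both children take their
  codes.\<close>

definition label_of :: "(nat \<Rightarrow> nat) \<Rightarrow> nat \<Rightarrow> nat" where
  "label_of \<tau> w = (if w \<le> 1 then root else sol (\<tau> (w div 2)) w)"

text \<open>Solutions outside the class of the current code get a value that no class average attains.\<close>

definition objective :: "(nat \<Rightarrow> nat) \<Rightarrow> nat \<Rightarrow> nat \<Rightarrow> real" where
  "objective \<tau> v t =
     (if sol t v = label_of \<tau> v
      then (\<Sum>i<m. (\<Prod>w\<in>{v<..<2 * v}. F i w (label_of \<tau> w)) *
             (F i (2 * v) (sol t (2 * v)) * F i (2 * v + 1) (sol t (2 * v + 1)))) +
           B * (R (2 * v) (sol t (2 * v)) + R (2 * v + 1) (sol t (2 * v + 1)))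
      else B)"

text \<open>The objective at \<open>v\<close> depends on earlier picks, so the recursion carries all
  of them as a function; \<open>pick_eq\<close> is the resulting fixed-point equation.\<close>

primrec picks :: "nat \<Rightarrow> nat \<Rightarrow> nat" where
  "picks 0 = (\<lambda>_. 0)"
| "picks (Suc v) = (picks v)(v := argmin (objective (picks v) v) T)"

definition pick :: "nat \<Rightarrow> nat" where "pick v = picks (Suc v) v"

lemma picks_eq: "u < v \<Longrightarrow> picks v u = pick u"
  by (induction v) (auto simp: pick_def less_Suc_eq)

lemma objective_cong:
  assumes "\<And>u. u < v \<Longrightarrow> \<tau> u = \<tau>' u" shows "objective \<tau> v = objective \<tau>' v"
proof -
  have *: "label_of \<tau> w = label_of \<tau>' w" if "w < 2 * v \<or> w = v" for w
  proof (cases "w \<le> 1")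
    case False
    then have "w div 2 < v" using that by auto
    then show ?thesis using assms by (simp add: label_of_def)
  qed (simp add: label_of_def)
  have "(\<Prod>w\<in>{v<..<2 * v}. F i w (label_of \<tau> w)) = (\<Prod>w\<in>{v<..<2 * v}. F i w (label_of \<tau>' w))" for i
    using * by (intro prod.cong) auto
  then show ?thesis using *[of v] by (simp add: objective_def fun_eq_iff)
qed

lemma pick_eq: "pick v = argmin (objective pick v) T"
proof -
  have "objective (picks v) v = objective pick v" by (intro objective_cong picks_eq)
  then show ?thesis by (simp add: pick_def)
qed

definition out :: "nat \<Rightarrow> nat" where "out = label_of pick"

lemma out_children:
  assumes "0 < v" shows "out (2 * v) = sol (pick v) (2 * v)" "out (2 * v + 1) = sol (pick v) (2 * v + 1)"
  using assms by (simp_all add: out_def label_of_def)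

text \<open>The estimator on the frontier. Given the codes there, the subtrees evolve independently,
  so the expected product for a row factors into values of \<open>F\<close>.\<close>

definition Psi :: "nat \<Rightarrow> real" where
  "Psi v = (\<Sum>i<m. \<Prod>w=v..<2 * v. F i w (out w)) + B * (\<Sum>w=v..<2 * v. R w (out w))"

text \<open>Below \<open>B\<close> the code at \<open>v\<close> cannot be rare, since it alone would
  cost \<open>B\<close>. The class mean of the objective is the current estimator minus the part
  \<open>B * ?S\<close> that the choice leaves unchanged. So the minimum is below \<open>B\<close>,
  the value given to solutions outside the class, and the minimiser lies in the class.\<close>

lemma greedy_step:
  assumes v: "0 < v" "v < n" and Psi: "Psi v < B"
  shows "Psi (Suc v) \<le> Psi v" "pick v < T" "sol (pick v) v = out v"
proof -
  let ?P = "\<lambda>i. \<Prod>w\<in>{v<..<2 * v}. F i w (out w)" and ?S = "\<Sum>w\<in>{v<..<2 * v}. R w (out w)"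
  let ?C = "cls v (out v)"
  let ?f = "\<lambda>i t. F i (2 * v) (sol t (2 * v)) * F i (2 * v + 1) (sol t (2 * v + 1))"
  let ?r = "\<lambda>t. R (2 * v) (sol t (2 * v)) + R (2 * v + 1) (sol t (2 * v + 1))"
  have P0: "0 \<le> ?P i" for i
    using v F_ge_1 by (intro prod_nonneg) (auto intro: order_trans[OF zero_le_one])
  have S0: "0 \<le> ?S" using v R_nonneg by (intro sum_nonneg) auto
  have Psi_v: "Psi v = (\<Sum>i<m. F i v (out v) * ?P i) + B * (R v (out v) + ?S)"
    by (simp only: Psi_def frontier_step(1)[OF v(1)] frontier_step_prod(1)[OF v(1)])
  have F0: "0 \<le> (\<Sum>i<m. F i v (out v) * ?P i)"
    using P0 F_ge_1[of v] v by (intro sum_nonneg mult_nonneg_nonneg) (auto intro: order_trans[OF zero_le_one])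
  have nr: "\<not> rare v (out v)"
  proof
    assume "rare v (out v)"
    then have "R v (out v) = 1" using v by (simp add: R_node)
    then have "Psi v = (\<Sum>i<m. F i v (out v) * ?P i) + B + B * ?S" using Psi_v by (simp add: distrib_left)
    moreover have "0 \<le> B * ?S" using S0 by simp
    ultimately show False using Psi F0 by linarith
  qed
  let ?c = "real (card ?C)"
  have c: "0 < ?c" using not_rare_nonempty[OF nr] by (simp add: card_gt_0_iff)
  have obj: "objective pick v t = (\<Sum>i<m. ?P i * ?f i t) + B * ?r t" if "sol t v = out v" for t
    using that by (simp add: objective_def out_def)
  have "(\<Sum>t\<in>?C. objective pick v t) = (\<Sum>t\<in>?C. (\<Sum>i<m. ?P i * ?f i t) + B * ?r t)"
    by (intro sum.cong refl obj) (auto dest: cls_memD)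
  also have "\<dots> = (\<Sum>i<m. ?P i * (\<Sum>t\<in>?C. ?f i t)) + B * (\<Sum>t\<in>?C. ?r t)"
  proof -
    have "(\<Sum>t\<in>?C. \<Sum>i<m. ?P i * ?f i t) = (\<Sum>i<m. ?P i * (\<Sum>t\<in>?C. ?f i t))"
      by (subst sum.swap) (simp only: sum_distrib_left)
    moreover have "(\<Sum>t\<in>?C. B * ?r t) = B * (\<Sum>t\<in>?C. ?r t)" by (simp only: sum_distrib_left)
    ultimately show ?thesis by (simp only: sum.distrib[of "\<lambda>t. \<Sum>i<m. ?P i * ?f i t" "\<lambda>t. B * ?r t"])
  qed
  finally have "(\<Sum>t\<in>?C. objective pick v t) / ?c = (\<Sum>i<m. ?P i * ((\<Sum>t\<in>?C. ?f i t) / ?c)) + B * ((\<Sum>t\<in>?C. ?r t) / ?c)"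
    by (simp only: add_divide_distrib times_divide_eq_right
        sum_divide_distrib[of "\<lambda>i. ?P i * (\<Sum>t\<in>?C. ?f i t)" "{..<m}" ?c])
  also have "\<dots> = (\<Sum>i<m. F i v (out v) * ?P i) + B * R v (out v)"
    using nr v by (simp add: F_node R_node mult.commute)
  finally have avg: "(\<Sum>t\<in>?C. objective pick v t) / ?c = Psi v - B * ?S" using Psi_v by (simp add: algebra_simps)
  \<comment> \<open>The minimum over all \<open>T\<close> solutions is at most the mean over the
    class.\<close>
  have "objective pick v (pick v) \<le> (\<Sum>t\<in>?C. objective pick v t) / ?c"
    using not_rare_nonempty[OF nr] unfolding pick_eq[of v]
    by (intro average_ge argmin_le) (auto dest: cls_memD)
  then have le: "objective pick v (pick v) \<le> Psi v - B * ?S" using avg by simp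
  then have "objective pick v (pick v) < B" using Psi S0 mult_nonneg_nonneg[of "real B" ?S] by linarith
  then show mem: "sol (pick v) v = out v" by (auto simp: objective_def out_def split: if_splits)
  show "pick v < T" using theta_pos by (subst pick_eq) (rule argmin_less)
  have "Psi (Suc v) = (\<Sum>i<m. ?P i * ?f i (pick v)) + B * (?S + ?r (pick v))"
    by (simp only: Psi_def frontier_step(2)[OF v(1)] frontier_step_prod(2)[OF v(1)] out_children[OF v(1)])
  also have "\<dots> = objective pick v (pick v) + B * ?S" using obj[OF mem] by (simp add: algebra_simps)
  finally show "Psi (Suc v) \<le> Psi v" using le by simp
qed

lemma out_root: "out 1 = root" by (simp add: out_def label_of_def)

text \<open>At the root each row contributes at most \<open>2\<close> and the penalty at most
  \<open>1\<close>; the sum is below \<open>B\<close>, so every later step is a valid greedy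
  step.\<close>

lemma Psi_bound: "0 < v \<Longrightarrow> v \<le> n \<Longrightarrow> Psi v \<le> 2 * real m + 1"
proof (induction v)
  case (Suc v)
  show ?case
  proof (cases "v = 0")
    case True
    have "{1..<2} = {1::nat}" by auto
    moreover have "(\<Sum>i<m. F i 1 root) \<le> (\<Sum>i<m. 2)" using F_root by (intro sum_mono) auto
    ultimately show ?thesis using True R_root out_root by (simp add: Psi_def)
  next
    case False
    with Suc have IH: "Psi v \<le> 2 * real m + 1" by simp
    moreover have "2 * real m + 1 < B" by (simp add: B_def)
    ultimately have "Psi v < B" by linarith
    with greedy_step(1)[of v] False Suc.prems IH show ?thesis by simp
  qed
qed simp

text \<open>Each inner vertex and its two children carry codes of one common solution; validity is
  local and therefore inherited.\<close>

lemma out_step: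
  assumes "0 < v" "v < n"
  shows "pick v < T \<and> sol (pick v) v = out v \<and> sol (pick v) (2 * v) = out (2 * v) \<and> sol (pick v) (2 * v + 1) = out (2 * v + 1)"
proof -
  have "Psi v < B" using Psi_bound[of v] assms by (simp add: B_def)
  with greedy_step[OF assms] out_children[OF assms(1)] show ?thesis by simp
qed

lemma out_G:
  assumes "0 < v" "v < n" shows "G (out v mod q) (out (2 * v) mod q) (out (2 * v + 1) mod q)"
  using out_step[OF assms] sol_G[of "pick v" v] assms by metis

lemma out_leaf:
  assumes "n \<le> v" "v < 2 * n" "i < m" shows "a (out v mod q) i \<le> 1"
proof (cases "v = 1")
  \<comment> \<open>For height \<open>0\<close> the root is the only leaf, and there is no parent
    whose pick could be consulted.\<close>
  case True
  then show ?thesis using sol_leaf[of 0 v i] theta_pos assms sol_root[of 0] out_root by simp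
next
  case False
  let ?p = "v div 2"
  have "2 \<le> v" using False assms n_pos by (simp del: n_pos)
  then have p: "0 < ?p" "?p < n" using assms by auto
  have "v = 2 * ?p \<or> v = 2 * ?p + 1" by presburger
  then have "out v = sol (pick ?p) v" "pick ?p < T" using out_step[OF p] by metis+
  then show ?thesis using sol_leaf[of "pick ?p" v i] assms by simp
qed

lemma exp_half_le: "0 \<le> x \<Longrightarrow> x \<le> 1 \<Longrightarrow> exp (x / 2) \<le> 1 + (x::real)"
proof -
  assume x: "0 \<le> x" "x \<le> 1"
  have "exp (x / 2) \<le> 1 + x / 2 + (x / 2)\<^sup>2" using x by (intro exp_bound) auto
  also have "(x / 2)\<^sup>2 \<le> x / 2" using x mult_left_le[of x x] by (simp add: power2_eq_square)
  finally show ?thesis by simp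
qed

text \<open>Once the frontier consists of leaves, the \<open>F\<close> values are the plain factors
  \<open>1 + s * a\<close>. The product for one row is at most the sum over all rows, and
  \<open>exp (x / 2) \<le> 1 + x\<close> converts it into an exponential of the load.\<close>

theorem out_load:
  assumes i: "i < m"
  shows "(\<Sum>v=n..<2 * n. a (out v mod q) i) \<le> 32 * 2 ^ h * blocks * ln (2 * real m + 1)"
proof -
  let ?A = "\<lambda>v. a (out v mod q) i"
  let ?l = "\<Sum>v=n..<2 * n. ?A v"
  have s1: "s \<le> 1" using s_le by simp
  have "exp (s * ?l / 2) = (\<Prod>v=n..<2 * n. exp (s * ?A v / 2))"
    by (simp add: exp_sum[symmetric] sum_distrib_left sum_divide_distrib)
  also have "\<dots> \<le> (\<Prod>v=n..<2 * n. F i v (out v))"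
  proof (intro prod_mono conjI)
    fix v assume v: "v \<in> {n..<2 * n}"
    have "s * ?A v \<le> 1 * 1" using v i s1 s_pos a_nonneg out_leaf by (intro mult_mono) auto
    then show "exp (s * ?A v / 2) \<le> F i v (out v)"
      using v s_pos a_nonneg by (subst F_leaf) (auto intro!: exp_half_le)
  qed simp
  also have "\<dots> \<le> (\<Sum>i<m. \<Prod>v=n..<2 * n. F i v (out v))"
    using i F_ge_1 n_pos by (intro member_le_sum[of i "{..<m}" "\<lambda>i. \<Prod>v=n..<2 * n. F i v (out v)"])
      (auto intro!: prod_nonneg intro: order_trans[OF zero_le_one])
  also have "\<dots> \<le> Psi n"
  proof -
    have "0 \<le> (\<Sum>w=n..<2 * n. R w (out w))" using n_pos by (intro sum_nonneg) (simp add: R_leaf)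
    then show ?thesis by (simp add: Psi_def)
  qed
  also have "\<dots> \<le> 2 * real m + 1" by (rule Psi_bound) simp_all
  finally have "s * ?l / 2 \<le> ln (2 * real m + 1)" by (subst ln_ge_iff) simp_all
  then have "?l \<le> 2 * ln (2 * real m + 1) / s" using s_pos by (simp add: field_simps)
  also have "\<dots> = 32 * 2 ^ h * blocks * ln (2 * real m + 1)" by (simp add: s_def)
  finally show ?thesis .
qed

end

section \<open>Filling tables\<close>

text \<open>The evaluation of expressions by simplification has to go below conditionals.\<close>

declare if_cong [cong]

lemma index2_less:
  assumes "i' < i" "j' < (M::nat)" shows "M * i' + j' < M * i"
proof -
  have "M * i' + j' < M * Suc i'" using assms(2) by simp
  also have "\<dots> \<le> M * i" using assms(1) by (intro mult_le_mono) auto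
  finally show ?thesis .
qed

text \<open>The body may rely on smaller entries of the same table and on everything before the
  offset \<open>l\<close>; the latter lets one array hold the layers of successive rounds.\<close>

lemma table_n1:
  assumes "\<And>i A. i < nv \<sigma> p \<Longrightarrow> (\<And>i'. i' < i \<Longrightarrow> A (l + i') = f i') \<Longrightarrow> (\<And>z. z < l \<Longrightarrow> A z = na \<sigma> a z) \<Longrightarrow>
      nval ie (\<sigma>\<lparr>nv := (nv \<sigma>)(x := i), na := (na \<sigma>)(a := A)\<rparr>) = l + i \<and>
      nval e (\<sigma>\<lparr>nv := (nv \<sigma>)(x := i), na := (na \<sigma>)(a := A)\<rparr>) = f i"
  shows "\<exists>A. psem (For x p (StN a ie e)) \<sigma> = \<sigma>\<lparr>na := (na \<sigma>)(a := A)\<rparr> \<and>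
      (\<forall>i<nv \<sigma> p. A (l + i) = f i) \<and> (\<forall>z<l. A z = na \<sigma> a z)"
proof -
  let ?g = "\<lambda>z. f (z - l)"
  have "psem (For x p (StN a ie e)) \<sigma> = seg_n \<sigma> a l (l + nv \<sigma> p) ?g"
  proof (rule fill_n1)
    fix i \<tau> assume i: "i < nv \<sigma> p" and \<tau>: "\<tau> = seg_n (bind_nv \<sigma> x i) a l (l + i) ?g"
    show "nval ie \<tau> = l + i \<and> nval e \<tau> = ?g (l + i)"
      using assms[OF i, of "\<lambda>z. if l \<le> z \<and> z < l + i then ?g z else na \<sigma> a z"] unfolding \<tau> seg_n_def by simp
  qed
  then show ?thesis unfolding seg_n_def by (intro exI conjI) (assumption, simp_all)
qed

lemma table_r1:
  assumes "\<And>i A. i < nv \<sigma> p \<Longrightarrow> (\<And>i'. i' < i \<Longrightarrow> A (l + i') = f i') \<Longrightarrow> (\<And>z. z < l \<Longrightarrow> A z = ra \<sigma> a z) \<Longrightarrow>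
      nval ie (\<sigma>\<lparr>nv := (nv \<sigma>)(x := i), ra := (ra \<sigma>)(a := A)\<rparr>) = l + i \<and>
      rval e (\<sigma>\<lparr>nv := (nv \<sigma>)(x := i), ra := (ra \<sigma>)(a := A)\<rparr>) = f i"
  shows "\<exists>A. psem (For x p (StR a ie e)) \<sigma> = \<sigma>\<lparr>ra := (ra \<sigma>)(a := A)\<rparr> \<and>
      (\<forall>i<nv \<sigma> p. A (l + i) = f i) \<and> (\<forall>z<l. A z = ra \<sigma> a z)"
proof -
  let ?g = "\<lambda>z. f (z - l)"
  have "psem (For x p (StR a ie e)) \<sigma> = seg_r \<sigma> a l (l + nv \<sigma> p) ?g"
  proof (rule fill_r1)
    fix i \<tau> assume i: "i < nv \<sigma> p" and \<tau>: "\<tau> = seg_r (bind_nv \<sigma> x i) a l (l + i) ?g"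
    show "nval ie \<tau> = l + i \<and> rval e \<tau> = ?g (l + i)"
      using assms[OF i, of "\<lambda>z. if l \<le> z \<and> z < l + i then ?g z else ra \<sigma> a z"] unfolding \<tau> seg_r_def by simp
  qed
  then show ?thesis unfolding seg_r_def by (intro exI conjI) (assumption, simp_all)
qed

text \<open>Only completed rows are offered to the body. This suffices for the recursions below,
  which always refer to another vertex, hence to another row.\<close>

lemma table_r2:
  assumes x: "x \<noteq> r"
    and e: "\<And>i j A. i < nv \<sigma> p \<Longrightarrow> j < nv \<sigma> r \<Longrightarrow>
      (\<And>i' j'. i' < i \<Longrightarrow> j' < nv \<sigma> r \<Longrightarrow> A (l + (nv \<sigma> r * i' + j')) = f i' j') \<Longrightarrow> (\<And>z. z < l \<Longrightarrow> A z = ra \<sigma> a z) \<Longrightarrow>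
      nval ie (\<sigma>\<lparr>nv := (nv \<sigma>)(x := i, y := j), ra := (ra \<sigma>)(a := A)\<rparr>) = l + (nv \<sigma> r * i + j) \<and>
      rval e (\<sigma>\<lparr>nv := (nv \<sigma>)(x := i, y := j), ra := (ra \<sigma>)(a := A)\<rparr>) = f i j"
  shows "\<exists>A. psem (For x p (For y r (StR a ie e))) \<sigma> = \<sigma>\<lparr>ra := (ra \<sigma>)(a := A)\<rparr> \<and>
      (\<forall>i<nv \<sigma> p. \<forall>j<nv \<sigma> r. A (l + (nv \<sigma> r * i + j)) = f i j) \<and> (\<forall>z<l. A z = ra \<sigma> a z)"
proof -
  let ?M = "nv \<sigma> r"
  let ?g = "\<lambda>z. f ((z - l) div ?M) ((z - l) mod ?M)"
  have "psem (For x p (For y r (StR a ie e))) \<sigma> = seg_r \<sigma> a l (l + nv \<sigma> p * ?M) ?g"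
  proof (rule fill_r2[OF x])
    fix i j \<tau> assume i: "i < nv \<sigma> p" and j: "j < ?M"
      and \<tau>: "\<tau> = seg_r (bind_nv (bind_nv \<sigma> x i) y j) a l (l + i * ?M + j) ?g"
    let ?A = "\<lambda>z. if l \<le> z \<and> z < l + i * ?M + j then ?g z else ra \<sigma> a z"
    have "?A (l + (?M * i' + j')) = f i' j'" if "i' < i" "j' < ?M" for i' j'
      using index2_less[OF that] that(2) by (simp add: mult.commute)
    from e[OF i j this] have "nval ie \<tau> = l + (?M * i + j) \<and> rval e \<tau> = f i j"
      unfolding \<tau> seg_r_def by simp
    with j show "nval ie \<tau> = l + i * ?M + j \<and> rval e \<tau> = ?g (l + i * ?M + j)"
      by (simp add: mult.commute add.assoc)
  qed
  moreover have "?M * i + j < nv \<sigma> p * ?M" if "i < nv \<sigma> p" "j < ?M" for i j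
    using index2_less[OF that] by (simp add: mult.commute)
  ultimately show ?thesis unfolding seg_r_def by (intro exI conjI) (assumption, simp_all)
qed

lemma table_r3:
  assumes x: "x \<noteq> r" "x \<noteq> q" "y \<noteq> q"
    and e: "\<And>i j k A. i < nv \<sigma> p \<Longrightarrow> j < nv \<sigma> r \<Longrightarrow> k < nv \<sigma> q \<Longrightarrow>
      (\<And>i' j' k'. i' < i \<Longrightarrow> j' < nv \<sigma> r \<Longrightarrow> k' < nv \<sigma> q \<Longrightarrow>
        A (l + (nv \<sigma> q * (nv \<sigma> r * i' + j') + k')) = f i' j' k') \<Longrightarrow> (\<And>z. z < l \<Longrightarrow> A z = ra \<sigma> a z) \<Longrightarrow>
      nval ie (\<sigma>\<lparr>nv := (nv \<sigma>)(x := i, y := j, w := k), ra := (ra \<sigma>)(a := A)\<rparr>) = l + (nv \<sigma> q * (nv \<sigma> r * i + j) + k) \<and>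
      rval e (\<sigma>\<lparr>nv := (nv \<sigma>)(x := i, y := j, w := k), ra := (ra \<sigma>)(a := A)\<rparr>) = f i j k"
  shows "\<exists>A. psem (For x p (For y r (For w q (StR a ie e)))) \<sigma> = \<sigma>\<lparr>ra := (ra \<sigma>)(a := A)\<rparr> \<and>
      (\<forall>i<nv \<sigma> p. \<forall>j<nv \<sigma> r. \<forall>k<nv \<sigma> q. A (l + (nv \<sigma> q * (nv \<sigma> r * i + j) + k)) = f i j k) \<and>
      (\<forall>z<l. A z = ra \<sigma> a z)"
proof -
  let ?M = "nv \<sigma> r" and ?Q = "nv \<sigma> q"
  let ?g = "\<lambda>z. f ((z - l) div ?Q div ?M) ((z - l) div ?Q mod ?M) ((z - l) mod ?Q)"
  have "psem (For x p (For y r (For w q (StR a ie e)))) \<sigma> = seg_r \<sigma> a l (l + nv \<sigma> p * (?M * ?Q)) ?g"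
  proof (rule fill_r3[OF x])
    fix i j k \<tau> assume i: "i < nv \<sigma> p" and j: "j < ?M" and k: "k < ?Q"
      and \<tau>: "\<tau> = seg_r (bind_nv (bind_nv (bind_nv \<sigma> x i) y j) w k) a l (l + (i * ?M + j) * ?Q + k) ?g"
    let ?A = "\<lambda>z. if l \<le> z \<and> z < l + (i * ?M + j) * ?Q + k then ?g z else ra \<sigma> a z"
    have "?A (l + (?Q * (?M * i' + j') + k')) = f i' j' k'" if "i' < i" "j' < ?M" "k' < ?Q" for i' j' k'
    proof -
      have "?Q * (?M * i' + j') + k' < ?Q * (?M * i)" using index2_less[OF index2_less[OF that(1,2)] that(3)] .
      also have "\<dots> \<le> (i * ?M + j) * ?Q + k" by (simp add: algebra_simps)
      finally show ?thesis using that(2,3) by simp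
    qed
    from e[OF i j k this] have "nval ie \<tau> = l + (?Q * (?M * i + j) + k) \<and> rval e \<tau> = f i j k"
      unfolding \<tau> seg_r_def by simp
    moreover have "l + (i * ?M + j) * ?Q + k = l + (?Q * (?M * i + j) + k)" by (simp add: mult.commute)
    moreover have "?g (l + (i * ?M + j) * ?Q + k) = f i j k" using j k by (simp add: add.assoc)
    ultimately show "nval ie \<tau> = l + (i * ?M + j) * ?Q + k \<and> rval e \<tau> = ?g (l + (i * ?M + j) * ?Q + k)"
      by (simp only:)
  qed
  moreover have "?Q * (?M * i + j) + k < nv \<sigma> p * (?M * ?Q)" if "i < nv \<sigma> p" "j < ?M" "k < ?Q" for i j k
    using index2_less[OF index2_less[OF that(1,2)] that(3)] by (simp add: mult_ac)
  ultimately show ?thesis unfolding seg_r_def by (intro exI conjI) (assumption, simp_all)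
qed

lemma psem_For_invariant:
  assumes "I 0 \<sigma>" and "\<And>i \<tau>. i < nv \<sigma> p \<Longrightarrow> I i \<tau> \<Longrightarrow> I (Suc i) (psem c (bind_nv \<tau> x i))"
    and "\<And>i \<tau> k. I i \<tau> \<Longrightarrow> I i (bind_nv \<tau> x k)"
  shows "I (nv \<sigma> p) (psem (For x p c) \<sigma>)"
proof -
  have "I i (iterate (\<lambda>i \<tau>. psem c (bind_nv \<tau> x i)) i \<sigma>)" if "i \<le> nv \<sigma> p" for i
    using that by (induction i) (use assms(1,2) in auto)
  from assms(3)[OF this[OF order_refl]] show ?thesis by simp
qed

section \<open>The program: tables depending on the sizes only\<close>

text \<open>Repeated addition, as the machine has no product of natural numbers. Nested products may
  share the counter because no factor refers to it.\<close>

definition Mul :: "nexp \<Rightarrow> name \<Rightarrow> nexp" where "Mul e p = NSum ''z'' p e"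

definition NEq :: "nexp \<Rightarrow> nexp \<Rightarrow> nexp \<Rightarrow> nexp \<Rightarrow> nexp" where
  "NEq a b c d = NIf (BN a b) d (NIf (BN b a) d c)"

definition REq :: "nexp \<Rightarrow> nexp \<Rightarrow> rexp \<Rightarrow> rexp \<Rightarrow> rexp" where
  "REq a b c d = RIf (BN a b) d (RIf (BN b a) d c)"

lemma nval_NEq [simp]: "nval (NEq a b c d) \<sigma> = (if nval a \<sigma> = nval b \<sigma> then nval c \<sigma> else nval d \<sigma>)"
  by (simp add: NEq_def)

lemma rval_REq [simp]: "rval (REq a b c d) \<sigma> = (if nval a \<sigma> = nval b \<sigma> then rval c \<sigma> else rval d \<sigma>)"
  by (simp add: REq_def)

lemma wf_Mul [simp]: "wf_n (Mul e p) = (p \<in> params \<and> wf_n e)"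
  by (auto simp: Mul_def counter_def user_name_def params_def)

lemma wf_Eq [simp]:
  "wf_n (NEq a b c d) = (wf_n a \<and> wf_n b \<and> wf_n c \<and> wf_n d)"
  "wf_r (REq a b c' d') = (wf_n a \<and> wf_n b \<and> wf_r c' \<and> wf_r d')"
  by (auto simp: NEq_def REq_def)

text \<open>Multiplication by a number \<open>b\<close> that is not a parameter: \<open>c\<close> is
  added once for each \<open>k < b\<close> in a loop over a parameter that is at least
  \<open>b\<close>.\<close>

lemma sum_if_less: "(\<Sum>k<N. if k < b then c else 0) = min b N * (c::nat)"
  by (induction N) (auto simp: min_def le_Suc_eq)

text \<open>Bounded existential quantification expressed as a positive count.\<close>

lemma sum_indicator_pos: "0 < (\<Sum>k<(N::nat). if P k then Suc 0 else 0) \<longleftrightarrow> (\<exists>k<N. P k)"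
  by (induction N) (auto simp: less_Suc_eq)

abbreviation pred :: "nexp \<Rightarrow> nexp" where "pred e \<equiv> NMinus e (NC 1)"

definition c_pw :: cmd where
  "c_pw = For ''x'' ''H1'' (StN ''pw'' (NV ''x'') (NIf (BN (NV ''x'') (NC 1)) (NC 1)
     (NPlus (NLd ''pw'' (pred (NV ''x''))) (NLd ''pw'' (pred (NV ''x''))))))"

definition c_pq :: cmd where
  "c_pq = For ''x'' ''H1'' (StN ''pq'' (NV ''x'') (NIf (BN (NV ''x'') (NC 1)) (NC 1)
     (Mul (NLd ''pq'' (pred (NV ''x''))) ''q'')))"

text \<open>For positive \<open>K\<close> the result is one more than the ceiling of
  \<open>H / K\<close>; the extra \<open>1\<close> keeps it positive for \<open>H = 0\<close>. As
  \<open>K\<close> is not a parameter, its multiples are formed by a loop over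
  \<open>H\<close>.\<close>

definition c_h :: cmd where
  "c_h = SetN ''h'' (NPlus (NSum ''x'' ''H''
     (NIf (BN (NSum ''y'' ''H'' (NIf (BN (NV ''y'') (NV ''x'')) (NV ''K'') (NC 0))) (NV ''H'')) (NC 1) (NC 0))) (NC 1))"

text \<open>Truth value of divisibility of \<open>e\<close>, at most \<open>H\<close>, by \<open>h\<close>; \<open>h\<close> itself cannot bound a loop.\<close>

definition is_multiple :: "nexp \<Rightarrow> bexp" where
  "is_multiple e = BN (NC 0) (NSum ''y'' ''H1''
     (NEq (NSum ''z'' ''H1'' (NIf (BN (NV ''z'') (NV ''y'')) (NV ''h'') (NC 0))) e (NC 1) (NC 0)))"

definition c_ct :: cmd where
  "c_ct = SetN ''ct'' (NSum ''x'' ''H'' (NIf (is_multiple (NV ''x'')) (NC 1) (NC 0)))"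

text \<open>Division by counting the positive multiples of \<open>q\<close> up to \<open>x\<close>.
  Halves and depths are obtained by similar counts.\<close>

definition c_dv :: cmd where
  "c_dv = For ''x'' ''QQ'' (StN ''dv'' (NV ''x'')
     (NSum ''y'' ''QQ'' (NIf (BN (NV ''x'') (Mul (NPlus (NV ''y'') (NC 1)) ''q'')) (NC 0) (NC 1))))"

definition c_md :: cmd where
  "c_md = For ''x'' ''QQ'' (StN ''md'' (NV ''x'') (NMinus (NV ''x'') (Mul (NLd ''dv'' (NV ''x'')) ''q'')))"

definition c_par :: cmd where
  "c_par = For ''x'' ''N'' (StN ''par'' (NV ''x'')
     (NSum ''y'' ''n'' (NIf (BN (NPlus (NPlus (NV ''y'') (NV ''y'')) (NC 1)) (NV ''x'')) (NC 1) (NC 0))))"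

definition c_cu :: cmd where
  "c_cu = For ''x'' ''N'' (StN ''cu'' (NV ''x'') (NIf (is_multiple
     (NSum ''w'' ''H'' (NIf (BN (NV ''x'') (NLd ''pw'' (NPlus (NV ''w'') (NC 1)))) (NC 0) (NC 1)))) (NC 1) (NC 0)))"

definition c_a :: cmd where
  "c_a = For ''x'' ''q'' (For ''i'' ''m'' (StR ''a'' (NPlus (Mul (NV ''x'') ''m'') (NV ''i''))
     (RAgg ROAdd ''j'' ''d'' (ROf (NC 0)) (RBin ROMul (RLd ''A'' (NPlus (Mul (NV ''i'') ''d'') (NV ''j'')))
       (RLd ''x'' (NPlus (Mul (NV ''x'') ''d'') (NV ''j'')))))))"

definition c_ex :: cmd where
  "c_ex = For ''x'' ''q'' (StR ''ex'' (NV ''x'')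
     (RAgg ROAdd ''i'' ''m'' (ROf (NC 0)) (RIf (BR (ROf (NC 1)) (RLd ''a'' (NPlus (Mul (NV ''x'') ''m'') (NV ''i''))))
       (ROf (NC 1)) (ROf (NC 0)))))"

definition four_times :: "nexp \<Rightarrow> nexp" where "four_times e = NPlus (NPlus e e) (NPlus e e)"

text \<open>With \<open>H1 = H + 2\<close> the tables of powers reach exponent \<open>H + 1\<close>,
  which bounds both the exponent in \<open>2 ^ h\<close> and the exponent in
  \<open>Q\<close>.\<close>

definition c_pre :: "cmd list" where
  "c_pre = [SetN ''H1'' (NPlus (NV ''H'') (NC 2)), c_pw, SetN ''n'' (NLd ''pw'' (NV ''H'')),
     SetN ''N'' (NPlus (NV ''n'') (NV ''n'')), c_h, c_pq, c_ct,
     SetN ''Q'' (NLd ''pq'' (NPlus (NV ''ct'') (NC 1))),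
     SetN ''q2'' (Mul (NV ''q'') ''q''), SetN ''QQ'' (Mul (NV ''q'') ''Q''),
     SetN ''B'' (four_times (NPlus (NV ''m'') (NC 1))),
     SetN ''th'' (Mul (Mul (Mul (Mul (Mul (NPlus (Mul (NV ''B'') ''m'') (NV ''B'')) ''N'') ''N'') ''N'') ''N'') ''Q''),
     SetN ''T'' (Mul (Mul (four_times (NPlus (Mul (NV ''th'') ''m'') (NV ''th''))) ''N'') ''Q''),
     c_dv, c_md, c_par, c_cu, c_a, c_ex]"

lemma wf_pre: "list_all wf_c c_pre"
  by (simp add: c_pre_def c_pw_def c_pq_def c_h_def c_ct_def c_dv_def c_md_def c_par_def c_cu_def c_a_def c_ex_def
      is_multiple_def four_times_def counter_def user_name_def params_def)

section \<open>Specification of the tables for an instance\<close>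

locale instance_tables = feasible_tree +
  fixes d K :: nat and Am xm :: "nat \<Rightarrow> real" and Gt :: "nat \<Rightarrow> nat"
  assumes Gt: "\<And>x p. x < q \<Longrightarrow> p < q * q \<Longrightarrow> 0 < Gt (q * q * x + p) \<longleftrightarrow> G x (p div q) (p mod q)"
    and a_eq: "\<And>l i. l < q \<Longrightarrow> i < m \<Longrightarrow> a l i = (\<Sum>j<d. Am (d * i + j) * xm (d * l + j))"
    and h_eq: "h = (\<Sum>x<H. if x * K < H then 1 else 0) + 1"
begin

definition H1 :: nat where "H1 = H + 2"

definition start :: "env \<Rightarrow> bool" where
  "start \<sigma> \<longleftrightarrow> nv \<sigma> ''H'' = H \<and> nv \<sigma> ''q'' = q \<and> nv \<sigma> ''m'' = m \<and> nv \<sigma> ''d'' = d \<and> nv \<sigma> ''root'' = root \<and>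
     nv \<sigma> ''K'' = K \<and> na \<sigma> ''Gamma'' = Gt \<and> ra \<sigma> ''A'' = Am \<and> ra \<sigma> ''x'' = xm \<and> ra \<sigma> ''W'' = (\<lambda>_. 0)"

definition sizes :: "env \<Rightarrow> bool" where
  "sizes \<tau> \<longleftrightarrow> nv \<tau> ''H'' = H \<and> nv \<tau> ''q'' = q \<and> nv \<tau> ''m'' = m \<and> nv \<tau> ''d'' = d \<and> nv \<tau> ''root'' = root \<and>
     nv \<tau> ''n'' = n \<and> nv \<tau> ''N'' = 2 * n \<and> nv \<tau> ''Q'' = Q \<and> nv \<tau> ''q2'' = q * q \<and> nv \<tau> ''QQ'' = Q * q \<and>
     nv \<tau> ''H1'' = H1 \<and> nv \<tau> ''B'' = B \<and> nv \<tau> ''th'' = theta \<and> nv \<tau> ''T'' = T \<and> nv \<tau> ''h'' = h \<and>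
     nv \<tau> ''ct'' = cuts h H"

text \<open>The part of the state that is read-only after preprocessing.\<close>

definition static :: "env \<Rightarrow> bool" where
  "static \<tau> \<longleftrightarrow> sizes \<tau> \<and>
     (\<forall>k<H1. na \<tau> ''pw'' k = 2 ^ k) \<and> (\<forall>x<Q * q. na \<tau> ''dv'' x = x div q) \<and> (\<forall>x<Q * q. na \<tau> ''md'' x = x mod q) \<and>
     (\<forall>v<2 * n. na \<tau> ''par'' v = v div 2) \<and> (\<forall>v<2 * n. na \<tau> ''cu'' v = (if cut v then 1 else 0)) \<and>
     na \<tau> ''Gamma'' = Gt \<and> (\<forall>l<q. \<forall>i<m. ra \<tau> ''a'' (m * l + i) = a l i) \<and> (\<forall>l<q. ra \<tau> ''ex'' l = excess l)"

definition size_bound :: nat where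
  "size_bound = H + 2 + q + m + d + 2 * n + Q + q * q + Q * q + T"

lemma h_le: "h \<le> H + 1"
proof -
  have "(\<Sum>x<H. if x * K < H then 1 else 0 :: nat) \<le> (\<Sum>x<H. 1)" by (intro sum_mono) simp
  then show ?thesis by (simp add: h_eq)
qed

lemma cuts_eq: "cuts h k = (\<Sum>x<k. if x mod h = 0 then 1 else 0)"
  by (induction k) auto

lemma cuts_le: "cuts h k \<le> k"
proof -
  have "(\<Sum>x<k. if x mod h = 0 then 1 else 0 :: nat) \<le> (\<Sum>x<k. 1)" by (intro sum_mono) simp
  then show ?thesis by (simp add: cuts_eq)
qed

lemma bval_is_multiple:
  assumes "nv \<sigma> ''H1'' = H1" "nv \<sigma> ''h'' = h" "x \<le> H" and e: "\<And>k. nval e (bind_nv \<sigma> ''y'' k) = x"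
  shows "bval (is_multiple e) \<sigma> \<longleftrightarrow> x mod h = 0"
proof -
  have "bval (is_multiple e) \<sigma> \<longleftrightarrow> (\<exists>y<H1. y * h = x)"
    using assms(1,2) by (simp add: is_multiple_def e sum_if_less sum_indicator_pos cong: conj_cong)
  also have "\<dots> \<longleftrightarrow> x mod h = 0"
  proof
    assume "x mod h = 0"
    then have "x div h * h = x" by (simp add: mult.commute minus_mod_eq_mult_div[symmetric])
    \<comment> \<open>The quotient is at most \<open>H\<close>, so the bounded search finds
      it.\<close>
    moreover have "x div h < H1" using le_trans[OF div_le_dividend[of x h] assms(3)] unfolding H1_def by linarith
    ultimately show "\<exists>y<H1. y * h = x" by blast
  qed auto
  finally show ?thesis .
qed

section \<open>Correctness of the preprocessing\<close>

lemma step_pw: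
  assumes "nv \<sigma> ''H1'' = H1"
  shows "\<exists>A. psem c_pw \<sigma> = \<sigma>\<lparr>na := (na \<sigma>)(''pw'' := A)\<rparr> \<and> (\<forall>k<H1. A k = 2 ^ k)"
proof -
  have "\<exists>A. psem c_pw \<sigma> = \<sigma>\<lparr>na := (na \<sigma>)(''pw'' := A)\<rparr> \<and> (\<forall>i<nv \<sigma> ''H1''. A (0 + i) = 2 ^ i) \<and> (\<forall>z<0. A z = na \<sigma> ''pw'' z)"
    unfolding c_pw_def
  proof (rule table_n1)
    fix i A assume "\<And>i'. i' < i \<Longrightarrow> A (0 + i') = (2::nat) ^ i'"
    then have "0 < i \<Longrightarrow> A (i - 1) = 2 ^ (i - 1)" by simp
    then show "nval (NV ''x'') (\<sigma>\<lparr>nv := (nv \<sigma>)(''x'' := i), na := (na \<sigma>)(''pw'' := A)\<rparr>) = 0 + i \<and>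
        nval (NIf (BN (NV ''x'') (NC 1)) (NC 1) (NPlus (NLd ''pw'' (pred (NV ''x''))) (NLd ''pw'' (pred (NV ''x'')))))
          (\<sigma>\<lparr>nv := (nv \<sigma>)(''x'' := i), na := (na \<sigma>)(''pw'' := A)\<rparr>) = 2 ^ i"
      by (cases i) auto
  qed
  then show ?thesis using assms by auto
qed

lemma step_pq:
  assumes "nv \<sigma> ''H1'' = H1" "nv \<sigma> ''q'' = q"
  shows "\<exists>A. psem c_pq \<sigma> = \<sigma>\<lparr>na := (na \<sigma>)(''pq'' := A)\<rparr> \<and> (\<forall>k<H1. A k = q ^ k)"
proof -
  have "\<exists>A. psem c_pq \<sigma> = \<sigma>\<lparr>na := (na \<sigma>)(''pq'' := A)\<rparr> \<and> (\<forall>i<nv \<sigma> ''H1''. A (0 + i) = q ^ i) \<and> (\<forall>z<0. A z = na \<sigma> ''pq'' z)"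
    unfolding c_pq_def
  proof (rule table_n1)
    fix i A assume "\<And>i'. i' < i \<Longrightarrow> A (0 + i') = q ^ i'"
    then have "0 < i \<Longrightarrow> A (i - 1) = q ^ (i - 1)" by simp
    then show "nval (NV ''x'') (\<sigma>\<lparr>nv := (nv \<sigma>)(''x'' := i), na := (na \<sigma>)(''pq'' := A)\<rparr>) = 0 + i \<and>
        nval (NIf (BN (NV ''x'') (NC 1)) (NC 1) (Mul (NLd ''pq'' (pred (NV ''x''))) ''q''))
          (\<sigma>\<lparr>nv := (nv \<sigma>)(''x'' := i), na := (na \<sigma>)(''pq'' := A)\<rparr>) = q ^ i"
      using assms(2) by (cases i) (auto simp: Mul_def)
  qed
  then show ?thesis using assms by auto
qed

lemma step_h:
  assumes "nv \<sigma> ''H'' = H" "nv \<sigma> ''K'' = K" shows "psem c_h \<sigma> = bind_nv \<sigma> ''h'' h"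
proof -
  have "(\<Sum>x<H. if (\<Sum>y<H. if y < x then K else 0) < H then 1 else 0 :: nat) = (\<Sum>x<H. if x * K < H then 1 else 0)"
    by (intro sum.cong refl) (simp add: sum_if_less)
  then show ?thesis using assms by (simp add: c_h_def h_eq)
qed

lemma step_ct:
  assumes "nv \<sigma> ''H'' = H" "nv \<sigma> ''H1'' = H1" "nv \<sigma> ''h'' = h"
  shows "psem c_ct \<sigma> = bind_nv \<sigma> ''ct'' (cuts h H)"
proof -
  have "bval (is_multiple (NV ''x'')) (bind_nv \<sigma> ''x'' x) \<longleftrightarrow> x mod h = 0" if "x < H" for x
    using that assms by (intro bval_is_multiple) auto
  then show ?thesis using assms by (simp add: c_ct_def cuts_eq cong: sum.cong_simp)
qed

lemma step_dv:
  assumes "nv \<sigma> ''QQ'' = Q * q" "nv \<sigma> ''q'' = q"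
  shows "\<exists>A. psem c_dv \<sigma> = \<sigma>\<lparr>na := (na \<sigma>)(''dv'' := A)\<rparr> \<and> (\<forall>x<Q * q. A x = x div q)"
proof -
  have "\<exists>A. psem c_dv \<sigma> = \<sigma>\<lparr>na := (na \<sigma>)(''dv'' := A)\<rparr> \<and> (\<forall>i<nv \<sigma> ''QQ''. A (0 + i) = i div q) \<and> (\<forall>z<0. A z = na \<sigma> ''dv'' z)"
    unfolding c_dv_def
  proof (rule table_n1)
    fix x A assume x: "x < nv \<sigma> ''QQ''"
    have "(x < q * Suc y) \<longleftrightarrow> \<not> y < x div q" for y
      using less_eq_div_iff_mult_less_eq[OF q_pos, of "Suc y" x] by (auto simp: mult.commute)
    then have "(\<Sum>y<Q * q. if x < q * Suc y then 0 else 1 :: nat) = (\<Sum>y<Q * q. if y < x div q then 1 else 0)"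
      by (intro sum.cong) auto
    also have "x div q \<le> Q * q" using x assms(1) div_le_dividend[of x q] by linarith
    then have "(\<Sum>y<Q * q. if y < x div q then 1 else 0) = x div q" by (simp add: sum_if_less min_absorb1)
    finally show "nval (NV ''x'') (\<sigma>\<lparr>nv := (nv \<sigma>)(''x'' := x), na := (na \<sigma>)(''dv'' := A)\<rparr>) = 0 + x \<and>
        nval (NSum ''y'' ''QQ'' (NIf (BN (NV ''x'') (Mul (NPlus (NV ''y'') (NC 1)) ''q'')) (NC 0) (NC 1)))
          (\<sigma>\<lparr>nv := (nv \<sigma>)(''x'' := x), na := (na \<sigma>)(''dv'' := A)\<rparr>) = x div q"
      using assms by (simp add: Mul_def cong: if_cong)
  qed
  then show ?thesis using assms by auto
qed

lemma step_md:
  assumes "nv \<sigma> ''QQ'' = Q * q" "nv \<sigma> ''q'' = q" "\<forall>x<Q * q. na \<sigma> ''dv'' x = x div q"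
  shows "\<exists>A. psem c_md \<sigma> = \<sigma>\<lparr>na := (na \<sigma>)(''md'' := A)\<rparr> \<and> (\<forall>x<Q * q. A x = x mod q)"
proof -
  have "\<exists>A. psem c_md \<sigma> = \<sigma>\<lparr>na := (na \<sigma>)(''md'' := A)\<rparr> \<and> (\<forall>i<nv \<sigma> ''QQ''. A (0 + i) = i mod q) \<and> (\<forall>z<0. A z = na \<sigma> ''md'' z)"
    unfolding c_md_def
  proof (rule table_n1)
    fix x A assume "x < nv \<sigma> ''QQ''"
    then show "nval (NV ''x'') (\<sigma>\<lparr>nv := (nv \<sigma>)(''x'' := x), na := (na \<sigma>)(''md'' := A)\<rparr>) = 0 + x \<and>
        nval (NMinus (NV ''x'') (Mul (NLd ''dv'' (NV ''x'')) ''q''))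
          (\<sigma>\<lparr>nv := (nv \<sigma>)(''x'' := x), na := (na \<sigma>)(''md'' := A)\<rparr>) = x mod q"
      using assms by (simp add: Mul_def minus_mult_div_eq_mod)
  qed
  then show ?thesis using assms by auto
qed

lemma step_par:
  assumes "nv \<sigma> ''N'' = 2 * n" "nv \<sigma> ''n'' = n"
  shows "\<exists>A. psem c_par \<sigma> = \<sigma>\<lparr>na := (na \<sigma>)(''par'' := A)\<rparr> \<and> (\<forall>v<2 * n. A v = v div 2)"
proof -
  have "\<exists>A. psem c_par \<sigma> = \<sigma>\<lparr>na := (na \<sigma>)(''par'' := A)\<rparr> \<and> (\<forall>i<nv \<sigma> ''N''. A (0 + i) = i div 2) \<and> (\<forall>z<0. A z = na \<sigma> ''par'' z)"
    unfolding c_par_def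
  proof (rule table_n1)
    fix v A assume v: "v < nv \<sigma> ''N''"
    have "(\<Sum>y<n. if y + y + 1 < v then 1 else 0 :: nat) = (\<Sum>y<n. if y < v div 2 then 1 else 0)"
      by (intro sum.cong refl if_cong) auto
    also have "\<dots> = v div 2" using v assms(1) by (simp add: sum_if_less)
    finally show "nval (NV ''x'') (\<sigma>\<lparr>nv := (nv \<sigma>)(''x'' := v), na := (na \<sigma>)(''par'' := A)\<rparr>) = 0 + v \<and>
        nval (NSum ''y'' ''n'' (NIf (BN (NPlus (NPlus (NV ''y'') (NV ''y'')) (NC 1)) (NV ''x'')) (NC 1) (NC 0)))
          (\<sigma>\<lparr>nv := (nv \<sigma>)(''x'' := v), na := (na \<sigma>)(''par'' := A)\<rparr>) = v div 2"
      using assms by simp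
  qed
  then show ?thesis using assms by auto
qed

text \<open>The depth is a binary logarithm, so it counts the powers \<open>2 ^ (w + 1)\<close> not
  exceeding \<open>v\<close>; by \<open>depth_le\<close> none of them has an exponent beyond
  \<open>H\<close>.\<close>

lemma depth_count: "v < 2 * n \<Longrightarrow> (\<Sum>w<H. if v < 2 ^ (w + 1) then 0 else 1 :: nat) = depth v"
proof (cases "v = 0")
  case False
  assume v: "v < 2 * n"
  have "(\<Sum>w<H. if v < 2 ^ (w + 1) then 0 else 1 :: nat) = (\<Sum>w<H. if w < depth v then 1 else 0)"
    using depth_le_iff[of v] False by (intro sum.cong refl) (auto simp: not_less[symmetric])
  also have "\<dots> = depth v" using depth_le[of v] False v by (simp add: sum_if_less)
  finally show ?thesis .
qed (subst depth.simps, simp)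

lemma step_cu:
  assumes "nv \<sigma> ''N'' = 2 * n" "nv \<sigma> ''H'' = H" "nv \<sigma> ''H1'' = H1" "nv \<sigma> ''h'' = h" "\<forall>k<H1. na \<sigma> ''pw'' k = 2 ^ k"
  shows "\<exists>A. psem c_cu \<sigma> = \<sigma>\<lparr>na := (na \<sigma>)(''cu'' := A)\<rparr> \<and> (\<forall>v<2 * n. A v = (if cut v then 1 else 0))"
proof -
  have "\<exists>A. psem c_cu \<sigma> = \<sigma>\<lparr>na := (na \<sigma>)(''cu'' := A)\<rparr> \<and> (\<forall>i<nv \<sigma> ''N''. A (0 + i) = (if cut i then 1 else 0)) \<and>
      (\<forall>z<0. A z = na \<sigma> ''cu'' z)"
    unfolding c_cu_def
  proof (rule table_n1)
    fix v A assume v: "v < nv \<sigma> ''N''"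
    let ?\<tau> = "\<sigma>\<lparr>nv := (nv \<sigma>)(''x'' := v), na := (na \<sigma>)(''cu'' := A)\<rparr>"
    let ?e = "NSum ''w'' ''H'' (NIf (BN (NV ''x'') (NLd ''pw'' (NPlus (NV ''w'') (NC 1)))) (NC 0) (NC 1))"
    have "depth v \<le> H"
    proof (cases "v = 0")
      case True then show ?thesis by (subst depth.simps) simp
    qed (use depth_le[of v] v assms(1) in simp)
    moreover have "nval ?e (bind_nv ?\<tau> ''y'' k) = depth v" for k
      using assms v depth_count[of v] by (simp add: H1_def cong: sum.cong_simp)
    ultimately have "bval (is_multiple ?e) ?\<tau> \<longleftrightarrow> depth v mod h = 0"
      using assms by (intro bval_is_multiple) auto
    then show "nval (NV ''x'') ?\<tau> = 0 + v \<and> nval (NIf (is_multiple ?e) (NC 1) (NC 0)) ?\<tau> = (if cut v then 1 else 0)"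
      by (simp add: cut_def)
  qed
  then show ?thesis using assms by auto
qed

lemma step_a:
  assumes "nv \<sigma> ''q'' = q" "nv \<sigma> ''m'' = m" "nv \<sigma> ''d'' = d" "ra \<sigma> ''A'' = Am" "ra \<sigma> ''x'' = xm"
  shows "\<exists>A. psem c_a \<sigma> = \<sigma>\<lparr>ra := (ra \<sigma>)(''a'' := A)\<rparr> \<and> (\<forall>l<q. \<forall>i<m. A (m * l + i) = a l i)"
proof -
  have "\<exists>A. psem c_a \<sigma> = \<sigma>\<lparr>ra := (ra \<sigma>)(''a'' := A)\<rparr> \<and>
      (\<forall>l<nv \<sigma> ''q''. \<forall>i<nv \<sigma> ''m''. A (0 + (nv \<sigma> ''m'' * l + i)) = a l i) \<and> (\<forall>z<0. A z = ra \<sigma> ''a'' z)"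
    unfolding c_a_def by (rule table_r2) (use assms in \<open>simp_all add: Mul_def aggr_plus a_eq\<close>)
  then show ?thesis using assms by auto
qed

lemma step_ex:
  assumes "nv \<sigma> ''q'' = q" "nv \<sigma> ''m'' = m" "\<forall>l<q. \<forall>i<m. ra \<sigma> ''a'' (m * l + i) = a l i"
  shows "\<exists>A. psem c_ex \<sigma> = \<sigma>\<lparr>ra := (ra \<sigma>)(''ex'' := A)\<rparr> \<and> (\<forall>l<q. A l = excess l)"
proof -
  have "\<exists>A. psem c_ex \<sigma> = \<sigma>\<lparr>ra := (ra \<sigma>)(''ex'' := A)\<rparr> \<and> (\<forall>l<nv \<sigma> ''q''. A (0 + l) = excess l) \<and> (\<forall>z<0. A z = ra \<sigma> ''ex'' z)"
    unfolding c_ex_def by (rule table_r1) (use assms in \<open>simp_all add: Mul_def aggr_plus excess_def cong: sum.cong_simp\<close>)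
  then show ?thesis using assms by auto
qed

text \<open>Each intermediate state gets a name and its components become rewrite rules, so that
  lookups follow a chain of short updates instead of a large nested term.\<close>

lemma pre_phase:
  assumes st: "start \<sigma>" and zero: "\<And>p. p \<in> params - {''H'', ''q'', ''m'', ''d''} \<Longrightarrow> nv \<sigma> p = 0"
  shows "static (fold psem c_pre \<sigma>) \<and> ra (fold psem c_pre \<sigma>) ''W'' = (\<lambda>_. 0) \<and> bounded_run size_bound c_pre \<sigma>"
proof -
  have in0: "nv \<sigma> ''H'' = H" "nv \<sigma> ''q'' = q" "nv \<sigma> ''m'' = m" "nv \<sigma> ''d'' = d" "nv \<sigma> ''root'' = root"
    "nv \<sigma> ''K'' = K" "na \<sigma> ''Gamma'' = Gt" "ra \<sigma> ''A'' = Am" "ra \<sigma> ''x'' = xm" "ra \<sigma> ''W'' = (\<lambda>_. 0)"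
    using st by (simp_all add: start_def)
  \<comment> \<open>Parameters not yet assigned are \<open>0\<close>, so the bound on all parameters
    holds from the start.\<close>
  have z0: "nv \<sigma> ''n'' = 0" "nv \<sigma> ''N'' = 0" "nv \<sigma> ''Q'' = 0" "nv \<sigma> ''QQ'' = 0" "nv \<sigma> ''q2'' = 0" "nv \<sigma> ''T'' = 0" "nv \<sigma> ''H1'' = 0"
    using zero by (simp_all add: params_def)
  define s1 where "s1 = bind_nv \<sigma> ''H1'' H1"
  have l1: "nv s1 = (nv \<sigma>)(''H1'' := H1)" "na s1 = na \<sigma>" "ra s1 = ra \<sigma>" by (simp_all add: s1_def)
  have e1: "psem (SetN ''H1'' (NPlus (NV ''H'') (NC 2))) \<sigma> = s1"
    using in0 by (simp add: s1_def H1_def)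
  obtain A2 where A2: "psem c_pw s1 = s1\<lparr>na := (na s1)(''pw'' := A2)\<rparr>" "\<forall>k<H1. A2 k = 2 ^ k"
    using step_pw[of s1] by (auto simp: s1_def)
  define s2 where "s2 = s1\<lparr>na := (na s1)(''pw'' := A2)\<rparr>"
  have l2: "nv s2 = nv s1" "na s2 = (na s1)(''pw'' := A2)" "ra s2 = ra s1" by (simp_all add: s2_def)
  define s3 where "s3 = bind_nv s2 ''n'' n"
  have l3: "nv s3 = (nv s2)(''n'' := n)" "na s3 = na s2" "ra s3 = ra s2" by (simp_all add: s3_def)
  have e3: "psem (SetN ''n'' (NLd ''pw'' (NV ''H''))) s2 = s3"
    using in0 A2(2) by (simp add: s3_def l2 l1 n_def H1_def)
  define s4 where "s4 = bind_nv s3 ''N'' (2 * n)"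
  have l4: "nv s4 = (nv s3)(''N'' := (2 * n))" "na s4 = na s3" "ra s4 = ra s3" by (simp_all add: s4_def)
  have e4: "psem (SetN ''N'' (NPlus (NV ''n'') (NV ''n''))) s3 = s4"
    by (simp add: s4_def l3 mult_2)
  define s5 where "s5 = bind_nv s4 ''h'' h"
  have l5: "nv s5 = (nv s4)(''h'' := h)" "na s5 = na s4" "ra s5 = ra s4" by (simp_all add: s5_def)
  have e5: "psem c_h s4 = s5"
    unfolding s5_def using in0 by (intro step_h) (simp_all add: l4 l3 l2 l1)
  obtain A6 where A6: "psem c_pq s5 = s5\<lparr>na := (na s5)(''pq'' := A6)\<rparr>" "\<forall>k<H1. A6 k = q ^ k"
    using step_pq[of s5] in0 by (auto simp: l5 l4 l3 l2 l1)
  define s6 where "s6 = s5\<lparr>na := (na s5)(''pq'' := A6)\<rparr>"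
  have l6: "nv s6 = nv s5" "na s6 = (na s5)(''pq'' := A6)" "ra s6 = ra s5" by (simp_all add: s6_def)
  define s7 where "s7 = bind_nv s6 ''ct'' (cuts h H)"
  have l7: "nv s7 = (nv s6)(''ct'' := (cuts h H))" "na s7 = na s6" "ra s7 = ra s6" by (simp_all add: s7_def)
  have e7: "psem c_ct s6 = s7"
    unfolding s7_def using in0 by (intro step_ct) (simp_all add: l6 l5 l4 l3 l2 l1)
  define s8 where "s8 = bind_nv s7 ''Q'' Q"
  have l8: "nv s8 = (nv s7)(''Q'' := Q)" "na s8 = na s7" "ra s8 = ra s7" by (simp_all add: s8_def)
  have "cuts h H + 1 < H1" using cuts_le[of H] by (simp add: H1_def)
  then have e8: "psem (SetN ''Q'' (NLd ''pq'' (NPlus (NV ''ct'') (NC 1)))) s7 = s8"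
    using A6(2) by (simp add: s8_def l7 l6 Q_def)
  define s9 where "s9 = bind_nv s8 ''q2'' (q * q)"
  have l9: "nv s9 = (nv s8)(''q2'' := (q * q))" "na s9 = na s8" "ra s9 = ra s8" by (simp_all add: s9_def)
  have e9: "psem (SetN ''q2'' (Mul (NV ''q'') ''q'')) s8 = s9"
    using in0 by (simp add: Mul_def s9_def l8 l7 l6 l5 l4 l3 l2 l1)
  define s10 where "s10 = bind_nv s9 ''QQ'' (Q * q)"
  have l10: "nv s10 = (nv s9)(''QQ'' := (Q * q))" "na s10 = na s9" "ra s10 = ra s9" by (simp_all add: s10_def)
  have e10: "psem (SetN ''QQ'' (Mul (NV ''q'') ''Q'')) s9 = s10"
    using in0 by (simp add: Mul_def s10_def l9 l8 l7 l6 l5 l4 l3 l2 l1)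
  define s11 where "s11 = bind_nv s10 ''B'' B"
  have l11: "nv s11 = (nv s10)(''B'' := B)" "na s11 = na s10" "ra s11 = ra s10" by (simp_all add: s11_def)
  have "B = m + 1 + (m + 1) + (m + 1 + (m + 1))" by (simp add: B_def)
  then have e11: "psem (SetN ''B'' (four_times (NPlus (NV ''m'') (NC 1)))) s10 = s11"
    using in0 by (simp add: four_times_def s11_def l10 l9 l8 l7 l6 l5 l4 l3 l2 l1)
  have nv11: "nv s11 ''m'' = m" "nv s11 ''N'' = 2 * n" "nv s11 ''Q'' = Q" "nv s11 ''B'' = B"
    using in0 by (simp_all add: l11 l10 l9 l8 l7 l6 l5 l4 l3 l2 l1)
  define s12 where "s12 = bind_nv s11 ''th'' theta"
  have l12: "nv s12 = (nv s11)(''th'' := theta)" "na s12 = na s11" "ra s12 = ra s11" by (simp_all add: s12_def)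
  \<comment> \<open>The factor \<open>m + 1\<close> is not a parameter; \<open>B * (m + 1)\<close>
    is computed as \<open>m * B + B\<close>.\<close>
  have "theta = Q * (2 * n * (2 * n * (2 * n * (2 * n * (m * B + B)))))"
    by (simp add: theta_def power4_eq_xxxx algebra_simps)
  then have e12: "psem (SetN ''th'' (Mul (Mul (Mul (Mul (Mul (NPlus (Mul (NV ''B'') ''m'') (NV ''B'')) ''N'') ''N'') ''N'') ''N'') ''Q'')) s11 = s12"
    using nv11 by (simp add: Mul_def s12_def)
  define s13 where "s13 = bind_nv s12 ''T'' T"
  have l13: "nv s13 = (nv s12)(''T'' := T)" "na s13 = na s12" "ra s13 = ra s12" by (simp_all add: s13_def)
  \<comment> \<open>Likewise \<open>B\<close> is not a parameter and its definition is
    expanded.\<close>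
  have "T = Q * (2 * n * ((m * theta + theta + (m * theta + theta)) + (m * theta + theta + (m * theta + theta))))"
    by (simp add: T_def B_def algebra_simps)
  then have e13: "psem (SetN ''T'' (Mul (Mul (four_times (NPlus (Mul (NV ''th'') ''m'') (NV ''th''))) ''N'') ''Q'')) s12 = s13"
    using nv11 by (simp add: Mul_def four_times_def s13_def l12)
  have nv13: "nv s13 ''H'' = H" "nv s13 ''q'' = q" "nv s13 ''m'' = m" "nv s13 ''d'' = d" "nv s13 ''root'' = root" "nv s13 ''n'' = n"
    "nv s13 ''N'' = 2 * n" "nv s13 ''Q'' = Q" "nv s13 ''q2'' = q * q" "nv s13 ''QQ'' = Q * q" "nv s13 ''H1'' = H1" "nv s13 ''B'' = B"
    "nv s13 ''th'' = theta" "nv s13 ''T'' = T" "nv s13 ''h'' = h" "nv s13 ''ct'' = cuts h H"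
    using in0 by (simp_all add: l13 l12 l11 l10 l9 l8 l7 l6 l5 l4 l3 l2 l1)
  have arr13: "\<forall>k<H1. na s13 ''pw'' k = 2 ^ k" "na s13 ''Gamma'' = Gt" "ra s13 ''A'' = Am" "ra s13 ''x'' = xm" "ra s13 ''W'' = (\<lambda>_. 0)"
    using in0 A2(2) by (simp_all add: l13 l12 l11 l10 l9 l8 l7 l6 l5 l4 l3 l2 l1)
  obtain A14 where A14: "psem c_dv s13 = s13\<lparr>na := (na s13)(''dv'' := A14)\<rparr>" "\<forall>x<Q * q. A14 x = x div q"
    using step_dv[of s13] nv13 by auto
  define s14 where "s14 = s13\<lparr>na := (na s13)(''dv'' := A14)\<rparr>"
  have l14: "nv s14 = nv s13" "na s14 = (na s13)(''dv'' := A14)" "ra s14 = ra s13" by (simp_all add: s14_def)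
  obtain A15 where A15: "psem c_md s14 = s14\<lparr>na := (na s14)(''md'' := A15)\<rparr>" "\<forall>x<Q * q. A15 x = x mod q"
    using step_md[of s14] nv13 A14(2) by (auto simp: s14_def)
  define s15 where "s15 = s14\<lparr>na := (na s14)(''md'' := A15)\<rparr>"
  have l15: "nv s15 = nv s14" "na s15 = (na s14)(''md'' := A15)" "ra s15 = ra s14" by (simp_all add: s15_def)
  obtain A16 where A16: "psem c_par s15 = s15\<lparr>na := (na s15)(''par'' := A16)\<rparr>" "\<forall>v<2 * n. A16 v = v div 2"
    using step_par[of s15] nv13 by (auto simp: l15 l14)
  define s16 where "s16 = s15\<lparr>na := (na s15)(''par'' := A16)\<rparr>"
  have l16: "nv s16 = nv s15" "na s16 = (na s15)(''par'' := A16)" "ra s16 = ra s15" by (simp_all add: s16_def)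
  obtain A17 where A17: "psem c_cu s16 = s16\<lparr>na := (na s16)(''cu'' := A17)\<rparr>" "\<forall>v<2 * n. A17 v = (if cut v then 1 else 0)"
    using step_cu[of s16] nv13 arr13 by (auto simp: l16 l15 l14)
  define s17 where "s17 = s16\<lparr>na := (na s16)(''cu'' := A17)\<rparr>"
  have l17: "nv s17 = nv s16" "na s17 = (na s16)(''cu'' := A17)" "ra s17 = ra s16" by (simp_all add: s17_def)
  obtain A18 where A18: "psem c_a s17 = s17\<lparr>ra := (ra s17)(''a'' := A18)\<rparr>" "\<forall>l<q. \<forall>i<m. A18 (m * l + i) = a l i"
    using step_a[of s17] nv13 arr13 by (auto simp: l17 l16 l15 l14)
  define s18 where "s18 = s17\<lparr>ra := (ra s17)(''a'' := A18)\<rparr>"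
  have l18: "nv s18 = nv s17" "na s18 = na s17" "ra s18 = (ra s17)(''a'' := A18)" by (simp_all add: s18_def)
  obtain A19 where A19: "psem c_ex s18 = s18\<lparr>ra := (ra s18)(''ex'' := A19)\<rparr>" "\<forall>l<q. A19 l = excess l"
    using step_ex[of s18] nv13 A18(2) by (auto simp: l18 l17 l16 l15 l14)
  define s19 where "s19 = s18\<lparr>ra := (ra s18)(''ex'' := A19)\<rparr>"
  have l19: "nv s19 = nv s18" "na s19 = na s18" "ra s19 = (ra s18)(''ex'' := A19)" by (simp_all add: s19_def)
  have fold: "fold psem c_pre \<sigma> = s19"
    unfolding c_pre_def
    by (simp only: fold.simps comp_apply id_apply e1 A2(1) s2_def[symmetric] e3 e4 e5 A6(1) s6_def[symmetric] e7 e8 e9 e10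
        e11 e12 e13 A14(1) s14_def[symmetric] A15(1) s15_def[symmetric] A16(1) s16_def[symmetric] A17(1) s17_def[symmetric] A18(1) s18_def[symmetric] A19(1) s19_def[symmetric])
  have "static s19"
    using nv13 arr13 A14(2) A15(2) A16(2) A17(2) A18(2) A19(2)
    by (simp add: static_def sizes_def l19 l18 l17 l16 l15 l14)
  moreover have "ra s19 ''W'' = (\<lambda>_. 0)" using arr13 by (simp add: l19 l18 l17 l16 l15 l14)
  moreover have "bounded_run size_bound c_pre \<sigma>"
  proof -
    have b13: "bounded size_bound s13"
      using nv13 by (auto simp: bounded_def params_def size_bound_def H1_def)
    have b0: "bounded size_bound \<sigma>" using in0 z0 by (auto simp: bounded_def params_def size_bound_def)
    have step: "bounded size_bound (bind_nv \<tau> x k)" if "bounded size_bound \<tau>" "x \<in> params \<longrightarrow> k \<le> size_bound" for \<tau> x k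
      using that by (auto simp: bounded_def)
    have b1: "bounded size_bound s1" unfolding s1_def by (rule step[OF b0]) (simp add: params_def size_bound_def H1_def)
    have b2: "bounded size_bound s2" using b1 by (simp add: s2_def bounded_def)
    have b3: "bounded size_bound s3" unfolding s3_def by (rule step[OF b2]) (simp add: params_def size_bound_def H1_def)
    have b4: "bounded size_bound s4" unfolding s4_def by (rule step[OF b3]) (simp add: params_def size_bound_def H1_def)
    have b5: "bounded size_bound s5" unfolding s5_def by (rule step[OF b4]) (simp add: params_def size_bound_def H1_def)
    have b6: "bounded size_bound s6" using b5 by (simp add: s6_def bounded_def)
    have b7: "bounded size_bound s7" unfolding s7_def by (rule step[OF b6]) (simp add: params_def size_bound_def H1_def)
    have b8: "bounded size_bound s8" unfolding s8_def by (rule step[OF b7]) (simp add: params_def size_bound_def H1_def)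
    have b9: "bounded size_bound s9" unfolding s9_def by (rule step[OF b8]) (simp add: params_def size_bound_def H1_def)
    have b10: "bounded size_bound s10" unfolding s10_def by (rule step[OF b9]) (simp add: params_def size_bound_def H1_def)
    have b11: "bounded size_bound s11" unfolding s11_def by (rule step[OF b10]) (simp add: params_def size_bound_def H1_def)
    have b12: "bounded size_bound s12" unfolding s12_def by (rule step[OF b11]) (simp add: params_def size_bound_def H1_def)
    have b: "bounded size_bound s14" "bounded size_bound s15" "bounded size_bound s16" "bounded size_bound s17" "bounded size_bound s18"
      using b13 by (simp_all add: bounded_def l18 l17 l16 l15 l14)
    show ?thesis unfolding c_pre_def
      by (simp only: bounded_run.simps e1 A2(1) s2_def[symmetric] e3 e4 e5 A6(1) s6_def[symmetric] e7 e8 e9 e10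
        e11 e12 e13 A14(1) s14_def[symmetric] A15(1) s15_def[symmetric] A16(1) s16_def[symmetric] A17(1) s17_def[symmetric] A18(1) s18_def[symmetric] A19(1) s19_def[symmetric]
        b0 b1 b2 b3 b4 b5 b6 b7 b8 b9 b10 b11 b12 b13 b simp_thms)
  qed
  ultimately show ?thesis unfolding fold by blast
qed

end

section \<open>The program: best responses and rounding\<close>

text \<open>
  Tables defined by recursion from the leaves are stored in reverse order of the vertices, so that
  they are filled from left to right.
\<close>

definition mirror :: "nexp \<Rightarrow> nexp" where "mirror v = NMinus (NMinus (NV ''N'') (NC 1)) v"

definition left_e :: "nexp \<Rightarrow> nexp" where "left_e v = NPlus v v"
definition right_e :: "nexp \<Rightarrow> nexp" where "right_e v = NPlus (NPlus v v) (NC 1)"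

definition hist_e :: "nexp \<Rightarrow> nexp \<Rightarrow> nexp" where
  "hist_e v y = NIf (BN (NC 0) (NLd ''cu'' v)) y (NLd ''dv'' y)"

definition child_e :: "nexp \<Rightarrow> nexp \<Rightarrow> nexp \<Rightarrow> nexp" where
  "child_e v y l = NIf (BN (NPlus (Mul (hist_e v y) ''q'') l) (NV ''Q'')) (NPlus (Mul (hist_e v y) ''q'') l) (NC 0)"

definition big_e :: rexp where
  "big_e = RBin ROAdd (RBin ROMul (RBin ROMul (ROf (NV ''n'')) (ROf (NV ''m''))) (ROf (NV ''th''))) (ROf (NC 1))"

definition cell3 :: "name \<Rightarrow> nexp \<Rightarrow> nexp \<Rightarrow> nexp \<Rightarrow> rexp" where
  "cell3 A v i y = RLd A (NPlus (Mul (NPlus (Mul v ''m'') i) ''Q'') y)"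

definition cell2 :: "name \<Rightarrow> nexp \<Rightarrow> nexp \<Rightarrow> rexp" where
  "cell2 A v y = RLd A (NPlus (Mul v ''Q'') y)"

text \<open>One layer per round: the rounding consults all solutions, and new weights are written
  without touching the layer they are computed from.\<close>

definition at_time :: "nexp \<Rightarrow> nexp \<Rightarrow> nexp" where
  "at_time t v = NPlus (Mul t ''N'') v"

definition node_e :: "nexp \<Rightarrow> nexp \<Rightarrow> nexp \<Rightarrow> rexp" where
  "node_e v y p = RBin ROSub
     (RBin ROAdd
       (RBin ROAdd
         (cell2 ''dp'' (mirror (left_e v)) (child_e v y (NLd ''dv'' p)))
         (cell2 ''dp'' (mirror (right_e v)) (child_e v y (NLd ''md'' p))))
       (RBin ROMul big_e
         (RIf (BN (NC 0) (NLd ''Gamma'' (NPlus (Mul (NLd ''md'' y) ''q2'') p))) (ROf (NC 0)) (ROf (NC 1)))))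
     (RIf (BN (NC 0) (NLd ''cu'' v))
       (RAgg ROAdd ''i'' ''m'' (ROf (NC 0)) (cell3 ''W'' (at_time (NV ''t'') v) (NV ''i'') y))
       (ROf (NC 0)))"

definition choice_e :: "nexp \<Rightarrow> nexp \<Rightarrow> nexp" where
  "choice_e v y = NArg ''p'' ''q2'' (node_e v y (NV ''p''))"

definition inner :: "nexp \<Rightarrow> rexp \<Rightarrow> rexp \<Rightarrow> rexp" where
  "inner v a b = RIf (BN (NC 0) v) (RIf (BN v (NV ''n'')) a b) b"

text \<open>A recursion from the root: the row of the parent already lies to the left, so the
  vertices are not reversed.\<close>

definition c_acc :: cmd where
  "c_acc = For ''v'' ''N'' (For ''i'' ''m'' (For ''y'' ''Q'' (StR ''acc''
     (NPlus (Mul (NPlus (Mul (NV ''v'') ''m'') (NV ''i'')) ''Q'') (NV ''y''))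
     (RIf (BN (NV ''v'') (NC 2)) (ROf (NC 0))
       (RIf (BN (NC 0) (NLd ''cu'' (NLd ''par'' (NV ''v''))))
         (RBin ROAdd (cell3 ''acc'' (NLd ''par'' (NV ''v'')) (NV ''i'') (NLd ''dv'' (NV ''y'')))
           (cell3 ''W'' (at_time (NV ''t'') (NLd ''par'' (NV ''v''))) (NV ''i'') (NV ''y'')))
         (cell3 ''acc'' (NLd ''par'' (NV ''v'')) (NV ''i'') (NV ''y'')))))))"

definition c_dp :: cmd where
  "c_dp = For ''u'' ''N'' (For ''y'' ''Q'' (StR ''dp'' (NPlus (Mul (NV ''u'') ''Q'') (NV ''y''))
     (inner (mirror (NV ''u''))
       (node_e (mirror (NV ''u'')) (NV ''y'') (choice_e (mirror (NV ''u'')) (NV ''y'')))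
       (RBin ROAdd
         (RAgg ROAdd ''i'' ''m'' (ROf (NC 0))
           (RBin ROMul (cell3 ''acc'' (mirror (NV ''u'')) (NV ''i'') (NLd ''dv'' (NV ''y'')))
             (RLd ''a'' (NPlus (Mul (NLd ''md'' (NV ''y'')) ''m'') (NV ''i'')))))
         (RBin ROMul big_e (RLd ''ex'' (NLd ''md'' (NV ''y''))))))))"

definition par_e :: nexp where "par_e = NLd ''par'' (NV ''v'')"
definition psol_e :: nexp where "psol_e = NLd ''L'' (at_time (NV ''t'') par_e)"

text \<open>Minimisers are recomputed while walking down instead of being stored for every
  code.\<close>

definition c_sol :: cmd where
  "c_sol = For ''v'' ''N'' (StN ''L'' (at_time (NV ''t'') (NV ''v''))
     (NIf (BN (NV ''v'') (NC 2)) (NV ''root'')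
       (NPlus (Mul (hist_e par_e psol_e) ''q'')
         (NEq (left_e par_e) (NV ''v'') (NLd ''dv'' (choice_e par_e psol_e)) (NLd ''md'' (choice_e par_e psol_e))))))"

definition c_ld :: cmd where
  "c_ld = For ''u'' ''N'' (For ''i'' ''m'' (StR ''ld'' (NPlus (Mul (NV ''u'') ''m'') (NV ''i''))
     (inner (mirror (NV ''u''))
       (RBin ROAdd (RLd ''ld'' (NPlus (Mul (mirror (left_e (mirror (NV ''u'')))) ''m'') (NV ''i'')))
         (RLd ''ld'' (NPlus (Mul (mirror (right_e (mirror (NV ''u'')))) ''m'') (NV ''i''))))
       (RLd ''a'' (NPlus (Mul (NLd ''md'' (NLd ''L'' (at_time (NV ''t'') (mirror (NV ''u''))))) ''m'') (NV ''i''))))))"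

definition new_weight_e :: rexp where
  "new_weight_e = RBin ROAdd (cell3 ''W'' (at_time (NV ''t'') (NV ''v'')) (NV ''i'') (NV ''y''))
     (REq (NLd ''L'' (at_time (NV ''t'') (NV ''v''))) (NV ''y'')
       (RBin ROSub (RLd ''ld'' (NPlus (Mul (mirror (NV ''v'')) ''m'') (NV ''i''))) (ROf (NC 1)))
       (ROf (NC 0)))"

definition c_W :: cmd where
  "c_W = For ''v'' ''N'' (For ''i'' ''m'' (For ''y'' ''Q'' (StR ''W''
     (NPlus (Mul (NPlus (Mul (at_time (NPlus (NV ''t'') (NC 1)) (NV ''v'')) ''m'') (NV ''i'')) ''Q'') (NV ''y''))
     (RIf (BR (ROf (NC 0)) new_weight_e) new_weight_e (ROf (NC 0))))))"

definition c_rounds :: cmd where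
  "c_rounds = For ''t'' ''T'' (CSeq c_acc (CSeq c_dp (CSeq c_sol (CSeq c_ld c_W))))"

definition sol_e :: "nexp \<Rightarrow> nexp" where "sol_e v = NLd ''L'' (at_time (NV ''t'') v)"

definition count_e :: "nexp \<Rightarrow> nexp \<Rightarrow> nexp" where
  "count_e v y = NSum ''t'' ''T'' (NEq (sol_e v) y (NC 1) (NC 0))"

definition class_mean :: "nexp \<Rightarrow> nexp \<Rightarrow> rexp \<Rightarrow> rexp" where
  "class_mean v y e = RBin RODiv
     (RAgg ROAdd ''t'' ''T'' (ROf (NC 0)) (REq (sol_e v) y e (ROf (NC 0)))) (ROf (count_e v y))"

definition s_e :: rexp where
  "s_e = RBin RODiv (ROf (NC 1)) (RBin ROMul (RBin ROMul (ROf (NC 16)) (ROf (NLd ''pw'' (NV ''h''))))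
     (ROf (NPlus (NV ''ct'') (NC 1))))"

definition F_e :: "nexp \<Rightarrow> nexp \<Rightarrow> nexp \<Rightarrow> rexp" where "F_e v i y = cell3 ''F'' (mirror v) i y"
definition R_e :: "nexp \<Rightarrow> nexp \<Rightarrow> rexp" where "R_e v y = cell2 ''R'' (mirror v) y"

definition c_F :: cmd where
  "c_F = For ''u'' ''N'' (For ''i'' ''m'' (For ''y'' ''Q'' (StR ''F''
     (NPlus (Mul (NPlus (Mul (NV ''u'') ''m'') (NV ''i'')) ''Q'') (NV ''y''))
     (inner (mirror (NV ''u''))
       (RIf (BN (count_e (mirror (NV ''u'')) (NV ''y'')) (NV ''th'')) (ROf (NC 1))
         (class_mean (mirror (NV ''u'')) (NV ''y'')
           (RBin ROMul (F_e (left_e (mirror (NV ''u''))) (NV ''i'') (sol_e (left_e (mirror (NV ''u'')))))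
             (F_e (right_e (mirror (NV ''u''))) (NV ''i'') (sol_e (right_e (mirror (NV ''u''))))))))
       (RBin ROAdd (ROf (NC 1)) (RBin ROMul s_e (RLd ''a'' (NPlus (Mul (NLd ''md'' (NV ''y'')) ''m'') (NV ''i'')))))))))"

definition c_R :: cmd where
  "c_R = For ''u'' ''N'' (For ''y'' ''Q'' (StR ''R'' (NPlus (Mul (NV ''u'') ''Q'') (NV ''y''))
     (inner (mirror (NV ''u''))
       (RIf (BN (count_e (mirror (NV ''u'')) (NV ''y'')) (NV ''th'')) (ROf (NC 1))
         (class_mean (mirror (NV ''u'')) (NV ''y'')
           (RBin ROAdd (R_e (left_e (mirror (NV ''u''))) (sol_e (left_e (mirror (NV ''u'')))))
             (R_e (right_e (mirror (NV ''u''))) (sol_e (right_e (mirror (NV ''u''))))))))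
       (ROf (NC 0)))))"

definition out_e :: "nexp \<Rightarrow> nexp" where
  "out_e w = NIf (BN w (NC 2)) (NV ''root'') (NLd ''L'' (at_time (NLd ''pick'' (NLd ''par'' w)) w))"

definition objective_e :: rexp where
  "objective_e = REq (sol_e (NV ''v'')) (out_e (NV ''v''))
     (RBin ROAdd
       (RAgg ROAdd ''i'' ''m'' (ROf (NC 0))
         (RBin ROMul
           (RAgg ROMul ''w'' ''N'' (ROf (NC 1))
             (RIf (BN (NV ''v'') (NV ''w''))
               (RIf (BN (NV ''w'') (left_e (NV ''v''))) (F_e (NV ''w'') (NV ''i'') (out_e (NV ''w''))) (ROf (NC 1)))
               (ROf (NC 1))))
           (RBin ROMul (F_e (left_e (NV ''v'')) (NV ''i'') (sol_e (left_e (NV ''v''))))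
             (F_e (right_e (NV ''v'')) (NV ''i'') (sol_e (right_e (NV ''v'')))))))
       (RBin ROMul (ROf (NV ''B''))
         (RBin ROAdd (R_e (left_e (NV ''v'')) (sol_e (left_e (NV ''v''))))
           (R_e (right_e (NV ''v'')) (sol_e (right_e (NV ''v'')))))))
     (ROf (NV ''B''))"

definition c_pick :: cmd where
  "c_pick = For ''v'' ''n'' (StN ''pick'' (NV ''v'') (NArg ''t'' ''T'' objective_e))"

definition c_label :: cmd where
  "c_label = For ''v'' ''N'' (StN ''label'' (NV ''v'') (NLd ''md'' (out_e (NV ''v''))))"

definition c_main :: "cmd list" where "c_main = [c_rounds, c_F, c_R, c_pick, c_label]"

lemma wf_main: "list_all wf_c c_main"
  by (simp add: c_main_def c_rounds_def c_acc_def c_dp_def c_sol_def c_ld_def c_W_def c_F_def c_R_def c_pick_def c_label_def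
      mirror_def left_e_def right_e_def hist_e_def child_e_def big_e_def cell3_def cell2_def at_time_def node_e_def choice_e_def
      inner_def par_e_def psol_e_def new_weight_e_def sol_e_def count_e_def class_mean_def s_e_def F_e_def R_e_def out_e_def
      objective_e_def counter_def user_name_def params_def)

lemma set_vars_main: "c \<in> set c_main \<Longrightarrow> set_vars c = {}"
  by (auto simp: c_main_def c_rounds_def c_acc_def c_dp_def c_sol_def c_ld_def c_W_def c_F_def c_R_def c_pick_def c_label_def)

text \<open>Hygiene: \<open>node_e\<close> and \<open>choice_e\<close> place the expressions for
  vertex and code under binders of \<open>''z''\<close>, \<open>''i''\<close> and
  \<open>''p''\<close>, and this condition rules out capture.\<close>

definition stable :: "nexp \<Rightarrow> env \<Rightarrow> bool" where
  "stable e \<tau> \<longleftrightarrow> (\<forall>f. (\<forall>x. x \<notin> {''z'', ''i'', ''p''} \<longrightarrow> f x = nv \<tau> x) \<longrightarrow> nval e (\<tau>\<lparr>nv := f\<rparr>) = nval e \<tau>)"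

lemma stableD:
  assumes "stable e \<tau>"
  shows "nval e (\<tau>\<lparr>nv := (nv \<tau>)(''z'' := k)\<rparr>) = nval e \<tau>" "nval e (\<tau>\<lparr>nv := (nv \<tau>)(''i'' := k)\<rparr>) = nval e \<tau>"
    "nval e (\<tau>\<lparr>nv := (nv \<tau>)(''i'' := k, ''z'' := k')\<rparr>) = nval e \<tau>" "nval e (\<tau>\<lparr>nv := (nv \<tau>)(''p'' := k)\<rparr>) = nval e \<tau>"
  using assms unfolding stable_def by simp_all

lemma stable_bind_p: "stable e \<tau> \<Longrightarrow> stable e (\<tau>\<lparr>nv := (nv \<tau>)(''p'' := k)\<rparr>)"
  unfolding stable_def by simp

section \<open>Evaluation of the best-response rounds\<close>

context instance_tables
begin

lemma staticD:
  assumes "static \<tau>"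
  shows "nv \<tau> ''H'' = H" "nv \<tau> ''q'' = q" "nv \<tau> ''m'' = m" "nv \<tau> ''d'' = d" "nv \<tau> ''root'' = root" "nv \<tau> ''n'' = n"
    "nv \<tau> ''N'' = 2 * n" "nv \<tau> ''Q'' = Q" "nv \<tau> ''q2'' = q * q" "nv \<tau> ''QQ'' = Q * q" "nv \<tau> ''H1'' = H1" "nv \<tau> ''B'' = B"
    "nv \<tau> ''th'' = theta" "nv \<tau> ''T'' = T" "nv \<tau> ''h'' = h" "nv \<tau> ''ct'' = cuts h H"
    "\<And>k. k < H1 \<Longrightarrow> na \<tau> ''pw'' k = 2 ^ k" "\<And>x. x < Q * q \<Longrightarrow> na \<tau> ''dv'' x = x div q" "\<And>x. x < Q * q \<Longrightarrow> na \<tau> ''md'' x = x mod q"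
    "\<And>v. v < 2 * n \<Longrightarrow> na \<tau> ''par'' v = v div 2" "\<And>v. v < 2 * n \<Longrightarrow> na \<tau> ''cu'' v = (if cut v then 1 else 0)"
    "na \<tau> ''Gamma'' = Gt" "\<And>l i. l < q \<Longrightarrow> i < m \<Longrightarrow> ra \<tau> ''a'' (m * l + i) = a l i" "\<And>l. l < q \<Longrightarrow> ra \<tau> ''ex'' l = excess l"
  using assms by (simp_all add: static_def sizes_def)

lemma static_upd_n: "''pw'' \<noteq> b \<Longrightarrow> ''dv'' \<noteq> b \<Longrightarrow> ''md'' \<noteq> b \<Longrightarrow> ''par'' \<noteq> b \<Longrightarrow> ''cu'' \<noteq> b \<Longrightarrow> ''Gamma'' \<noteq> b \<Longrightarrow>
    static (\<tau>\<lparr>na := (na \<tau>)(b := A)\<rparr>) = static \<tau>"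
  by (simp add: static_def sizes_def)

lemma static_upd_r: "''a'' \<noteq> b \<Longrightarrow> ''ex'' \<noteq> b \<Longrightarrow> static (\<tau>\<lparr>ra := (ra \<tau>)(b := A)\<rparr>) = static \<tau>"
  by (simp add: static_def sizes_def)

lemma static_cong:
  assumes "\<And>x. x \<in> params \<union> {''root'', ''B'', ''th'', ''h'', ''ct''} \<Longrightarrow> f x = nv \<tau> x"
  shows "static (\<tau>\<lparr>nv := f\<rparr>) = static \<tau>"
proof -
  have "f ''H'' = nv \<tau> ''H''" "f ''q'' = nv \<tau> ''q''" "f ''m'' = nv \<tau> ''m''" "f ''d'' = nv \<tau> ''d''" "f ''root'' = nv \<tau> ''root''"
    "f ''n'' = nv \<tau> ''n''" "f ''N'' = nv \<tau> ''N''" "f ''Q'' = nv \<tau> ''Q''" "f ''q2'' = nv \<tau> ''q2''" "f ''QQ'' = nv \<tau> ''QQ''"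
    "f ''H1'' = nv \<tau> ''H1''" "f ''B'' = nv \<tau> ''B''" "f ''th'' = nv \<tau> ''th''" "f ''T'' = nv \<tau> ''T''" "f ''h'' = nv \<tau> ''h''"
    "f ''ct'' = nv \<tau> ''ct''"
    by (rule assms; simp add: params_def)+
  then show ?thesis by (simp add: static_def sizes_def)
qed

lemma static_bind:
  assumes "x \<notin> params \<union> {''root'', ''B'', ''th'', ''h'', ''ct''}"
  shows "static (bind_nv \<tau> x k) = static \<tau>"
  using assms by (intro static_cong) auto

lemma q_le_Q: "q \<le> Q" using q_pos by (simp add: Q_def)

lemma less_Qq: "y < Q \<Longrightarrow> y < Q * q"
proof -
  assume "y < Q"
  moreover have "Q * 1 \<le> Q * q" using q_pos by (intro mult_le_mono2) simp
  ultimately show "y < Q * q" by linarith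
qed

lemma p_less_Qq: "p < q * q \<Longrightarrow> p < Q * q"
  by (rule less_le_trans[OF _ mult_le_mono1[OF q_le_Q]])

lemma node_value:
  assumes st: "static \<tau>" and t: "nv \<tau> ''t'' = t" and sv: "stable ve \<tau>" and sy: "stable ye \<tau>"
    and v: "nval ve \<tau> = v" "0 < v" "v < n" and y: "nval ye \<tau> = y" "y < Q" and p: "nval pe \<tau> = p" "p < q * q"
    and W: "\<And>i. i < m \<Longrightarrow> ra \<tau> ''W'' (Q * (m * (2 * n * t + v) + i) + y) = W v i y"
    and D1: "\<And>c. c < Q \<Longrightarrow> ra \<tau> ''dp'' (Q * (2 * n - 1 - 2 * v) + c) = DL c"
    and D2: "\<And>c. c < Q \<Longrightarrow> ra \<tau> ''dp'' (Q * (2 * n - 1 - (2 * v + 1)) + c) = DR c"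
  shows "rval (node_e ve ye pe) \<tau> = node_cost W big DL DR v y p"
proof -
  note S = staticD[OF st]
  note V = stableD[OF sv, unfolded v(1)] stableD[OF sy, unfolded y(1)]
  have lt: "v < 2 * n" "y < Q * q" "p < Q * q" "y mod q < q" "p div q < q" "p mod q < q"
    using v y p q_pos less_Qq p_less_Qq by (simp_all add: less_mult_imp_div_less)
  have hist: "nval (hist_e ve ye) \<tau> = hist v y" "\<And>k. nval (hist_e ve ye) (\<tau>\<lparr>nv := (nv \<tau>)(''z'' := k)\<rparr>) = hist v y"
    using lt by (simp_all add: hist_e_def hist_def S V v(1) y(1))
  have ch: "nval (child_e ve ye e) \<tau> = clamp (hist v y * q + nval e \<tau>)" for e
    by (simp add: child_e_def clamp_def Mul_def hist S mult.commute)
  have clamp: "clamp x < Q" for x using Q_pos by (simp add: clamp_def)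
  have big: "rval big_e \<tau> = big" by (simp add: big_e_def big_def S)
  have d1: "rval (cell2 ''dp'' (mirror (left_e ve)) (child_e ve ye (NLd ''dv'' pe))) \<tau> = DL (clamp (hist v y * q + p div q))"
    using D1[OF clamp] lt by (simp add: cell2_def mirror_def left_e_def Mul_def ch S V p(1) mult_2)
  have d2: "rval (cell2 ''dp'' (mirror (right_e ve)) (child_e ve ye (NLd ''md'' pe))) \<tau> = DR (clamp (hist v y * q + p mod q))"
    using D2[OF clamp] lt by (simp add: cell2_def mirror_def right_e_def Mul_def ch S V p(1) mult_2)
  have G: "rval (RIf (BN (NC 0) (NLd ''Gamma'' (NPlus (Mul (NLd ''md'' ye) ''q2'') pe))) (ROf (NC 0)) (ROf (NC 1))) \<tau> =
      viol (y mod q) (p div q) (p mod q)"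
    using lt Gt[OF lt(4) p(2)] by (simp add: Mul_def S V p(1) viol_def)
  have c: "rval (RIf (BN (NC 0) (NLd ''cu'' ve))
       (RAgg ROAdd ''i'' ''m'' (ROf (NC 0)) (cell3 ''W'' (at_time (NV ''t'') ve) (NV ''i'') ye)) (ROf (NC 0))) \<tau> = credit W v y"
    using lt W by (simp add: credit_def cell3_def at_time_def Mul_def aggr_plus S V v(1) y(1) t cong: sum.cong_simp)
  show ?thesis by (simp only: node_e_def rval.simps(2) rop_fun.simps d1 d2 G c big node_cost_def)
qed

lemma choice_value:
  assumes st: "static \<tau>" and t: "nv \<tau> ''t'' = t" and sv: "stable ve \<tau>" and sy: "stable ye \<tau>"
    and v: "nval ve \<tau> = v" "0 < v" "v < n" and y: "nval ye \<tau> = y" "y < Q"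
    and W: "\<And>i. i < m \<Longrightarrow> ra \<tau> ''W'' (Q * (m * (2 * n * t + v) + i) + y) = W v i y"
    and D1: "\<And>c. c < Q \<Longrightarrow> ra \<tau> ''dp'' (Q * (2 * n - 1 - 2 * v) + c) = dp W big (2 * v) c"
    and D2: "\<And>c. c < Q \<Longrightarrow> ra \<tau> ''dp'' (Q * (2 * n - 1 - (2 * v + 1)) + c) = dp W big (2 * v + 1) c"
  shows "nval (choice_e ve ye) \<tau> = choice W big v y"
proof -
  have "rval (node_e ve ye (NV ''p'')) (bind_nv \<tau> ''p'' p) = node_cost W big (dp W big (2 * v)) (dp W big (2 * v + 1)) v y p"
    if "p < q * q" for p
    using assms that stableD(4)[OF sv] stableD(4)[OF sy]
    by (intro node_value) (auto simp: static_bind params_def intro: stable_bind_p)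
  then have "argmin (\<lambda>p. rval (node_e ve ye (NV ''p'')) (bind_nv \<tau> ''p'' p)) (q * q) = choice W big v y"
    unfolding choice_def by (rule argmin_cong)
  then show ?thesis by (simp add: choice_e_def staticD[OF st])
qed

lemma step_acc:
  assumes st: "static \<sigma>" and t: "nv \<sigma> ''t'' = t"
    and W: "\<And>v i y. v < 2 * n \<Longrightarrow> i < m \<Longrightarrow> y < Q \<Longrightarrow> ra \<sigma> ''W'' (Q * (m * (2 * n * t + v) + i) + y) = W v i y"
  shows "\<exists>A. psem c_acc \<sigma> = \<sigma>\<lparr>ra := (ra \<sigma>)(''acc'' := A)\<rparr> \<and>
    (\<forall>v<2 * n. \<forall>i<m. \<forall>y<Q. A (Q * (m * v + i) + y) = acc W v i y)"
proof -
  note S = staticD[OF st]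
  have "\<exists>A. psem c_acc \<sigma> = \<sigma>\<lparr>ra := (ra \<sigma>)(''acc'' := A)\<rparr> \<and>
      (\<forall>v<nv \<sigma> ''N''. \<forall>i<nv \<sigma> ''m''. \<forall>y<nv \<sigma> ''Q''. A (0 + (nv \<sigma> ''Q'' * (nv \<sigma> ''m'' * v + i) + y)) = acc W v i y) \<and>
      (\<forall>z<0. A z = ra \<sigma> ''acc'' z)"
    unfolding c_acc_def
  proof (rule table_r3, goal_cases)
    case (4 v i y A)
    then have b: "v < 2 * n" "i < m" "y < Q" and A: "\<And>v' i' y'. v' < v \<Longrightarrow> i' < m \<Longrightarrow> y' < Q \<Longrightarrow> A (Q * (m * v' + i') + y') = acc W v' i' y'"
      using S by simp_all
    have "y div q < Q" "y < Q * q" using b(3) div_le_dividend[of y q] less_Qq by (linarith, blast)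
    moreover have "\<not> v < 2 \<Longrightarrow> v div 2 < v" "v div 2 < 2 * n" using b by auto
    moreover have "acc W v i y = (if v < 2 then 0 else if cut (v div 2) then acc W (v div 2) i (y div q) + W (v div 2) i y
        else acc W (v div 2) i y)" by (subst acc.simps) (simp add: numeral_2_eq_2 less_Suc_eq_le)
    ultimately show ?case
      using b A W[of "v div 2" i y]
      by (cases "v < 2"; cases "cut (v div 2)") (simp_all add: cell3_def at_time_def Mul_def S t)
  qed simp_all
  then show ?thesis using S by auto
qed

end

lemma rval_inner [simp]:
  "rval (inner v a b) \<tau> = (if 0 < nval v \<tau> \<and> nval v \<tau> < nv \<tau> ''n'' then rval a \<tau> else rval b \<tau>)"
  by (simp add: inner_def)

lemma nval_vertex [simp]:
  "nval (mirror e) \<tau> = nv \<tau> ''N'' - 1 - nval e \<tau>" "nval (left_e e) \<tau> = 2 * nval e \<tau>"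
  "nval (right_e e) \<tau> = 2 * nval e \<tau> + 1"
  by (simp_all add: mirror_def left_e_def right_e_def)

context instance_tables
begin

lemma static_fill_r:
  assumes "static \<sigma>" "''a'' \<noteq> b" "''ex'' \<noteq> b"
    and "\<And>x. x \<in> params \<union> {''root'', ''B'', ''th'', ''h'', ''ct''} \<Longrightarrow> f x = nv \<sigma> x"
  shows "static (\<sigma>\<lparr>nv := f, ra := (ra \<sigma>)(b := A)\<rparr>)"
  using static_upd_r[OF assms(2,3), of "\<sigma>\<lparr>nv := f\<rparr>" A] static_cong[OF assms(4)] assms(1) by simp

lemma static_fill_n:
  assumes "static \<sigma>" "''pw'' \<noteq> b" "''dv'' \<noteq> b" "''md'' \<noteq> b" "''par'' \<noteq> b" "''cu'' \<noteq> b" "''Gamma'' \<noteq> b"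
    and "\<And>x. x \<in> params \<union> {''root'', ''B'', ''th'', ''h'', ''ct''} \<Longrightarrow> f x = nv \<sigma> x"
  shows "static (\<sigma>\<lparr>nv := f, na := (na \<sigma>)(b := A)\<rparr>)"
  using static_upd_n[OF assms(2-7), of "\<sigma>\<lparr>nv := f\<rparr>" A] static_cong[OF assms(8)] assms(1) by simp

lemma dp_leaf': "\<not> (0 < v \<and> v < n) \<Longrightarrow> dp W b v y = leaf_cost W b v y"
  unfolding dp_def by (subst tree_rec_leaf) simp_all

lemma step_dp:
  assumes st: "static \<sigma>" and t: "nv \<sigma> ''t'' = t"
    and W: "\<And>v i y. v < 2 * n \<Longrightarrow> i < m \<Longrightarrow> y < Q \<Longrightarrow> ra \<sigma> ''W'' (Q * (m * (2 * n * t + v) + i) + y) = W v i y"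
    and acc: "\<And>v i y. v < 2 * n \<Longrightarrow> i < m \<Longrightarrow> y < Q \<Longrightarrow> ra \<sigma> ''acc'' (Q * (m * v + i) + y) = acc W v i y"
  shows "\<exists>A. psem c_dp \<sigma> = \<sigma>\<lparr>ra := (ra \<sigma>)(''dp'' := A)\<rparr> \<and>
    (\<forall>u<2 * n. \<forall>y<Q. A (Q * u + y) = dp W big (2 * n - 1 - u) y)"
proof -
  note S = staticD[OF st]
  have "\<exists>A. psem c_dp \<sigma> = \<sigma>\<lparr>ra := (ra \<sigma>)(''dp'' := A)\<rparr> \<and>
      (\<forall>u<nv \<sigma> ''N''. \<forall>y<nv \<sigma> ''Q''. A (0 + (nv \<sigma> ''Q'' * u + y)) = dp W big (2 * n - 1 - u) y) \<and>
      (\<forall>z<0. A z = ra \<sigma> ''dp'' z)"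
    unfolding c_dp_def
  proof (rule table_r2, goal_cases)
    case (2 u y A)
    then have b: "u < 2 * n" "y < Q" and A: "\<And>u' y'. u' < u \<Longrightarrow> y' < Q \<Longrightarrow> A (Q * u' + y') = dp W big (2 * n - 1 - u') y'"
      using S by simp_all
    define v where "v = 2 * n - 1 - u"
    have vS: "2 * n - Suc u = v" by (simp add: v_def)
    let ?\<tau> = "\<sigma>\<lparr>nv := (nv \<sigma>)(''u'' := u, ''y'' := y), ra := (ra \<sigma>)(''dp'' := A)\<rparr>"
    let ?v = "mirror (NV ''u'')" and ?y = "NV ''y''"
    have st': "static ?\<tau>" using st by (rule static_fill_r) (auto simp: params_def)
    note S' = staticD[OF st']
    have vv: "nval ?v ?\<tau> = v" by (simp add: v_def S)
    have v: "v < 2 * n" using b by (simp add: v_def)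
    have y': "y div q < Q" "y < Q * q" "y mod q < q"
      using b(2) le_less_trans[OF div_le_dividend b(2)] less_Qq q_pos by simp_all
    have idx: "nval (NPlus (Mul (NV ''u'') ''Q'') (NV ''y'')) ?\<tau> = 0 + (nv \<sigma> ''Q'' * u + y)"
      by (simp add: Mul_def)
    have big: "rval big_e ?\<tau> = big" by (simp add: big_e_def big_def S)
    show ?case
    proof (cases "0 < v \<and> v < n")
      case True
      \<comment> \<open>Both children have larger numbers, hence earlier rows in the reversed
        table.\<close>
      have u: "2 * n - 1 - 2 * v < u" "2 * n - 1 - (2 * v + 1) < u" "2 * n - 1 - (2 * n - 1 - 2 * v) = 2 * v"
        "2 * n - 1 - (2 * n - 1 - (2 * v + 1)) = 2 * v + 1" using True b by (auto simp: v_def)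
      have D1: "\<And>c. c < Q \<Longrightarrow> ra ?\<tau> ''dp'' (Q * (2 * n - 1 - 2 * v) + c) = dp W big (2 * v) c"
        using A[OF u(1)] unfolding u(3) by simp
      have D2: "\<And>c. c < Q \<Longrightarrow> ra ?\<tau> ''dp'' (Q * (2 * n - 1 - (2 * v + 1)) + c) = dp W big (2 * v + 1) c"
        using A[OF u(2)] unfolding u(4) by simp
      have sv: "stable ?v ?\<tau>" "stable ?y ?\<tau>" by (simp_all add: stable_def mirror_def)
      have Wv: "\<And>i. i < m \<Longrightarrow> ra ?\<tau> ''W'' (Q * (m * (2 * n * t + v) + i) + y) = W v i y" using W v b by simp
      have tt: "nv ?\<tau> ''t'' = t" using t by simp
      have yy: "nval ?y ?\<tau> = y" by simp
      have c: "nval (choice_e ?v ?y) ?\<tau> = choice W big v y"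
        using True b by (intro choice_value[OF st' tt sv vv _ _ yy _ Wv D1 D2]) simp_all
      have "rval (node_e ?v ?y (choice_e ?v ?y)) ?\<tau> = node_cost W big (dp W big (2 * v)) (dp W big (2 * v + 1)) v y (choice W big v y)"
        using True b choice_less by (intro node_value[where W = W and v = v and y = y and DL = "dp W big (2 * v)" and DR = "dp W big (2 * v + 1)",
                OF st' tt sv vv _ _ yy _ c _ Wv D1 D2]) simp_all
      then show ?thesis using True idx vv dp_node[of v W big y] by (simp only: rval_inner S' v_def[symmetric] if_True simp_thms)
    next
      \<comment> \<open>This covers the leaves and index \<open>0\<close>, where
        \<open>tree_rec\<close> takes its leaf branch too.\<close>
      case False
      have "rval (RBin ROAdd
         (RAgg ROAdd ''i'' ''m'' (ROf (NC 0))
           (RBin ROMul (cell3 ''acc'' ?v (NV ''i'') (NLd ''dv'' ?y))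
             (RLd ''a'' (NPlus (Mul (NLd ''md'' ?y) ''m'') (NV ''i'')))))
         (RBin ROMul big_e (RLd ''ex'' (NLd ''md'' ?y)))) ?\<tau> = leaf_cost W big v y"
        using y' v acc b by (simp add: leaf_cost_def aggr_plus cell3_def Mul_def S vS big cong: sum.cong_simp)
      then show ?thesis using False idx vv dp_leaf'[OF False] by (simp only: rval_inner S' v_def[symmetric] if_False simp_thms)
    qed
  qed simp_all
  then show ?thesis using S by auto
qed

lemma sol_small: "v \<le> 1 \<Longrightarrow> sol t v = root"
  unfolding sol_def by (subst best.simps) simp

lemma root_less_Q: "root < Q" using root q_le_Q by simp

lemma sol_less: "v < 2 * n \<Longrightarrow> sol t v < Q"
  using coded_bound[OF coded_sol, of v] sol_small[of v] root_less_Q by (cases "v = 0") auto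

lemma step_sol:
  assumes st: "static \<sigma>" and t: "nv \<sigma> ''t'' = t"
    and W: "\<And>v i y. v < 2 * n \<Longrightarrow> i < m \<Longrightarrow> y < Q \<Longrightarrow> ra \<sigma> ''W'' (Q * (m * (2 * n * t + v) + i) + y) = weight t v i y"
    and D: "\<And>u y. u < 2 * n \<Longrightarrow> y < Q \<Longrightarrow> ra \<sigma> ''dp'' (Q * u + y) = dp (weight t) big (2 * n - 1 - u) y"
  shows "\<exists>A. psem c_sol \<sigma> = \<sigma>\<lparr>na := (na \<sigma>)(''L'' := A)\<rparr> \<and>
    (\<forall>v<2 * n. A (2 * n * t + v) = sol t v) \<and> (\<forall>z<2 * n * t. A z = na \<sigma> ''L'' z)"
proof -
  note S = staticD[OF st]
  have "\<exists>A. psem c_sol \<sigma> = \<sigma>\<lparr>na := (na \<sigma>)(''L'' := A)\<rparr> \<and>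
      (\<forall>v<nv \<sigma> ''N''. A (2 * n * t + v) = sol t v) \<and> (\<forall>z<2 * n * t. A z = na \<sigma> ''L'' z)"
    unfolding c_sol_def
  proof (rule table_n1, goal_cases)
    case (1 v A)
    then have b: "v < 2 * n" and A: "\<And>v'. v' < v \<Longrightarrow> A (2 * n * t + v') = sol t v'" using S by simp_all
    let ?\<tau> = "\<sigma>\<lparr>nv := (nv \<sigma>)(''v'' := v), na := (na \<sigma>)(''L'' := A)\<rparr>"
    have st': "static ?\<tau>" using st by (rule static_fill_n) (auto simp: params_def)
    note S' = staticD[OF st']
    have idx: "nval (at_time (NV ''t'') (NV ''v'')) ?\<tau> = 2 * n * t + v" by (simp add: at_time_def Mul_def S t)
    show ?case
    proof (cases "v < 2")
      case True
      then show ?thesis using idx sol_small[of v t] by (simp add: S)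
    next
      case False
      define p where "p = v div 2"
      have p: "0 < p" "p < n" "p < v" "p < 2 * n" using False b by (auto simp: p_def)
      let ?y = "sol t p"
      have y: "?y < Q" "?y < Q * q" using sol_less[of p t] p less_Qq by simp_all
      have pe: "nval par_e ?\<tau> = p" by (simp add: par_e_def S b p_def)
      have ye: "nval psol_e ?\<tau> = ?y" using A[OF p(3)] by (simp add: psol_e_def par_e_def at_time_def Mul_def S b t p_def)
      have sv: "stable par_e ?\<tau>" "stable psol_e ?\<tau>" by (simp_all add: stable_def par_e_def psol_e_def at_time_def Mul_def)
      have u: "2 * n - 1 - 2 * p < 2 * n" "2 * n - 1 - (2 * p + 1) < 2 * n" "2 * n - 1 - (2 * n - 1 - 2 * p) = 2 * p"
        "2 * n - 1 - (2 * n - 1 - (2 * p + 1)) = 2 * p + 1" using p by auto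
      have D1: "\<And>c. c < Q \<Longrightarrow> ra ?\<tau> ''dp'' (Q * (2 * n - 1 - 2 * p) + c) = dp (weight t) big (2 * p) c"
        using D[OF u(1)] unfolding u(3) by simp
      have D2: "\<And>c. c < Q \<Longrightarrow> ra ?\<tau> ''dp'' (Q * (2 * n - 1 - (2 * p + 1)) + c) = dp (weight t) big (2 * p + 1) c"
        using D[OF u(2)] unfolding u(4) by simp
      have Wv: "\<And>i. i < m \<Longrightarrow> ra ?\<tau> ''W'' (Q * (m * (2 * n * t + p) + i) + ?y) = weight t p i ?y" using W p y by simp
      have tt: "nv ?\<tau> ''t'' = t" using t by simp
      let ?c = "choice (weight t) big p ?y"
      have c: "nval (choice_e par_e psol_e) ?\<tau> = ?c"
        using p y by (intro choice_value[OF st' tt sv pe _ _ ye _ Wv D1 D2]) simp_all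
      have cQ: "?c < Q * q" using choice_less p_less_Qq by blast
      note V = stableD[OF sv(1), unfolded pe] stableD[OF sv(2), unfolded ye]
      have hist: "nval (hist_e par_e psol_e) (bind_nv ?\<tau> ''z'' k) = hist p ?y" for k
        using y p V(1)[of k] V(5)[of k] by (simp add: hist_e_def hist_def S)
      have e: "sol t v = q * hist p ?y + (if even v then ?c div q else ?c mod q)"
        unfolding sol_def p_def using False by (subst best.simps) (simp add: Let_def mult.commute)
      have ev: "2 * p = v \<longleftrightarrow> even v" unfolding p_def by presburger
      have "nval (NPlus (Mul (hist_e par_e psol_e) ''q'')
          (NEq (left_e par_e) (NV ''v'') (NLd ''dv'' (choice_e par_e psol_e)) (NLd ''md'' (choice_e par_e psol_e)))) ?\<tau> = sol t v"
        using hist cQ by (simp add: Mul_def pe c e ev S)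
      then show ?thesis using False idx by (simp only: nval.simps bval.simps) simp
    qed
  qed
  then show ?thesis using S by auto
qed

lemma load_leaf': "\<not> (0 < v \<and> v < n) \<Longrightarrow> load L i v = a (L v mod q) i"
  unfolding load_def by (rule tree_rec_leaf)

lemma step_ld:
  assumes st: "static \<sigma>" and t: "nv \<sigma> ''t'' = t"
    and L: "\<And>v. v < 2 * n \<Longrightarrow> na \<sigma> ''L'' (2 * n * t + v) = sol t v"
  shows "\<exists>A. psem c_ld \<sigma> = \<sigma>\<lparr>ra := (ra \<sigma>)(''ld'' := A)\<rparr> \<and>
    (\<forall>u<2 * n. \<forall>i<m. A (m * u + i) = load (sol t) i (2 * n - 1 - u))"
proof -
  note S = staticD[OF st]
  have "\<exists>A. psem c_ld \<sigma> = \<sigma>\<lparr>ra := (ra \<sigma>)(''ld'' := A)\<rparr> \<and>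
      (\<forall>u<nv \<sigma> ''N''. \<forall>i<nv \<sigma> ''m''. A (0 + (nv \<sigma> ''m'' * u + i)) = load (sol t) i (2 * n - 1 - u)) \<and>
      (\<forall>z<0. A z = ra \<sigma> ''ld'' z)"
    unfolding c_ld_def
  proof (rule table_r2, goal_cases)
    case (2 u i A)
    then have b: "u < 2 * n" "i < m" and A: "\<And>u' i'. u' < u \<Longrightarrow> i' < m \<Longrightarrow> A (m * u' + i') = load (sol t) i' (2 * n - 1 - u')"
      using S by simp_all
    define v where "v = 2 * n - 1 - u"
    have vS: "2 * n - Suc u = v" by (simp add: v_def)
    have v: "v < 2 * n" using b by (simp add: v_def)
    have y: "sol t v < Q * q" using sol_less[OF v] less_Qq by blast
    show ?case
    proof (cases "0 < v \<and> v < n")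
      case True
      have u: "2 * n - 1 - 2 * v < u" "2 * n - 1 - (2 * v + 1) < u" "2 * n - 1 - (2 * n - 1 - 2 * v) = 2 * v"
        "2 * n - 1 - (2 * n - 1 - (2 * v + 1)) = 2 * v + 1" using True b by (auto simp: v_def)
      have "A (m * (2 * n - 1 - 2 * v) + i) = load (sol t) i (2 * v)" "A (m * (2 * n - 1 - (2 * v + 1)) + i) = load (sol t) i (2 * v + 1)"
        using A[OF u(1) b(2)] A[OF u(2) b(2)] unfolding u(3,4) by simp_all
      moreover have "load (sol t) i v = load (sol t) i (2 * v) + load (sol t) i (2 * v + 1)" using True by (intro load_node) auto
      ultimately show ?thesis using True unfolding v_def[symmetric]
        by (simp add: Mul_def S vS)
    next
      case False
      show ?thesis unfolding v_def[symmetric] load_leaf'[OF False]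
        using False L[OF v] y q_pos b by (cases "v = 0") (simp_all add: Mul_def at_time_def S vS t)
    qed
  qed simp_all
  then show ?thesis using S by auto
qed

lemma step_W:
  assumes st: "static \<sigma>" and t: "nv \<sigma> ''t'' = t"
    and W: "\<And>v i y. v < 2 * n \<Longrightarrow> i < m \<Longrightarrow> y < Q \<Longrightarrow> ra \<sigma> ''W'' (Q * (m * (2 * n * t + v) + i) + y) = weight t v i y"
    and L: "\<And>v. v < 2 * n \<Longrightarrow> na \<sigma> ''L'' (2 * n * t + v) = sol t v"
    and ld: "\<And>u i. u < 2 * n \<Longrightarrow> i < m \<Longrightarrow> ra \<sigma> ''ld'' (m * u + i) = load (sol t) i (2 * n - 1 - u)"
  shows "\<exists>A. psem c_W \<sigma> = \<sigma>\<lparr>ra := (ra \<sigma>)(''W'' := A)\<rparr> \<and>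
    (\<forall>v<2 * n. \<forall>i<m. \<forall>y<Q. A (Q * (m * (2 * n * Suc t + v) + i) + y) = weight (Suc t) v i y)"
proof -
  note S = staticD[OF st]
  let ?l = "Q * (m * (2 * n * Suc t))"
  have "\<exists>A. psem c_W \<sigma> = \<sigma>\<lparr>ra := (ra \<sigma>)(''W'' := A)\<rparr> \<and>
      (\<forall>v<nv \<sigma> ''N''. \<forall>i<nv \<sigma> ''m''. \<forall>y<nv \<sigma> ''Q''. A (?l + (nv \<sigma> ''Q'' * (nv \<sigma> ''m'' * v + i) + y)) = weight (Suc t) v i y) \<and>
      (\<forall>z<?l. A z = ra \<sigma> ''W'' z)"
    unfolding c_W_def
  proof (rule table_r3, goal_cases)
    case (4 v i y A)
    then have b: "v < 2 * n" "i < m" "y < Q" and A: "\<And>z. z < ?l \<Longrightarrow> A z = ra \<sigma> ''W'' z"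
      using S by simp_all
    let ?\<tau> = "\<sigma>\<lparr>nv := (nv \<sigma>)(''v'' := v, ''i'' := i, ''y'' := y), ra := (ra \<sigma>)(''W'' := A)\<rparr>"
    \<comment> \<open>The old weights form the layer of round \<open>t\<close>, which ends before
      the start \<open>?l\<close> of the layer being written.\<close>
    have "2 * n * t + v < 2 * n * Suc t" using b by simp
    then have "Q * (m * (2 * n * t + v) + i) + y < ?l" using index2_less[OF index2_less b(3)] b(2) by blast
    then have W': "A (Q * (m * (2 * n * t + v) + i) + y) = weight t v i y" using A W[OF b] by simp
    have "rval new_weight_e ?\<tau> = weight t v i y + (if sol t v = y then load (sol t) i v - 1 else 0)"
      using L[OF b(1)] ld[of "2 * n - 1 - v" i] b W'
      by (simp add: new_weight_e_def cell3_def at_time_def Mul_def S t)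
    then have "rval (RIf (BR (ROf (NC 0)) new_weight_e) new_weight_e (ROf (NC 0))) ?\<tau> = weight (Suc t) v i y"
      by (simp add: sol_def max_def)
    moreover have "nval (NPlus (Mul (NPlus (Mul (at_time (NPlus (NV ''t'') (NC 1)) (NV ''v'')) ''m'') (NV ''i'')) ''Q'') (NV ''y'')) ?\<tau> =
        ?l + (nv \<sigma> ''Q'' * (nv \<sigma> ''m'' * v + i) + y)"
      by (simp add: at_time_def Mul_def S t algebra_simps)
    ultimately show ?case by blast
  qed simp_all
  then obtain A where A: "psem c_W \<sigma> = \<sigma>\<lparr>ra := (ra \<sigma>)(''W'' := A)\<rparr>"
    "\<And>v i y. v < 2 * n \<Longrightarrow> i < m \<Longrightarrow> y < Q \<Longrightarrow> A (?l + (Q * (m * v + i) + y)) = weight (Suc t) v i y"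
    using S by auto
  have "Q * (m * (2 * n * Suc t + v) + i) + y = ?l + (Q * (m * v + i) + y)" for v i y by (simp add: algebra_simps)
  with A show ?thesis by (intro exI[of _ A] conjI allI impI) (simp_all only:)
qed

text \<open>All earlier solutions are kept for the rounding, whereas a round reads only the latest
  layer of weights.\<close>

definition round_inv :: "nat \<Rightarrow> env \<Rightarrow> bool" where
  "round_inv t \<tau> \<longleftrightarrow> static \<tau> \<and> (\<forall>t'<t. \<forall>v<2 * n. na \<tau> ''L'' (2 * n * t' + v) = sol t' v) \<and>
     (\<forall>v<2 * n. \<forall>i<m. \<forall>y<Q. ra \<tau> ''W'' (Q * (m * (2 * n * t + v) + i) + y) = weight t v i y)"

lemma rounds:
  assumes "static \<sigma>" "ra \<sigma> ''W'' = (\<lambda>_. 0)" shows "round_inv T (psem c_rounds \<sigma>)"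
proof -
  have "round_inv (nv \<sigma> ''T'') (psem c_rounds \<sigma>)"
    unfolding c_rounds_def
  proof (rule psem_For_invariant)
    show "round_inv 0 \<sigma>" using assms by (simp add: round_inv_def)
    show "round_inv i (bind_nv \<tau> ''t'' k)" if "round_inv i \<tau>" for i \<tau> k
      using that by (simp add: round_inv_def static_bind params_def)
  next
    fix t \<tau> assume I: "round_inv t \<tau>"
    define s0 where "s0 = bind_nv \<tau> ''t'' t"
    have st0: "static s0" and t0: "nv s0 ''t'' = t"
      and L0: "\<And>t' v. t' < t \<Longrightarrow> v < 2 * n \<Longrightarrow> na s0 ''L'' (2 * n * t' + v) = sol t' v"
      and W0: "\<And>v i y. v < 2 * n \<Longrightarrow> i < m \<Longrightarrow> y < Q \<Longrightarrow> ra s0 ''W'' (Q * (m * (2 * n * t + v) + i) + y) = weight t v i y"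
      using I by (simp_all add: s0_def round_inv_def static_bind params_def)
    obtain A1 where A1: "psem c_acc s0 = s0\<lparr>ra := (ra s0)(''acc'' := A1)\<rparr>"
      "\<forall>v<2 * n. \<forall>i<m. \<forall>y<Q. A1 (Q * (m * v + i) + y) = acc (weight t) v i y"
      using step_acc[OF st0 t0 W0] by blast
    define s1 where "s1 = s0\<lparr>ra := (ra s0)(''acc'' := A1)\<rparr>"
    have st1: "static s1" and t1: "nv s1 ''t'' = t" using st0 t0 by (simp_all add: s1_def static_upd_r)
    have W1: "\<And>v i y. v < 2 * n \<Longrightarrow> i < m \<Longrightarrow> y < Q \<Longrightarrow> ra s1 ''W'' (Q * (m * (2 * n * t + v) + i) + y) = weight t v i y"
      and acc1: "\<And>v i y. v < 2 * n \<Longrightarrow> i < m \<Longrightarrow> y < Q \<Longrightarrow> ra s1 ''acc'' (Q * (m * v + i) + y) = acc (weight t) v i y"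
      using W0 A1(2) by (simp_all add: s1_def)
    obtain A2 where A2: "psem c_dp s1 = s1\<lparr>ra := (ra s1)(''dp'' := A2)\<rparr>"
      "\<forall>u<2 * n. \<forall>y<Q. A2 (Q * u + y) = dp (weight t) big (2 * n - 1 - u) y"
      using step_dp[OF st1 t1 W1 acc1] by blast
    define s2 where "s2 = s1\<lparr>ra := (ra s1)(''dp'' := A2)\<rparr>"
    have st2: "static s2" and t2: "nv s2 ''t'' = t" using st1 t1 by (simp_all add: s2_def static_upd_r)
    have W2: "\<And>v i y. v < 2 * n \<Longrightarrow> i < m \<Longrightarrow> y < Q \<Longrightarrow> ra s2 ''W'' (Q * (m * (2 * n * t + v) + i) + y) = weight t v i y"
      and dp2: "\<And>u y. u < 2 * n \<Longrightarrow> y < Q \<Longrightarrow> ra s2 ''dp'' (Q * u + y) = dp (weight t) big (2 * n - 1 - u) y"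
      using W1 A2(2) by (simp_all add: s2_def)
    obtain A3 where A3: "psem c_sol s2 = s2\<lparr>na := (na s2)(''L'' := A3)\<rparr>"
      "\<forall>v<2 * n. A3 (2 * n * t + v) = sol t v" "\<forall>z<2 * n * t. A3 z = na s2 ''L'' z"
      using step_sol[OF st2 t2 W2 dp2] by blast
    define s3 where "s3 = s2\<lparr>na := (na s2)(''L'' := A3)\<rparr>"
    have st3: "static s3" and t3: "nv s3 ''t'' = t" using st2 t2 by (simp_all add: s3_def static_upd_n)
    have W3: "\<And>v i y. v < 2 * n \<Longrightarrow> i < m \<Longrightarrow> y < Q \<Longrightarrow> ra s3 ''W'' (Q * (m * (2 * n * t + v) + i) + y) = weight t v i y"
      using W2 by (simp add: s3_def)
    have L3: "na s3 ''L'' (2 * n * t' + v) = sol t' v" if "t' < Suc t" "v < 2 * n" for t' v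
    proof (cases "t' = t")
      case False
      then have "2 * n * t' + v < 2 * n * t" using that by (intro index2_less) auto
      then show ?thesis using A3(3) L0[of t' v] that False by (simp add: s3_def s2_def s1_def)
    qed (use A3(2) that in \<open>simp add: s3_def\<close>)
    obtain A4 where A4: "psem c_ld s3 = s3\<lparr>ra := (ra s3)(''ld'' := A4)\<rparr>"
      "\<forall>u<2 * n. \<forall>i<m. A4 (m * u + i) = load (sol t) i (2 * n - 1 - u)"
      using step_ld[OF st3 t3 L3[of t]] by auto
    define s4 where "s4 = s3\<lparr>ra := (ra s3)(''ld'' := A4)\<rparr>"
    have st4: "static s4" and t4: "nv s4 ''t'' = t" using st3 t3 by (simp_all add: s4_def static_upd_r)
    have W4: "\<And>v i y. v < 2 * n \<Longrightarrow> i < m \<Longrightarrow> y < Q \<Longrightarrow> ra s4 ''W'' (Q * (m * (2 * n * t + v) + i) + y) = weight t v i y"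
      and ld4: "\<And>u i. u < 2 * n \<Longrightarrow> i < m \<Longrightarrow> ra s4 ''ld'' (m * u + i) = load (sol t) i (2 * n - 1 - u)"
      and L4: "\<And>t' v. t' < Suc t \<Longrightarrow> v < 2 * n \<Longrightarrow> na s4 ''L'' (2 * n * t' + v) = sol t' v"
      using W3 A4(2) L3 by (simp_all add: s4_def)
    obtain A5 where A5: "psem c_W s4 = s4\<lparr>ra := (ra s4)(''W'' := A5)\<rparr>"
      "\<forall>v<2 * n. \<forall>i<m. \<forall>y<Q. A5 (Q * (m * (2 * n * Suc t + v) + i) + y) = weight (Suc t) v i y"
      using step_W[OF st4 t4 W4 L4[of t] ld4] by blast
    have "psem (CSeq c_acc (CSeq c_dp (CSeq c_sol (CSeq c_ld c_W)))) s0 = s4\<lparr>ra := (ra s4)(''W'' := A5)\<rparr>"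
      by (simp only: psem.simps(5) A1(1) s1_def[symmetric] A2(1) s2_def[symmetric] A3(1) s3_def[symmetric] A4(1) s4_def[symmetric] A5(1))
    moreover have "round_inv (Suc t) (s4\<lparr>ra := (ra s4)(''W'' := A5)\<rparr>)"
      unfolding round_inv_def using st4 L4 A5(2) by (simp add: static_upd_r)
    ultimately show "round_inv (Suc t) (psem (CSeq c_acc (CSeq c_dp (CSeq c_sol (CSeq c_ld c_W)))) (bind_nv \<tau> ''t'' t))"
      by (simp only: s0_def)
  qed
  then show ?thesis using staticD(14)[OF assms(1)] by simp
qed

end

section \<open>Evaluation of the rounding tables\<close>

context instance_tables
begin

lemma sum_cls: "(\<Sum>t<T. if sol t v = y then g t else 0) = (\<Sum>t\<in>cls v y. g t)"
proof -
  have "cls v y = {t \<in> {..<T}. sol t v = y}" by (auto simp: cls_def)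
  then show ?thesis by (simp only: sum.inter_filter[OF finite_lessThan])
qed

lemma count_value:
  assumes st: "static \<tau>" and L: "\<And>t. t < T \<Longrightarrow> na \<tau> ''L'' (2 * n * t + v) = sol t v"
    and e: "\<And>k. nval ve (\<tau>\<lparr>nv := (nv \<tau>)(''t'' := k)\<rparr>) = v" "\<And>k. nval ye (\<tau>\<lparr>nv := (nv \<tau>)(''t'' := k)\<rparr>) = y"
  shows "nval (count_e ve ye) \<tau> = card (cls v y)"
proof -
  have "nval (count_e ve ye) \<tau> = (\<Sum>t<T. if sol t v = y then 1 else 0)"
    using L by (simp add: count_e_def sol_e_def at_time_def Mul_def staticD[OF st] e cong: sum.cong_simp)
  then show ?thesis by (simp only: sum_cls card_eq_sum)
qed

lemma class_mean_value:
  assumes st: "static \<tau>" and L: "\<And>t. t < T \<Longrightarrow> na \<tau> ''L'' (2 * n * t + v) = sol t v"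
    and e: "\<And>k. nval ve (\<tau>\<lparr>nv := (nv \<tau>)(''t'' := k)\<rparr>) = v" "\<And>k. nval ye (\<tau>\<lparr>nv := (nv \<tau>)(''t'' := k)\<rparr>) = y"
    and g: "\<And>t. t < T \<Longrightarrow> rval e (\<tau>\<lparr>nv := (nv \<tau>)(''t'' := t)\<rparr>) = g t"
  shows "rval (class_mean ve ye e) \<tau> = (\<Sum>t\<in>cls v y. g t) / card (cls v y)"
proof -
  have "rval (class_mean ve ye e) \<tau> = (\<Sum>t<T. if sol t v = y then g t else 0) / card (cls v y)"
    using L g count_value[OF st L e]
    by (simp add: class_mean_def sol_e_def at_time_def Mul_def aggr_plus staticD[OF st] e cong: sum.cong_simp)
  then show ?thesis by (simp only: sum_cls)
qed

lemma mirror_index: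
  assumes "u < 2 * n" "v = 2 * n - 1 - u" "0 < v" "v < n"
  shows "2 * n - 1 - 2 * v < u" "2 * n - 1 - (2 * v + 1) < u" "2 * n - 1 - (2 * n - 1 - 2 * v) = 2 * v"
    "2 * n - 1 - (2 * n - 1 - (2 * v + 1)) = 2 * v + 1"
  using assms by auto

lemma F_leaf': "\<not> (0 < v \<and> v < n) \<Longrightarrow> F i v y = 1 + s * a (y mod q) i"
  unfolding F_def by (subst tree_rec_leaf) simp_all

lemma R_leaf': "\<not> (0 < v \<and> v < n) \<Longrightarrow> R v y = 0"
  unfolding R_def by (subst tree_rec_leaf) simp_all

lemma step_F:
  assumes st: "static \<sigma>" and L: "\<And>t v. t < T \<Longrightarrow> v < 2 * n \<Longrightarrow> na \<sigma> ''L'' (2 * n * t + v) = sol t v"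
  shows "\<exists>A. psem c_F \<sigma> = \<sigma>\<lparr>ra := (ra \<sigma>)(''F'' := A)\<rparr> \<and>
    (\<forall>u<2 * n. \<forall>i<m. \<forall>y<Q. A (Q * (m * u + i) + y) = F i (2 * n - 1 - u) y)"
proof -
  note S = staticD[OF st]
  have "\<exists>A. psem c_F \<sigma> = \<sigma>\<lparr>ra := (ra \<sigma>)(''F'' := A)\<rparr> \<and>
      (\<forall>u<nv \<sigma> ''N''. \<forall>i<nv \<sigma> ''m''. \<forall>y<nv \<sigma> ''Q''. A (0 + (nv \<sigma> ''Q'' * (nv \<sigma> ''m'' * u + i) + y)) = F i (2 * n - 1 - u) y) \<and>
      (\<forall>z<0. A z = ra \<sigma> ''F'' z)"
    unfolding c_F_def
  proof (rule table_r3, goal_cases)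
    case (4 u i y A)
    then have b: "u < 2 * n" "i < m" "y < Q"
      and A: "\<And>u' i' y'. u' < u \<Longrightarrow> i' < m \<Longrightarrow> y' < Q \<Longrightarrow> A (Q * (m * u' + i') + y') = F i' (2 * n - 1 - u') y'"
      using S by simp_all
    define v where "v = 2 * n - 1 - u"
    have vS: "2 * n - Suc u = v" by (simp add: v_def)
    let ?\<tau> = "\<sigma>\<lparr>nv := (nv \<sigma>)(''u'' := u, ''i'' := i, ''y'' := y), ra := (ra \<sigma>)(''F'' := A)\<rparr>"
    let ?v = "mirror (NV ''u'')" and ?y = "NV ''y''"
    have st': "static ?\<tau>" using st by (rule static_fill_r) (auto simp: params_def)
    note S' = staticD[OF st']
    have v: "v < 2 * n" using b by (simp add: v_def)
    have L': "\<And>t. t < T \<Longrightarrow> na ?\<tau> ''L'' (2 * n * t + v) = sol t v" using L v by simp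
    have e: "\<And>k. nval ?v (?\<tau>\<lparr>nv := (nv ?\<tau>)(''t'' := k)\<rparr>) = v" "\<And>k. nval ?y (?\<tau>\<lparr>nv := (nv ?\<tau>)(''t'' := k)\<rparr>) = y"
      by (simp_all add: S vS)
    have idx: "nval (NPlus (Mul (NPlus (Mul (NV ''u'') ''m'') (NV ''i'')) ''Q'') (NV ''y'')) ?\<tau> =
        0 + (nv \<sigma> ''Q'' * (nv \<sigma> ''m'' * u + i) + y)" by (simp add: Mul_def)
    have vv: "nval ?v ?\<tau> = v" by (simp add: S vS)
    show ?case
    proof (cases "0 < v \<and> v < n")
      case True
      note u = mirror_index[OF b(1) v_def conjunct1[OF True] conjunct2[OF True]]
      have l: "rval (F_e (left_e ?v) (NV ''i'') (sol_e (left_e ?v))) (?\<tau>\<lparr>nv := (nv ?\<tau>)(''t'' := t)\<rparr>) = F i (2 * v) (sol t (2 * v))"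
        if "t < T" for t
        using A[OF u(1) b(2) sol_less[of "2 * v" t]] L[OF that, of "2 * v"] True unfolding u(3)
        by (simp add: F_e_def cell3_def sol_e_def at_time_def Mul_def S vS)
      have r: "rval (F_e (right_e ?v) (NV ''i'') (sol_e (right_e ?v))) (?\<tau>\<lparr>nv := (nv ?\<tau>)(''t'' := t)\<rparr>) = F i (2 * v + 1) (sol t (2 * v + 1))"
        if "t < T" for t
        using A[OF u(2) b(2) sol_less[of "2 * v + 1" t]] L[OF that, of "2 * v + 1"] True unfolding u(4)
        by (simp add: F_e_def cell3_def sol_e_def at_time_def Mul_def S vS)
      have cm: "rval (class_mean ?v ?y (RBin ROMul (F_e (left_e ?v) (NV ''i'') (sol_e (left_e ?v)))
            (F_e (right_e ?v) (NV ''i'') (sol_e (right_e ?v))))) ?\<tau> =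
          (\<Sum>t\<in>cls v y. F i (2 * v) (sol t (2 * v)) * F i (2 * v + 1) (sol t (2 * v + 1))) / card (cls v y)"
        by (rule class_mean_value[OF st' L' e]) (simp_all only: rval.simps(2) rop_fun.simps l r)
      have "rval (RIf (BN (count_e ?v ?y) (NV ''th'')) (ROf (NC 1))
          (class_mean ?v ?y (RBin ROMul (F_e (left_e ?v) (NV ''i'') (sol_e (left_e ?v)))
            (F_e (right_e ?v) (NV ''i'') (sol_e (right_e ?v)))))) ?\<tau> = F i v y"
        using True by (simp only: F_node rval.simps bval.simps nval.simps cm count_value[OF st' L' e] rare_def S' of_nat_1)
      then show ?thesis using True idx vv by (simp only: rval_inner S' v_def[symmetric] if_True simp_thms)
    next
      case False
      have "rval (RBin ROAdd (ROf (NC 1)) (RBin ROMul s_e (RLd ''a'' (NPlus (Mul (NLd ''md'' (NV ''y'')) ''m'') (NV ''i''))))) ?\<tau> =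
          1 + s * a (y mod q) i"
        using b less_Qq[OF b(3)] q_pos h_le by (simp add: s_e_def s_def blocks_def Mul_def S H1_def)
      then show ?thesis using False idx vv F_leaf'[OF False] by (simp only: rval_inner S' v_def[symmetric] if_False simp_thms)
    qed
  qed simp_all
  then show ?thesis using S by auto
qed

lemma step_R:
  assumes st: "static \<sigma>" and L: "\<And>t v. t < T \<Longrightarrow> v < 2 * n \<Longrightarrow> na \<sigma> ''L'' (2 * n * t + v) = sol t v"
  shows "\<exists>A. psem c_R \<sigma> = \<sigma>\<lparr>ra := (ra \<sigma>)(''R'' := A)\<rparr> \<and>
    (\<forall>u<2 * n. \<forall>y<Q. A (Q * u + y) = R (2 * n - 1 - u) y)"
proof -
  note S = staticD[OF st]
  have "\<exists>A. psem c_R \<sigma> = \<sigma>\<lparr>ra := (ra \<sigma>)(''R'' := A)\<rparr> \<and>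
      (\<forall>u<nv \<sigma> ''N''. \<forall>y<nv \<sigma> ''Q''. A (0 + (nv \<sigma> ''Q'' * u + y)) = R (2 * n - 1 - u) y) \<and>
      (\<forall>z<0. A z = ra \<sigma> ''R'' z)"
    unfolding c_R_def
  proof (rule table_r2, goal_cases)
    case (2 u y A)
    then have b: "u < 2 * n" "y < Q"
      and A: "\<And>u' y'. u' < u \<Longrightarrow> y' < Q \<Longrightarrow> A (Q * u' + y') = R (2 * n - 1 - u') y'"
      using S by simp_all
    define v where "v = 2 * n - 1 - u"
    have vS: "2 * n - Suc u = v" by (simp add: v_def)
    let ?\<tau> = "\<sigma>\<lparr>nv := (nv \<sigma>)(''u'' := u, ''y'' := y), ra := (ra \<sigma>)(''R'' := A)\<rparr>"
    let ?v = "mirror (NV ''u'')" and ?y = "NV ''y''"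
    have st': "static ?\<tau>" using st by (rule static_fill_r) (auto simp: params_def)
    note S' = staticD[OF st']
    have v: "v < 2 * n" using b by (simp add: v_def)
    have L': "\<And>t. t < T \<Longrightarrow> na ?\<tau> ''L'' (2 * n * t + v) = sol t v" using L v by simp
    have e: "\<And>k. nval ?v (?\<tau>\<lparr>nv := (nv ?\<tau>)(''t'' := k)\<rparr>) = v" "\<And>k. nval ?y (?\<tau>\<lparr>nv := (nv ?\<tau>)(''t'' := k)\<rparr>) = y"
      by (simp_all add: S vS)
    have idx: "nval (NPlus (Mul (NV ''u'') ''Q'') (NV ''y'')) ?\<tau> = 0 + (nv \<sigma> ''Q'' * u + y)" by (simp add: Mul_def)
    have vv: "nval ?v ?\<tau> = v" by (simp add: S vS)
    show ?case
    proof (cases "0 < v \<and> v < n")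
      case True
      note u = mirror_index[OF b(1) v_def conjunct1[OF True] conjunct2[OF True]]
      have l: "rval (R_e (left_e ?v) (sol_e (left_e ?v))) (?\<tau>\<lparr>nv := (nv ?\<tau>)(''t'' := t)\<rparr>) = R (2 * v) (sol t (2 * v))"
        if "t < T" for t
        using A[OF u(1) sol_less[of "2 * v" t]] L[OF that, of "2 * v"] True unfolding u(3)
        by (simp add: R_e_def cell2_def sol_e_def at_time_def Mul_def S vS)
      have r: "rval (R_e (right_e ?v) (sol_e (right_e ?v))) (?\<tau>\<lparr>nv := (nv ?\<tau>)(''t'' := t)\<rparr>) = R (2 * v + 1) (sol t (2 * v + 1))"
        if "t < T" for t
        using A[OF u(2) sol_less[of "2 * v + 1" t]] L[OF that, of "2 * v + 1"] True unfolding u(4)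
        by (simp add: R_e_def cell2_def sol_e_def at_time_def Mul_def S vS)
      have cm: "rval (class_mean ?v ?y (RBin ROAdd (R_e (left_e ?v) (sol_e (left_e ?v)))
            (R_e (right_e ?v) (sol_e (right_e ?v))))) ?\<tau> =
          (\<Sum>t\<in>cls v y. R (2 * v) (sol t (2 * v)) + R (2 * v + 1) (sol t (2 * v + 1))) / card (cls v y)"
        by (rule class_mean_value[OF st' L' e]) (simp_all only: rval.simps(2) rop_fun.simps l r)
      have "rval (RIf (BN (count_e ?v ?y) (NV ''th'')) (ROf (NC 1))
          (class_mean ?v ?y (RBin ROAdd (R_e (left_e ?v) (sol_e (left_e ?v)))
            (R_e (right_e ?v) (sol_e (right_e ?v)))))) ?\<tau> = R v y"
        using True by (simp only: R_node rval.simps bval.simps nval.simps cm count_value[OF st' L' e] rare_def S' of_nat_1)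
      then show ?thesis using True idx vv by (simp only: rval_inner S' v_def[symmetric] if_True simp_thms)
    next
      case False
      have "rval (ROf (NC 0)) ?\<tau> = 0" by simp
      then show ?thesis using False idx vv R_leaf'[OF False] by (simp only: rval_inner S' v_def[symmetric] if_False simp_thms)
    qed
  qed simp_all
  then show ?thesis using S by auto
qed

lemma pick_less: "pick v < T"
  using theta_pos by (subst pick_eq) (rule argmin_less)

lemma label_of_less: "(\<And>u. \<tau> u < T) \<Longrightarrow> w < 2 * n \<Longrightarrow> label_of \<tau> w < Q"
  using sol_less root_less_Q by (simp add: label_of_def)

text \<open>The ends of the frontier depend on \<open>v\<close> and cannot bound a loop; the product
  runs over all vertices with neutral factors elsewhere.\<close>

lemma prod_between:
  assumes "2 * v \<le> (N::nat)"
  shows "(\<Prod>w<N. if v < w then if w < 2 * v then g w else 1 else 1) = (\<Prod>w\<in>{v<..<2 * v}. g w)"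
proof -
  have "{v<..<2 * v} = {w \<in> {..<N}. v < w \<and> w < 2 * v}" using assms by auto
  then have "(\<Prod>w\<in>{v<..<2 * v}. g w) = (\<Prod>w<N. if v < w \<and> w < 2 * v then g w else 1)"
    by (simp only: prod.inter_filter[OF finite_lessThan])
  also have "\<dots> = (\<Prod>w<N. if v < w then if w < 2 * v then g w else 1 else 1)" by (intro prod.cong) auto
  finally show ?thesis ..
qed

lemma step_pick:
  assumes st: "static \<sigma>" and L: "\<And>t v. t < T \<Longrightarrow> v < 2 * n \<Longrightarrow> na \<sigma> ''L'' (2 * n * t + v) = sol t v"
    and F: "\<And>u i y. u < 2 * n \<Longrightarrow> i < m \<Longrightarrow> y < Q \<Longrightarrow> ra \<sigma> ''F'' (Q * (m * u + i) + y) = F i (2 * n - 1 - u) y"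
    and R: "\<And>u y. u < 2 * n \<Longrightarrow> y < Q \<Longrightarrow> ra \<sigma> ''R'' (Q * u + y) = R (2 * n - 1 - u) y"
  shows "\<exists>A. psem c_pick \<sigma> = \<sigma>\<lparr>na := (na \<sigma>)(''pick'' := A)\<rparr> \<and> (\<forall>v<n. A v = pick v)"
proof -
  note S = staticD[OF st]
  have F': "ra \<sigma> ''F'' (Q * (m * (2 * n - Suc w) + i) + y) = F i w y" if "w < 2 * n" "i < m" "y < Q" for w i y
    using F[of "2 * n - 1 - w" i y] that by simp
  have R': "ra \<sigma> ''R'' (Q * (2 * n - Suc w) + y) = R w y" if "w < 2 * n" "y < Q" for w y
    using R[of "2 * n - 1 - w" y] that by simp
  have "\<exists>A. psem c_pick \<sigma> = \<sigma>\<lparr>na := (na \<sigma>)(''pick'' := A)\<rparr> \<and> (\<forall>v<nv \<sigma> ''n''. A (0 + v) = pick v) \<and>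
      (\<forall>z<0. A z = na \<sigma> ''pick'' z)"
    unfolding c_pick_def
  proof (rule table_n1, goal_cases)
    case (1 v A)
    then have b: "v < n" and A: "\<And>u. u < v \<Longrightarrow> A u = pick u" using S by simp_all
    let ?\<tau> = "\<sigma>\<lparr>nv := (nv \<sigma>)(''v'' := v), na := (na \<sigma>)(''pick'' := A)\<rparr>"
    have lv: "v < 2 * n" "2 * v < 2 * n" "Suc (2 * v) < 2 * n" using b by auto
    \<comment> \<open>The parents of the frontier vertices are numbered below \<open>v\<close>, so
      their picks are already in the table.\<close>
    have lab: "(if w < 2 then root else na \<sigma> ''L'' (2 * n * A (w div 2) + w)) = label_of pick w"
      if "w = v \<or> w < 2 * v" for w
    proof (cases "w < 2")
      case False
      then have "w div 2 < v" "w < 2 * n" using that b by auto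
      then show ?thesis using False A L pick_less by (simp add: label_of_def)
    qed (simp add: label_of_def)
    have "rval objective_e (?\<tau>\<lparr>nv := (nv ?\<tau>)(''t'' := t)\<rparr>) = objective pick v t" if t: "t < T" for t
    proof -
      let ?s = "?\<tau>\<lparr>nv := (nv ?\<tau>)(''t'' := t)\<rparr>"
      have sol_v: "nval (sol_e (NV ''v'')) ?s = sol t v" using L[OF t lv(1)] by (simp add: sol_e_def at_time_def Mul_def S)
      have out_v: "nval (out_e (NV ''v'')) ?s = label_of pick v"
        using lab[of v] lv by (simp add: out_e_def at_time_def Mul_def S)
      have Fl: "rval (F_e (left_e (NV ''v'')) (NV ''i'') (sol_e (left_e (NV ''v'')))) (bind_nv ?s ''i'' i) = F i (2 * v) (sol t (2 * v))"
        if "i < m" for i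
        using L[OF t lv(2)] F'[OF lv(2) that sol_less[OF lv(2)]] by (simp add: F_e_def cell3_def sol_e_def at_time_def Mul_def S)
      have Fr: "rval (F_e (right_e (NV ''v'')) (NV ''i'') (sol_e (right_e (NV ''v'')))) (bind_nv ?s ''i'' i) = F i (2 * v + 1) (sol t (2 * v + 1))"
        if "i < m" for i
        using L[OF t lv(3)] F'[OF lv(3) that sol_less[OF lv(3)]] by (simp add: F_e_def cell3_def sol_e_def at_time_def Mul_def S)
      have Rl: "rval (R_e (left_e (NV ''v'')) (sol_e (left_e (NV ''v'')))) ?s = R (2 * v) (sol t (2 * v))"
        using L[OF t lv(2)] R'[OF lv(2) sol_less[OF lv(2)]] by (simp add: R_e_def cell2_def sol_e_def at_time_def Mul_def S)
      have Rr: "rval (R_e (right_e (NV ''v'')) (sol_e (right_e (NV ''v'')))) ?s = R (2 * v + 1) (sol t (2 * v + 1))"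
        using L[OF t lv(3)] R'[OF lv(3) sol_less[OF lv(3)]] by (simp add: R_e_def cell2_def sol_e_def at_time_def Mul_def S)
      have Fw: "rval (F_e (NV ''w'') (NV ''i'') (out_e (NV ''w''))) (bind_nv (bind_nv ?s ''i'' i) ''w'' w) = F i w (label_of pick w)"
        if "i < m" "w < 2 * v" for i w
      proof -
        have w: "w < 2 * n" using that b by simp
        show ?thesis using lab[of w] that w F'[OF w that(1) label_of_less[OF pick_less w]]
          by (simp add: F_e_def cell3_def out_e_def at_time_def Mul_def S)
      qed
      have P: "rval (RAgg ROMul ''w'' ''N'' (ROf (NC 1))
             (RIf (BN (NV ''v'') (NV ''w''))
               (RIf (BN (NV ''w'') (left_e (NV ''v''))) (F_e (NV ''w'') (NV ''i'') (out_e (NV ''w''))) (ROf (NC 1)))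
               (ROf (NC 1)))) (bind_nv ?s ''i'' i) = (\<Prod>w\<in>{v<..<2 * v}. F i w (label_of pick w))" if i: "i < m" for i
      proof -
        have "2 * v \<le> 2 * n" using b by simp
        note prod_between[OF this, of "\<lambda>w. F i w (label_of pick w)", symmetric]
        then show ?thesis using Fw[OF i] by (simp add: aggr_times S)
      qed
      have "rval (RAgg ROAdd ''i'' ''m'' (ROf (NC 0))
         (RBin ROMul
           (RAgg ROMul ''w'' ''N'' (ROf (NC 1))
             (RIf (BN (NV ''v'') (NV ''w''))
               (RIf (BN (NV ''w'') (left_e (NV ''v''))) (F_e (NV ''w'') (NV ''i'') (out_e (NV ''w''))) (ROf (NC 1)))
               (ROf (NC 1))))
           (RBin ROMul (F_e (left_e (NV ''v'')) (NV ''i'') (sol_e (left_e (NV ''v''))))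
             (F_e (right_e (NV ''v'')) (NV ''i'') (sol_e (right_e (NV ''v''))))))) ?s =
          (\<Sum>i<m. (\<Prod>w\<in>{v<..<2 * v}. F i w (label_of pick w)) *
             (F i (2 * v) (sol t (2 * v)) * F i (2 * v + 1) (sol t (2 * v + 1))))" (is "rval ?sum ?s = ?rhs")
      proof -
        have "rval ?sum ?s = (\<Sum>i<nv ?s ''m''. rval (RBin ROMul
           (RAgg ROMul ''w'' ''N'' (ROf (NC 1))
             (RIf (BN (NV ''v'') (NV ''w''))
               (RIf (BN (NV ''w'') (left_e (NV ''v''))) (F_e (NV ''w'') (NV ''i'') (out_e (NV ''w''))) (ROf (NC 1)))
               (ROf (NC 1))))
           (RBin ROMul (F_e (left_e (NV ''v'')) (NV ''i'') (sol_e (left_e (NV ''v''))))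
             (F_e (right_e (NV ''v'')) (NV ''i'') (sol_e (right_e (NV ''v'')))))) (bind_nv ?s ''i'' i))"
          by (subst rval.simps(5)) (simp only: rop_fun.simps aggr_plus rval.simps(1) nval.simps(1) of_nat_0 add_0)
        also have "nv ?s ''m'' = m" by (simp add: S)
        also have "(\<Sum>i<m. rval (RBin ROMul
           (RAgg ROMul ''w'' ''N'' (ROf (NC 1))
             (RIf (BN (NV ''v'') (NV ''w''))
               (RIf (BN (NV ''w'') (left_e (NV ''v''))) (F_e (NV ''w'') (NV ''i'') (out_e (NV ''w''))) (ROf (NC 1)))
               (ROf (NC 1))))
           (RBin ROMul (F_e (left_e (NV ''v'')) (NV ''i'') (sol_e (left_e (NV ''v''))))
             (F_e (right_e (NV ''v'')) (NV ''i'') (sol_e (right_e (NV ''v'')))))) (bind_nv ?s ''i'' i)) = ?rhs"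
          by (intro sum.cong refl) (simp only: lessThan_iff rval.simps(2) rop_fun.simps P Fl Fr)
        finally show ?thesis .
      qed
      moreover have "nv ?s ''B'' = B" by (simp add: S)
      ultimately show ?thesis
        by (simp only: objective_e_def rval_REq sol_v out_v rval.simps(1,2) rop_fun.simps Rl Rr nval.simps(2) objective_def)
    qed
    then have "argmin (\<lambda>t. rval objective_e (?\<tau>\<lparr>nv := (nv ?\<tau>)(''t'' := t)\<rparr>)) T = argmin (objective pick v) T"
      by (rule argmin_cong)
    then have "nval (NArg ''t'' ''T'' objective_e) ?\<tau> = pick v"
      using pick_eq[of v] S(14) by simp
    then show ?case by simp
  qed
  then show ?thesis using S by auto
qed

lemma step_label:
  assumes st: "static \<sigma>" and L: "\<And>t v. t < T \<Longrightarrow> v < 2 * n \<Longrightarrow> na \<sigma> ''L'' (2 * n * t + v) = sol t v"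
    and P: "\<And>v. v < n \<Longrightarrow> na \<sigma> ''pick'' v = pick v"
  shows "\<forall>v<2 * n. na (psem c_label \<sigma>) ''label'' v = out v mod q"
proof -
  note S = staticD[OF st]
  have "\<exists>A. psem c_label \<sigma> = \<sigma>\<lparr>na := (na \<sigma>)(''label'' := A)\<rparr> \<and> (\<forall>v<nv \<sigma> ''N''. A (0 + v) = out v mod q) \<and>
      (\<forall>z<0. A z = na \<sigma> ''label'' z)"
    unfolding c_label_def
  proof (rule table_n1, goal_cases)
    case (1 v A)
    then have b: "v < 2 * n" using S by simp
    let ?\<tau> = "\<sigma>\<lparr>nv := (nv \<sigma>)(''v'' := v), na := (na \<sigma>)(''label'' := A)\<rparr>"
    have "nval (out_e (NV ''v'')) ?\<tau> = out v"
    proof (cases "v < 2")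
      case False
      have "v div 2 < n" using b by auto
      with False show ?thesis using L[OF pick_less b, of "v div 2"] b P
        by (simp add: out_e_def at_time_def Mul_def S out_def label_of_def)
    qed (simp add: out_e_def S out_def label_of_def)
    moreover have "out v < Q * q" using label_of_less[OF pick_less b] less_Qq by (simp add: out_def)
    ultimately show ?case using S by simp
  qed
  then show ?thesis using S by auto
qed

theorem main_phase:
  assumes "static \<sigma>" "ra \<sigma> ''W'' = (\<lambda>_. 0)"
  shows "\<forall>v<2 * n. na (fold psem c_main \<sigma>) ''label'' v = out v mod q"
proof -
  define s1 where "s1 = psem c_rounds \<sigma>"
  have st1: "static s1" and L1: "\<And>t v. t < T \<Longrightarrow> v < 2 * n \<Longrightarrow> na s1 ''L'' (2 * n * t + v) = sol t v"
    using rounds[OF assms] by (simp_all add: s1_def round_inv_def)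
  obtain A2 where A2: "psem c_F s1 = s1\<lparr>ra := (ra s1)(''F'' := A2)\<rparr>"
    "\<forall>u<2 * n. \<forall>i<m. \<forall>y<Q. A2 (Q * (m * u + i) + y) = F i (2 * n - 1 - u) y"
    using step_F[OF st1 L1] by blast
  define s2 where "s2 = s1\<lparr>ra := (ra s1)(''F'' := A2)\<rparr>"
  have st2: "static s2" and L2: "\<And>t v. t < T \<Longrightarrow> v < 2 * n \<Longrightarrow> na s2 ''L'' (2 * n * t + v) = sol t v"
    using st1 L1 by (simp_all add: s2_def static_upd_r)
  obtain A3 where A3: "psem c_R s2 = s2\<lparr>ra := (ra s2)(''R'' := A3)\<rparr>"
    "\<forall>u<2 * n. \<forall>y<Q. A3 (Q * u + y) = R (2 * n - 1 - u) y"
    using step_R[OF st2 L2] by blast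
  define s3 where "s3 = s2\<lparr>ra := (ra s2)(''R'' := A3)\<rparr>"
  have st3: "static s3" and L3: "\<And>t v. t < T \<Longrightarrow> v < 2 * n \<Longrightarrow> na s3 ''L'' (2 * n * t + v) = sol t v"
    and F3: "\<And>u i y. u < 2 * n \<Longrightarrow> i < m \<Longrightarrow> y < Q \<Longrightarrow> ra s3 ''F'' (Q * (m * u + i) + y) = F i (2 * n - 1 - u) y"
    and R3: "\<And>u y. u < 2 * n \<Longrightarrow> y < Q \<Longrightarrow> ra s3 ''R'' (Q * u + y) = R (2 * n - 1 - u) y"
    using st2 L2 A2(2) A3(2) by (simp_all add: s3_def static_upd_r) (simp_all add: s2_def)
  obtain A4 where A4: "psem c_pick s3 = s3\<lparr>na := (na s3)(''pick'' := A4)\<rparr>" "\<forall>v<n. A4 v = pick v"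
    using step_pick[OF st3 L3 F3 R3] by blast
  define s4 where "s4 = s3\<lparr>na := (na s3)(''pick'' := A4)\<rparr>"
  have st4: "static s4" and L4: "\<And>t v. t < T \<Longrightarrow> v < 2 * n \<Longrightarrow> na s4 ''L'' (2 * n * t + v) = sol t v"
    and P4: "\<And>v. v < n \<Longrightarrow> na s4 ''pick'' v = pick v"
    using st3 L3 A4(2) by (simp_all add: s4_def static_upd_n)
  have "fold psem c_main \<sigma> = psem c_label s4"
    unfolding c_main_def
    by (simp only: fold.simps comp_apply id_apply s1_def[symmetric] A2(1) s2_def[symmetric] A3(1) s3_def[symmetric] A4(1) s4_def[symmetric])
  with step_label[OF st4 L4 P4] show ?thesis by simp
qed

lemma bounded_static: "static \<sigma> \<Longrightarrow> bounded size_bound \<sigma>"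
  using staticD[of \<sigma>] by (simp add: bounded_def params_def size_bound_def H1_def)

lemma bounded_run_main:
  assumes "bounded M \<sigma>" "\<And>c. c \<in> set cs \<Longrightarrow> set_vars c = {}" shows "bounded_run M cs \<sigma>"
  using assms by (induction cs arbitrary: \<sigma>) (simp_all add: bounded_psem)

end

section \<open>Instances\<close>

lemma concat_blocks:
  assumes "\<And>i. i < k \<Longrightarrow> length (g i) = d"
  shows "length (concat (map g [0..<k])) = k * d"
    "i < k \<Longrightarrow> j < d \<Longrightarrow> concat (map g [0..<k]) ! (d * i + j) = g i ! j"
proof -
  have *: "length (concat (map g [0..<k])) = k * d \<and>
      (\<forall>i<k. \<forall>j<d. concat (map g [0..<k]) ! (d * i + j) = g i ! j)"
    using assms
  proof (induction k)
    case (Suc k)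
    then have l: "length (concat (map g [0..<k])) = k * d"
      and e: "\<And>i j. i < k \<Longrightarrow> j < d \<Longrightarrow> concat (map g [0..<k]) ! (d * i + j) = g i ! j" by auto
    have "concat (map g [0..<Suc k]) ! (d * i + j) = g i ! j" if "i < Suc k" "j < d" for i j
    proof (cases "i = k")
      case True
      then show ?thesis using l by (simp add: nth_append mult.commute)
    next
      case False
      then have "d * i + j < k * d" using index2_less[of i k j d] that by (simp add: mult.commute)
      then show ?thesis using False that l e by (simp add: nth_append)
    qed
    then show ?case using l Suc.prems by simp
  qed simp
  from * show "length (concat (map g [0..<k])) = k * d" by simp
  from * show "i < k \<Longrightarrow> j < d \<Longrightarrow> concat (map g [0..<k]) ! (d * i + j) = g i ! j" by simp
qed

lemma array_of_table2:
  assumes "i < k" "j < d"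
  shows "array_of [f i j. i \<leftarrow> [0..<k], j \<leftarrow> [0..<d]] (d * i + j) = f i j"
proof -
  let ?g = "\<lambda>i. map (f i) [0..<d]"
  have "concat (map ?g [0..<k]) ! (d * i + j) = f i j"
    using concat_blocks(2)[of k ?g d i j] assms by simp
  moreover have "d * i + j < length (concat (map ?g [0..<k]))"
    using concat_blocks(1)[of k ?g d] index2_less[OF assms] by (simp add: mult.commute)
  ultimately show ?thesis by (simp add: array_of_def)
qed

text \<open>The last two indices stay packed because the dynamic program minimises over pairs of
  labels in this form.\<close>

lemma array_of_table3:
  assumes "x < q" "p < q * q"
  shows "array_of [f a b c. a \<leftarrow> [0..<q], b \<leftarrow> [0..<q], c \<leftarrow> [0..<q]] (q * q * x + p) = f x (p div q) (p mod q)"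
proof -
  have q: "0 < q" using assms by simp
  let ?h = "\<lambda>a b. map (f a b) [0..<q]"
  let ?g = "\<lambda>a. concat (map (?h a) [0..<q])"
  have lg: "length (?g a) = q * q" for a using concat_blocks(1)[of q "?h a" q] by simp
  have "?g x ! (q * (p div q) + p mod q) = f x (p div q) (p mod q)"
    using concat_blocks(2)[of q "?h x" q "p div q" "p mod q"] assms q by (simp add: less_mult_imp_div_less)
  then have "concat (map ?g [0..<q]) ! (q * q * x + p) = f x (p div q) (p mod q)"
    using concat_blocks(2)[of q ?g "q * q" x p] assms lg by simp
  moreover have "q * q * x + p < length (concat (map ?g [0..<q]))"
    using concat_blocks(1)[of q ?g "q * q"] lg index2_less[OF assms] by (simp add: mult_ac)
  ultimately show ?thesis by (simp add: array_of_def)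
qed

text \<open>Zero outside the ranges of labels and rows, since the locale asks for nonnegativity at
  all arguments.\<close>

definition leaf_load :: "pbtl \<Rightarrow> nat \<Rightarrow> nat \<Rightarrow> real" where
  "leaf_load P l i = (if l < num_labels P \<and> i < nrows P
     then \<Sum>j<ncols P. constr P $$ (i, j) * real (lvec P l $ j) else 0)"

lemma load_le_iff:
  assumes "\<And>v. v \<in> leaves P \<Longrightarrow> lab v < num_labels P"
  shows "load_le P b lab \<longleftrightarrow> (\<forall>i<nrows P. (\<Sum>v\<in>leaves P. leaf_load P (lab v) i) \<le> b)"
proof -
  have "(constr P *\<^sub>v map_vec real (solution_vec P lab)) $ i = (\<Sum>v\<in>leaves P. leaf_load P (lab v) i)" if i: "i < nrows P" for i
  proof -
    have "(constr P *\<^sub>v map_vec real (solution_vec P lab)) $ i =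
        (\<Sum>j<ncols P. constr P $$ (i, j) * (\<Sum>v\<in>leaves P. real (lvec P (lab v) $ j)))"
      using i by (simp add: scalar_prod_def solution_vec_def nrows_def ncols_def lessThan_atLeast0)
    also have "\<dots> = (\<Sum>v\<in>leaves P. \<Sum>j<ncols P. constr P $$ (i, j) * real (lvec P (lab v) $ j))"
      by (simp add: sum_distrib_left sum.swap[of _ "leaves P"])
    also have "\<dots> = (\<Sum>v\<in>leaves P. leaf_load P (lab v) i)"
      using assms i by (intro sum.cong refl) (simp add: leaf_load_def)
    finally show ?thesis .
  qed
  then show ?thesis by (simp add: load_le_def less_eq_vec_def nrows_def)
qed

section \<open>Bounds\<close>

text \<open>The first bound limits the number of cuts by \<open>K\<close>; the second keeps
  \<open>2 ^ h\<close> within a factor \<open>4\<close> of the \<open>K\<close>-th root of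
  \<open>2 ^ H\<close>.\<close>

lemma block_height_bounds:
  fixes H K h :: nat
  assumes K: "0 < K" and h: "h = (\<Sum>x<H. if x * K < H then 1 else 0) + 1"
  shows "H \<le> h * K" "h \<le> H div K + 2"
proof -
  have c: "(\<Sum>x<H. if x < b then 1 else 0 :: nat) = min b H" for b :: nat by (simp add: sum_if_less)
  have "x * K < H" if "x < H div K" for x
  proof -
    have "x * K < H div K * K" using that K by simp
    also have "\<dots> \<le> H" by (rule div_times_less_eq_dividend)
    finally show ?thesis .
  qed
  then have "(\<Sum>x<H. if x < H div K then 1 else 0 :: nat) \<le> (\<Sum>x<H. if x * K < H then 1 else 0)"
    by (intro sum_mono) auto
  then have "H div K + 1 \<le> h" using h c[of "H div K"] div_le_dividend[of H K] by (simp add: min_absorb1)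
  then have "(H div K + 1) * K \<le> h * K" by (rule mult_right_mono) simp
  moreover have "H < (H div K + 1) * K" using K by (simp add: dividend_less_div_times)
  ultimately show "H \<le> h * K" by linarith
  have "x < H div K + 1" if "x * K < H" for x
    using that K by (metis less_Suc_eq_le Suc_eq_plus1 less_eq_div_iff_mult_less_eq less_imp_le_nat)
  then have "(\<Sum>x<H. if x * K < H then 1 else 0 :: nat) \<le> (\<Sum>x<H. if x < H div K + 1 then 1 else 0)"
    by (intro sum_mono) auto
  also have "\<dots> \<le> H div K + 1" by (simp only: c min.cobounded1)
  finally show "h \<le> H div K + 2" using h by linarith
qed

text \<open>By the choice of \<open>K\<close>, the factor \<open>2 ^ h\<close> is at most four times
  the \<open>\<epsilon>\<close>-th power of the number of leaves, and for
  \<open>\<epsilon> \<le> 1\<close> the number of layers is at most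
  \<open>3 / \<epsilon>\<close>.\<close>

lemma rounding_factor:
  fixes \<epsilon> :: real
  assumes \<epsilon>: "0 < \<epsilon>" and K: "K = nat \<lceil>1 / \<epsilon>\<rceil>" and h: "h \<le> H div K + 2"
  shows "2 ^ h * (real K + 1) \<le> 16 * max 1 (real (2 ^ H) powr \<epsilon> / \<epsilon>)"
proof -
  let ?n = "real (2 ^ H)" and ?M = "max 1 (real (2 ^ H) powr \<epsilon> / \<epsilon>)"
  have Kpos: "0 < K" using \<epsilon> K by simp
  have K1: "1 / \<epsilon> \<le> real K" "real K \<le> 1 / \<epsilon> + 1" using \<epsilon> K by (simp_all add: of_nat_ceiling)
  have n1: "1 \<le> ?n" by simp
  have "(2::real) ^ h \<le> 2 ^ (H div K + 2)" using h by (intro power_increasing) auto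
  also have "\<dots> = 4 * 2 powr real (H div K)" by (simp add: powr_realpow)
  also have "\<dots> \<le> 4 * 2 powr (real H / real K)" using of_nat_div_le_of_nat[of H K] by simp
  also have "2 powr (real H / real K) = ?n powr (1 / real K)" by (simp add: powr_powr flip: powr_realpow)
  finally have h4: "2 ^ h \<le> 4 * ?n powr (1 / real K)" .
  have "?n powr (1 / real K) * (real K + 1) \<le> 4 * ?M"
  proof (cases "\<epsilon> \<le> 1")
    case True
    have "1 / real K \<le> \<epsilon>" using K1(1) \<epsilon> Kpos by (simp add: field_simps)
    then have "?n powr (1 / real K) \<le> ?n powr \<epsilon>" using n1 by (intro powr_mono)
    moreover have "real K + 1 \<le> 3 / \<epsilon>" using K1(2) True \<epsilon> by (simp add: field_simps)
    ultimately have "?n powr (1 / real K) * (real K + 1) \<le> ?n powr \<epsilon> * (3 / \<epsilon>)" by (intro mult_mono) auto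
    also have "\<dots> = 3 * (?n powr \<epsilon> / \<epsilon>)" by simp
    also have "\<dots> \<le> 4 * ?M" by linarith
    finally show ?thesis .
  next
    case False
    \<comment> \<open>Now \<open>K = 1\<close> and the left side is \<open>2 * ?n\<close>, while
      division by a large \<open>\<epsilon>\<close> threatens the right side. For
      \<open>?n = 1\<close> the maximum with \<open>1\<close> saves the bound; for
      \<open>?n \<ge> 2\<close> the power outgrows the divisor.\<close>
    then have "0 < 1 / \<epsilon>" "1 / \<epsilon> \<le> 1" using \<epsilon> by auto
    then have "\<lceil>1 / \<epsilon>\<rceil> = 1" by linarith
    then have KK: "K = 1" using K by simp
    show ?thesis
    proof (cases "H = 0")
      case True
      then show ?thesis using KK by simp
    next
      case H: False
      have "(2::real) ^ 1 \<le> 2 ^ H" using H by (intro power_increasing) auto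
      then have n2: "2 \<le> ?n" by simp
      \<comment> \<open>Since \<open>ln 2\<close> is at least one half, this and
        \<open>1 + x \<le> exp x\<close> give
        \<open>\<epsilon> / 2 \<le> 2 powr (\<epsilon> - 1)\<close>.\<close>
      have "\<epsilon> / 2 \<le> 1 + (\<epsilon> - 1) * ln 2" 
      proof -
        have "(\<epsilon> - 1) * (1 / 2) \<le> (\<epsilon> - 1) * ln 2" using False ln2_ge_two_thirds by (intro mult_left_mono) auto
        then show ?thesis using False by (simp add: field_simps)
      qed
      also have "\<dots> \<le> exp ((\<epsilon> - 1) * ln 2)" by (rule exp_ge_add_one_self)
      also have "\<dots> = 2 powr (\<epsilon> - 1)" by (simp add: powr_def)
      also have "\<dots> \<le> ?n powr (\<epsilon> - 1)" using n2 False by (intro powr_mono2) auto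
      finally have "?n * (\<epsilon> / 2) \<le> ?n * ?n powr (\<epsilon> - 1)" using n1 by (intro mult_left_mono) auto
      also have "\<dots> = ?n powr \<epsilon>" using n1 by (simp add: powr_diff)
      finally have "?n / 2 \<le> ?n powr \<epsilon> / \<epsilon>" using \<epsilon> by (simp add: field_simps)
      moreover have "?n powr (1 / real K) * (real K + 1) = 2 * ?n" using KK by simp
      moreover have "?n powr \<epsilon> / \<epsilon> \<le> ?M" by simp
      ultimately show ?thesis by linarith
    qed
  qed
  then have "4 * (?n powr (1 / real K) * (real K + 1)) \<le> 4 * (4 * ?M)" by (rule mult_left_mono) simp
  moreover have "2 ^ h * (real K + 1) \<le> 4 * ?n powr (1 / real K) * (real K + 1)" using h4 by (intro mult_right_mono) auto
  ultimately show ?thesis by linarith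
qed

lemma ln_rows_le:
  assumes "0 < m" shows "ln (2 * real m + 1) \<le> 3 * max 1 (ln (real m))"
proof -
  have "ln (2 * real m + 1) \<le> ln (3 * real m)" using assms by (subst ln_le_cancel_iff) auto
  also have "\<dots> = ln 3 + ln (real m)" using assms by (simp add: ln_mult)
  also have "ln 3 \<le> (2::real)" using ln_le_minus_one[of "3::real"] by simp
  finally show ?thesis by linarith
qed

section \<open>The number of codes and the size of the parameters\<close>

context instance_tables
begin

lemma cuts_le_K:
  assumes "0 < K" shows "cuts h H \<le> K"
proof -
  have "h * cuts h H < H + h" by (rule cuts_bounds(2)[OF h])
  also have "\<dots> \<le> h * (K + 1)" using block_height_bounds(1)[OF assms h_eq] by simp
  finally show ?thesis using mult_less_cancel1[of h "cuts h H" "K + 1"] by linarith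
qed

lemma blocks_le_K: "0 < K \<Longrightarrow> real blocks \<le> real K + 1"
  using cuts_le_K by (simp add: blocks_def)

lemma bounded_input:
  assumes "nv \<sigma> ''H'' = H" "nv \<sigma> ''q'' = q" "nv \<sigma> ''m'' = m" "nv \<sigma> ''d'' = d"
    and "\<And>p. p \<in> params - {''H'', ''q'', ''m'', ''d''} \<Longrightarrow> nv \<sigma> p = 0"
  shows "bounded size_bound \<sigma>"
  unfolding bounded_def
proof
  fix p assume "p \<in> params"
  then show "nv \<sigma> p \<le> size_bound"
    using assms by (cases "p \<in> {''H'', ''q'', ''m'', ''d''}") (auto simp: size_bound_def)
qed

text \<open>The dominant parameter is \<open>T\<close>, equal to
  \<open>512 * n ^ 5 * (m + 1) ^ 3 * Q ^ 2\<close>; the others fit into the gap between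
  \<open>512\<close> and \<open>600\<close>. At most \<open>K\<close> cuts lie above a leaf, so
  \<open>Q\<close> is at most \<open>q ^ (K + 1)\<close>.\<close>

lemma size_bound_le:
  assumes "0 < K"
  shows "size_bound + 1 \<le> 600 * (n + m + d) ^ 8 * q ^ (2 * K + 2)"
proof -
  let ?S = "n + m + d"
  let ?X = "?S ^ 8 * Q ^ 2"
  have S: "1 \<le> ?S" using n_pos by (simp add: Suc_le_eq del: n_pos)
  have S8: "?S \<le> ?S ^ 8" using S power_increasing[of 1 8 ?S] by simp
  have QX: "1 \<le> Q" "q \<le> Q" using Q_pos q_le_Q by auto
  have Q2: "1 \<le> Q ^ 2" "Q \<le> Q ^ 2" "q * q \<le> Q ^ 2" "Q * q \<le> Q ^ 2"
    using QX mult_le_mono[OF QX(2,2)] by (simp_all add: power2_eq_square)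
  have SX: "x \<le> ?X" if "x \<le> ?S" for x
    using mult_le_mono[OF order_trans[OF that S8] Q2(1)] by simp
  have QXX: "y \<le> ?X" if "y \<le> Q ^ 2" for y
    using mult_le_mono[OF order_trans[OF S S8] that] by simp
  have "H < n" unfolding n_def by simp
  have "n ^ 5 * (m + 1) ^ 3 \<le> ?S ^ 5 * ?S ^ 3" using n_pos by (intro mult_le_mono power_mono) (simp_all add: Suc_le_eq del: n_pos)
  then have "n ^ 5 * (m + 1) ^ 3 \<le> ?S ^ 8" by (simp add: power_add[symmetric])
  then have "512 * (n ^ 5 * (m + 1) ^ 3) * Q ^ 2 \<le> 512 * ?S ^ 8 * Q ^ 2" by (intro mult_right_mono) simp_all
  moreover have "T = 512 * (n ^ 5 * (m + 1) ^ 3) * Q ^ 2"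
  proof -
    have "T = (4 * (m + 1)) * (2 * n) * Q * ((4 * (m + 1)) * (2 * n) ^ 4 * Q * (m + 1))" by (simp add: T_def theta_def B_def)
    also have "(4 * M) * (2 * n) * Q * ((4 * M) * (2 * n) ^ 4 * Q * M) = 512 * (n ^ 5 * M ^ 3) * Q ^ 2" for M
    proof -
      have "n ^ 5 = n * n ^ 4" by (simp add: numeral_eq_Suc)
      then show ?thesis by (simp add: power_mult_distrib power2_eq_square power3_eq_cube mult_ac)
    qed
    finally show ?thesis .
  qed
  ultimately have T: "T \<le> 512 * ?X" by (simp add: mult.assoc)
  have "H \<le> ?X" "1 \<le> ?X" "m \<le> ?X" "d \<le> ?X" "n \<le> ?X" by (rule SX, use \<open>H < n\<close> S in linarith)+
  moreover have "q \<le> ?X" "Q \<le> ?X" "q * q \<le> ?X" "Q * q \<le> ?X" by (rule QXX, use QX Q2 in linarith)+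
  ultimately have "size_bound + 1 \<le> 600 * ?X" using T unfolding size_bound_def by linarith
  also have "Q ^ 2 \<le> q ^ (2 * K + 2)"
    unfolding Q_def power_mult[symmetric] using cuts_le_K[OF assms] q_pos by (intro power_increasing) simp_all
  then have "600 * ?X \<le> 600 * (?S ^ 8 * q ^ (2 * K + 2))" by (intro mult_left_mono) simp_all
  finally show ?thesis by (simp add: mult.assoc)
qed

end

section \<open>The program for a given number of layers\<close>

text \<open>The cost bound does not see the constant assigned to \<open>K\<close>, so one polynomial
  serves every \<open>\<epsilon>\<close>; the final constant has to be chosen before
  \<open>\<epsilon>\<close>.\<close>

lemma cost_SetN_NC: "cost_list M (SetN x (NC k) # cs) = cost_list M (SetN x (NC k') # cs)"
  by simp

lemma bounded_run_mono: "M \<le> M' \<Longrightarrow> bounded_run M cs \<sigma> \<Longrightarrow> bounded_run M' cs \<sigma>"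
  by (induction cs arbitrary: \<sigma>) (auto simp: bounded_def intro: order_trans)

lemma bounded_run_append:
  "bounded_run M (xs @ ys) \<sigma> = (bounded_run M xs \<sigma> \<and> bounded_run M ys (fold psem xs \<sigma>))"
  by (induction xs arbitrary: \<sigma>) auto

definition program :: "nat \<Rightarrow> cmd list" where
  "program K = SetN ''K'' (NC K) # c_pre @ c_main"

definition start_env :: "pbtl \<Rightarrow> env" where
  "start_env P = \<lparr>nv = nvar (input_state P), na = narr (input_state P), ra = rarr (input_state P)\<rparr>"

lemma input_registers:
  "nvar (input_state P) = (\<lambda>_. 0)(''H'' := height P, ''q'' := num_labels P, ''root'' := root_label P, ''m'' := nrows P, ''d'' := ncols P)"
  by (simp add: input_state_def Let_def)

lemma valid_labeling_leaf:
  assumes "valid_labeling P lab" "v \<in> leaves P" shows "lab v < num_labels P"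
proof -
  have "0 < v" using assms(2) by (auto simp: leaves_def num_leaves_def)
  then show ?thesis using assms by (auto simp: valid_labeling_def vertices_def leaves_def labels_def)
qed

text \<open>The feasible labeling instantiates the locales and thereby the analysis; the program
  itself never receives it.\<close>

lemma algorithm_correct:
  fixes P :: pbtl and K :: nat
  assumes wf: "wf_pbtl P" and lab: "valid_labeling P lab" "load_le P 1 lab" and K: "0 < K"
    and M: "M = 600 * (num_leaves P + nrows P + ncols P) ^ 8 * num_labels P ^ (2 * K + 2)"
  shows "\<exists>t s'. t \<le> cost_list M (program K) \<and> run (comp_list (program K)) t (input_state P) = return_pmf ([], s') \<and>
    valid_labeling P (output_labeling s') \<and>
    (\<forall>i<nrows P. (\<Sum>v\<in>leaves P. leaf_load P (output_labeling s' v) i) \<le>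
       32 * 2 ^ ((\<Sum>x<height P. if x * K < height P then 1 else 0) + 1) * (real K + 1) * ln (2 * real (nrows P) + 1))"
proof -
  let ?G = "\<lambda>x y z. (x, y, z) \<in> triples P"
  let ?h = "(\<Sum>x<height P. if x * K < height P then 1 else 0) + 1 :: nat"
  let ?Am = "rarr (input_state P) ''A''" and ?xm = "rarr (input_state P) ''x''" and ?Gt = "narr (input_state P) ''Gamma''"
  have root: "root_label P < num_labels P" using wf by (simp add: wf_pbtl_def labels_def)
  have nn: "0 \<le> leaf_load P l i" for l i
    using wf by (auto simp: leaf_load_def wf_pbtl_def nrows_def ncols_def intro!: sum_nonneg)
  interpret block_tree "height P" "num_labels P" "nrows P" ?h "root_label P" "leaf_load P" ?G
    using root nn by unfold_locales auto
  have n_eq: "n = num_leaves P" by (simp add: n_def num_leaves_def)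
  have lv: "leaves P = {n..<2 * n}" by (simp add: leaves_def n_eq)
  interpret feasible_tree "height P" "num_labels P" "nrows P" ?h "root_label P" "leaf_load P" ?G lab
  proof
    show "lab 1 = root_label P" using lab(1) by (simp add: valid_labeling_def)
    show "lab v < num_labels P" if "0 < v" "v < 2 * n" for v
      using lab(1) that by (auto simp: valid_labeling_def vertices_def labels_def n_eq)
    show "(lab v, lab (2 * v), lab (2 * v + 1)) \<in> triples P" if "0 < v" "v < n" for v
      using lab(1) that by (auto simp: valid_labeling_def inner_vertices_def n_eq)
    show "(\<Sum>v=n..<2 * n. leaf_load P (lab v) i) \<le> 1" if "i < nrows P" for i
      using lab(2) that load_le_iff[of P lab 1] valid_labeling_leaf[OF lab(1)] by (simp add: lv)
  qed
  interpret instance_tables "height P" "num_labels P" "nrows P" ?h "root_label P" "leaf_load P" ?G lab "ncols P" K ?Am ?xm ?Gt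
  proof
    show "0 < ?Gt (num_labels P * num_labels P * x + p) \<longleftrightarrow> (x, p div num_labels P, p mod num_labels P) \<in> triples P"
      if "x < num_labels P" "p < num_labels P * num_labels P" for x p
      using array_of_table3[OF that, of "\<lambda>a b c. of_bool ((a, b, c) \<in> triples P) :: nat"]
      by (simp add: input_state_def Let_def)
    show "leaf_load P l i = (\<Sum>j<ncols P. ?Am (ncols P * i + j) * ?xm (ncols P * l + j))"
      if "l < num_labels P" "i < nrows P" for l i
      using array_of_table2[OF that(2), of _ "ncols P" "\<lambda>i j. constr P $$ (i, j)"]
        array_of_table2[OF that(1), of _ "ncols P" "\<lambda>l j. real (lvec P l $ j)"] that
      by (simp add: input_state_def Let_def leaf_load_def)
  qed simp
  let ?\<sigma> = "bind_nv (start_env P) ''K'' K"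
  have "start ?\<sigma>"
    by (simp add: start_def start_env_def input_registers) (simp add: input_state_def Let_def)
  moreover have "nv ?\<sigma> p = 0" if "p \<in> params - {''H'', ''q'', ''m'', ''d''}" for p
    using that by (auto simp: params_def start_env_def input_registers)
  ultimately have pre: "static (fold psem c_pre ?\<sigma>)" "ra (fold psem c_pre ?\<sigma>) ''W'' = (\<lambda>_. 0)" "bounded_run size_bound c_pre ?\<sigma>"
    using pre_phase[of ?\<sigma>] by blast+
  have "bounded size_bound (start_env P)"
    by (rule bounded_input) (auto simp: params_def start_env_def input_registers)
  then have "bounded_run size_bound (program K) (start_env P)"
    using pre(3) bounded_run_main[OF bounded_static[OF pre(1)], of c_main] set_vars_main
    by (simp add: program_def bounded_run_append)
  then have "bounded_run M (program K) (start_env P)" if "size_bound \<le> M"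
    using that bounded_run_mono by blast
  moreover have "size_bound \<le> M" using size_bound_le[OF K] by (simp add: M n_eq)
  moreover have "list_all wf_c (program K)"
    using wf_pre wf_main by (simp add: program_def user_name_def)
  moreover have "rel (start_env P) (input_state P)" by (simp add: rel_def start_env_def)
  ultimately obtain s' where s': "runs_in (comp_list (program K)) (cost_list M (program K)) (input_state P) s'"
    "rel (fold psem (program K) (start_env P)) s'"
    using correct_list by blast
  obtain t where t: "t \<le> cost_list M (program K)" "run (comp_list (program K)) t (input_state P) = return_pmf ([], s')"
    using runs_in_run[OF s'(1)] by blast
  have "fold psem (program K) (start_env P) = fold psem c_main (fold psem c_pre ?\<sigma>)" by (simp add: program_def)
  then have out: "output_labeling s' v = out v mod num_labels P" if "v < 2 * n" for v
    using s'(2) main_phase[OF pre(1,2)] that by (simp add: output_labeling_def rel_def)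
  have valid: "valid_labeling P (output_labeling s')"
    unfolding valid_labeling_def
  proof (intro conjI ballI)
    show "output_labeling s' v \<in> labels P" if "v \<in> vertices P" for v
      using that out[of v] q_pos by (simp add: vertices_def labels_def n_eq)
    show "output_labeling s' 1 = root_label P" using out[of 1] out_root root n_pos by simp
    show "(output_labeling s' v, output_labeling s' (2 * v), output_labeling s' (2 * v + 1)) \<in> triples P"
      if "v \<in> inner_vertices P" for v
      using that out_G[of v] out[of v] out[of "2 * v"] out[of "2 * v + 1"] by (simp add: inner_vertices_def n_eq)
  qed
  have "(\<Sum>v\<in>leaves P. leaf_load P (output_labeling s' v) i) \<le> 32 * 2 ^ ?h * (real K + 1) * ln (2 * real (nrows P) + 1)"
    if i: "i < nrows P" for i
  proof -
    have "(\<Sum>v\<in>leaves P. leaf_load P (output_labeling s' v) i) = (\<Sum>v=n..<2 * n. leaf_load P (out v mod num_labels P) i)"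
      unfolding lv by (intro sum.cong refl) (simp add: out)
    also have "\<dots> \<le> 32 * 2 ^ ?h * blocks * ln (2 * real (nrows P) + 1)" by (rule out_load[OF i])
    also have "\<dots> \<le> 32 * 2 ^ ?h * (real K + 1) * ln (2 * real (nrows P) + 1)"
      using blocks_le_K[OF K] by (intro mult_right_mono mult_left_mono) simp_all
    finally show ?thesis .
  qed
  with t valid show ?thesis by blast
qed

theorem theorem9:
  "\<exists>C::nat. \<forall>\<epsilon>::real. \<epsilon> > 0 \<longrightarrow>
     (\<exists>alg::com. \<forall>P::pbtl.
        wf_pbtl P \<longrightarrow>
        (\<exists>lab. valid_labeling P lab \<and> load_le P 1 lab) \<longrightarrow>
        (let n = num_leaves P; m = nrows P; d = ncols P in
         \<exists>t::nat.
           real t \<le> real C * real (card (labels P)) powr (real C * max 1 (1 / \<epsilon>))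
                       * real (n + m + d) ^ C \<and>
           halts_within alg t (input_state P) \<and>
           success_prob alg t (input_state P)
             (\<lambda>s. valid_labeling P (output_labeling s) \<and>
                  load_le P (real C * max 1 (real n powr \<epsilon> / \<epsilon>) * max 1 (ln (real m)))
                    (output_labeling s)) \<ge> 2 / 3))"
proof -
  obtain c where c: "\<And>M. cost_list M (program 0) \<le> c * (M + 1) ^ c"
    using poly_bounded_cost_list[of "program 0"] unfolding poly_bounded_def by blast
  have cost: "cost_list M (program K) \<le> c * (M + 1) ^ c" for M K
    using c[of M] cost_SetN_NC[of M "''K''" K "c_pre @ c_main" 0] by (simp add: program_def)
  \<comment> \<open>The terms cover the coefficient \<open>c * 601 ^ c\<close> of the running time,
    its exponents \<open>8 * c\<close> for the size and \<open>6 * c\<close> for the labels, and the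
    factor \<open>1536 = 32 * 16 * 3\<close> of the load bound.\<close>
  define C where "C = c * 601 ^ c + 14 * c + 2000"
  show ?thesis
  proof (intro exI[of _ C] allI impI)
    fix \<epsilon> :: real assume \<epsilon>: "0 < \<epsilon>"
    \<comment> \<open>The least \<open>K\<close> with \<open>1 / K \<le> \<epsilon>\<close>.\<close>
    define K where "K = nat \<lceil>1 / \<epsilon>\<rceil>"
    have K: "0 < K" using \<epsilon> by (simp add: K_def)
    let ?X = "max 1 (1 / \<epsilon>)"
    have KX: "real K \<le> 2 * ?X" using \<epsilon> unfolding K_def by (simp add: of_nat_ceiling) linarith
    show "\<exists>alg::com. \<forall>P::pbtl.
        wf_pbtl P \<longrightarrow>
        (\<exists>lab. valid_labeling P lab \<and> load_le P 1 lab) \<longrightarrow>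
        (let n = num_leaves P; m = nrows P; d = ncols P in
         \<exists>t::nat.
           real t \<le> real C * real (card (labels P)) powr (real C * max 1 (1 / \<epsilon>))
                       * real (n + m + d) ^ C \<and>
           halts_within alg t (input_state P) \<and>
           success_prob alg t (input_state P)
             (\<lambda>s. valid_labeling P (output_labeling s) \<and>
                  load_le P (real C * max 1 (real n powr \<epsilon> / \<epsilon>) * max 1 (ln (real m)))
                    (output_labeling s)) \<ge> 2 / 3)"
    proof (intro exI[of _ "comp_list (program K)"] allI impI)
      fix P :: pbtl
      assume wf: "wf_pbtl P" and "\<exists>lab. valid_labeling P lab \<and> load_le P 1 lab"
      then obtain lab where lab: "valid_labeling P lab" "load_le P 1 lab" by blast
      let ?n = "num_leaves P" and ?m = "nrows P" and ?d = "ncols P" and ?q = "num_labels P"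
      let ?S = "?n + ?m + ?d" and ?h = "(\<Sum>x<height P. if x * K < height P then 1 else 0) + 1 :: nat"
      let ?M = "600 * ?S ^ 8 * ?q ^ (2 * K + 2)"
      obtain t s' where t: "t \<le> cost_list ?M (program K)"
        and run: "run (comp_list (program K)) t (input_state P) = return_pmf ([], s')"
        and valid: "valid_labeling P (output_labeling s')"
        and load: "\<And>i. i < ?m \<Longrightarrow> (\<Sum>v\<in>leaves P. leaf_load P (output_labeling s' v) i) \<le>
          32 * 2 ^ ?h * (real K + 1) * ln (2 * real ?m + 1)"
        using algorithm_correct[OF wf lab K refl] by blast
      have S1: "1 \<le> ?S" by (simp add: num_leaves_def Suc_le_eq)
      have q1: "1 \<le> ?q" using wf by (auto simp: wf_pbtl_def labels_def)
      have "1 \<le> ?S ^ 8 * ?q ^ (2 * K + 2)" using S1 q1 by (simp add: Suc_le_eq)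
      then have "?M + 1 \<le> 601 * (?S ^ 8 * ?q ^ (2 * K + 2))" by linarith
      then have "c * (?M + 1) ^ c \<le> c * (601 * (?S ^ 8 * ?q ^ (2 * K + 2))) ^ c"
        by (intro mult_left_mono power_mono) simp_all
      also have "\<dots> = c * 601 ^ c * ?S ^ (8 * c) * ?q ^ ((2 * K + 2) * c)"
        by (simp only: power_mult_distrib power_mult mult.assoc)
      finally have "t \<le> c * 601 ^ c * ?S ^ (8 * c) * ?q ^ ((2 * K + 2) * c)" using t cost[of ?M K] by linarith
      then have "real t \<le> real (c * 601 ^ c) * real ?S ^ (8 * c) * real ?q ^ ((2 * K + 2) * c)"
        by (simp only: of_nat_le_iff flip: of_nat_mult of_nat_power)
      also have "\<dots> \<le> real C * real ?S ^ C * real ?q powr (real C * ?X)"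
      proof (intro mult_mono)
        show "real (c * 601 ^ c) \<le> real C" unfolding C_def by (intro of_nat_mono) simp
        show "real ?S ^ (8 * c) \<le> real ?S ^ C" using S1 by (intro power_increasing) (auto simp: C_def)
        have "real ((2 * K + 2) * c) = (2 * real K + 2) * real c" by (simp add: algebra_simps)
        also have "\<dots> \<le> (6 * ?X) * real c" using KX by (intro mult_right_mono) (auto simp: max_def)
        also have "\<dots> = (6 * real c) * ?X" by simp
        also have "\<dots> \<le> real C * ?X" by (intro mult_right_mono) (auto simp: C_def)
        finally have "real ((2 * K + 2) * c) \<le> real C * ?X" .
        then have "real ?q powr real ((2 * K + 2) * c) \<le> real ?q powr (real C * ?X)"
          using q1 by (intro powr_mono) auto
        then show "real ?q ^ ((2 * K + 2) * c) \<le> real ?q powr (real C * ?X)"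
          using q1 by (subst (asm) powr_realpow) auto
      qed auto
      finally have time: "real t \<le> real C * real (card (labels P)) powr (real C * ?X) * real ?S ^ C"
        by (simp add: labels_def mult_ac)
      have halt: "halts_within (comp_list (program K)) t (input_state P)"
        by (simp add: halts_within_def run)
      let ?F = "max 1 (real ?n powr \<epsilon> / \<epsilon>)" and ?L = "max 1 (ln (real ?m))"
      have "(\<Sum>v\<in>leaves P. leaf_load P (output_labeling s' v) i) \<le> real C * ?F * ?L" if i: "i < ?m" for i
      proof -
        have f: "2 ^ ?h * (real K + 1) \<le> 16 * ?F"
          unfolding num_leaves_def by (rule rounding_factor[OF \<epsilon> K_def block_height_bounds(2)[OF K refl]])
        have "2 ^ ?h * (real K + 1) * ln (2 * real ?m + 1) \<le> (16 * ?F) * (3 * ?L)"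
          using i by (intro mult_mono f ln_rows_le) auto
        then have "32 * 2 ^ ?h * (real K + 1) * ln (2 * real ?m + 1) \<le> 1536 * (?F * ?L)" by simp
        also have "\<dots> \<le> real C * (?F * ?L)" by (intro mult_right_mono) (auto simp: C_def)
        finally show ?thesis using load[OF i] by (simp add: mult.assoc)
      qed
      then have "load_le P (real C * ?F * ?L) (output_labeling s')"
        using load_le_iff[of P "output_labeling s'"] valid_labeling_leaf[OF valid] by blast
      \<comment> \<open>The run ends in a point mass, so the success probability is in fact
        \<open>1\<close>.\<close>
      then have "success_prob (comp_list (program K)) t (input_state P)
          (\<lambda>s. valid_labeling P (output_labeling s) \<and> load_le P (real C * ?F * ?L) (output_labeling s)) \<ge> 2 / 3"
        using valid by (simp add: success_prob_def run)
      with time halt show "let n = num_leaves P; m = nrows P; d = ncols P in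
         \<exists>t::nat.
           real t \<le> real C * real (card (labels P)) powr (real C * max 1 (1 / \<epsilon>))
                       * real (n + m + d) ^ C \<and>
           halts_within (comp_list (program K)) t (input_state P) \<and>
           success_prob (comp_list (program K)) t (input_state P)
             (\<lambda>s. valid_labeling P (output_labeling s) \<and>
                  load_le P (real C * max 1 (real n powr \<epsilon> / \<epsilon>) * max 1 (ln (real m)))
                    (output_labeling s)) \<ge> 2 / 3"
        unfolding Let_def by blast
    qed
  qed
qed

end
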